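(* Let $(L,\mathbb{F})$ be a Lévy process on $(\Omega,\mathscr{F},\mathbb{P};\mathbb{F})$ with finite horizon $T>0$, and assume that $L$ is not monotone, i.e. neither $L$ nor $-L$ is a subordinator. If the minimal entropy martingale measure (MEMM) $\mathbb{P}^*$ in $\hat{\mathscr{M}}^{\rm loc}_a$ exists, then the MEMM exists in each of the classes $\tilde{\mathscr{M}}_a$, $\mathscr{M}^{\rm loc}_a$, $\mathscr{M}_a$ and $\mathscr{M}_{efl}$, and it is the same measure $\mathbb{P}^*$.
   Context: Time runs over $[0,T]$, $\mathbb{F}=(\mathscr{F}_t)_{t\in[0,T]}$, and $(L,\mathbb{F})$ is a real-valued Lévy process with respect to $\mathbb{F}$ under $\mathbb{P}$ (càdlàg, $L_0=0$, $\mathbb{F}$-adapted, stationary increments $L_t-L_s$ independent of $\mathscr{F}_s$). Probability measures below are considered on $\mathscr{F}_T$. Relative entropy: $I_T(\mathbb{Q},\mathbb{P})=\mathbb{E}_{\mathbb{P}}\big[\frac{d\mathbb{Q}}{d\mathbb{P}}|_{\mathscr{F}_T}\log\frac{d\mathbb{Q}}{d\mathbb{P}}|_{\mathscr{F}_T}\big]$ if $\mathbb{Q}|_{\mathscr{F}_T}\ll\mathbb{P}|_{\mathscr{F}_T}$, and $+\infty$ otherwise. A MEMM in a class $\mathscr{C}$ is a $\mathbb{P}^*\in\mathscr{C}$ with $I_T(\mathbb{P}^*,\mathbb{P})=\inf_{\mathbb{Q}\in\mathscr{C}}I_T(\mathbb{Q},\mathbb{P})$. A probability measure $\mathbb{Q}$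 is Lévy preserving if $(L,\mathbb{F})$ is a Lévy process with respect to $\mathbb{Q}$. Classes (all measures $\mathbb{Q}$ satisfy $\mathbb{Q}|_{\mathscr{F}_T}\ll\mathbb{P}|_{\mathscr{F}_T}$): - $\mathscr{M}_a$: $(L,\mathbb{F})$ is a $\mathbb{Q}$-martingale. - $\mathscr{M}_{efl}$: $\mathbb{Q}|_{\mathscr{F}_T}\sim\mathbb{P}|_{\mathscr{F}_T}$, $(L,\mathbb{F})$ is a $\mathbb{Q}$-martingale, $I_T(\mathbb{Q},\mathbb{P})<+\infty$, and $\mathbb{Q}$ is Lévy preserving. - $\mathscr{M}^{\rm loc}_a$: $(L,\mathbb{F})$ is a $\mathbb{Q}$-local martingale. - $\tilde{\mathscr{M}}_a$: $\mathbb{E}_{\mathbb{Q}}[L_T]=0$ (in particular $L_T$ is $\mathbb{Q}$-integrable). - $\tilde{\mathscr{M}}^{\rm loc,0}_a$: $\mathbb{E}_{\mathbb{Q}}[|L_T|]<+\infty$ and there is a sequence $(\tau_k)_{k\ge1}$ of $\mathbb{F}$-stopping times such that $\{\tau_k=T\}\uparrow\Omega$ as $k\to\infty$ and $\mathbb{E}_{\mathbb{Q}}[L_{\tau_k\wedge T}]=0$ for all $k\ge1$. - $\hat{\mathscr{M}}^{\rm loc}_a=\mathscr{M}^{\rm loc}_a\cup\tilde{\mathscr{M}}^{\rm loc,0}_a$. *)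

theory Defs
  imports "HOL-Probability.Probability"
begin

text \<open>
  Processes and filtrations are indexed by \<^typ>\<open>real\<close>, and only their values at times in
  \<open>{0..T}\<close> matter. A filtration on \<open>{0..T}\<close> extends to the real line by taking \<open>F 0\<close> before
  time \<open>0\<close> and \<open>F T\<close> after time \<open>T\<close>, so the library locale \<^locale>\<open>filtration\<close> can be used
  without loss of generality.
\<close>

definition cadlag_on :: "real \<Rightarrow> (real \<Rightarrow> real) \<Rightarrow> bool" where
  "cadlag_on T f \<longleftrightarrow>
    (\<forall>t\<in>{0..<T}. continuous (at_right t) f) \<and>
    (\<forall>t\<in>{0<..T}. \<exists>l. (f \<longlongrightarrow> l) (at_left t))"

definition adapted_upto ::
  "real \<Rightarrow> (real \<Rightarrow> 'a measure) \<Rightarrow> (real \<Rightarrow> 'a \<Rightarrow> real) \<Rightarrow> bool" where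
  "adapted_upto T F X \<longleftrightarrow> (\<forall>t\<in>{0..T}. X t \<in> borel_measurable (F t))"

definition levy_process ::
  "'a measure \<Rightarrow> real \<Rightarrow> (real \<Rightarrow> 'a measure) \<Rightarrow> (real \<Rightarrow> 'a \<Rightarrow> real) \<Rightarrow> bool" where
  "levy_process M T F L \<longleftrightarrow>
    prob_space M \<and>
    adapted_upto T F L \<and>
    (\<forall>\<omega>\<in>space M. cadlag_on T (\<lambda>t. L t \<omega>)) \<and>
    (\<forall>\<omega>\<in>space M. L 0 \<omega> = 0) \<and>
    (\<forall>s t. 0 \<le> s \<and> s \<le> t \<and> t \<le> T \<longrightarrow>
      distr M borel (\<lambda>\<omega>. L t \<omega> - L s \<omega>) = distr M borel (\<lambda>\<omega>. L (t - s) \<omega> - L 0 \<omega>)) \<and>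
    (\<forall>s t. 0 \<le> s \<and> s \<le> t \<and> t \<le> T \<longrightarrow>
      prob_space.indep_set M (sets (F s))
        (sets (vimage_algebra (space M) (\<lambda>\<omega>. L t \<omega> - L s \<omega>) borel)))"

definition subordinator ::
  "'a measure \<Rightarrow> real \<Rightarrow> (real \<Rightarrow> 'a measure) \<Rightarrow> (real \<Rightarrow> 'a \<Rightarrow> real) \<Rightarrow> bool" where
  "subordinator M T F L \<longleftrightarrow>
    levy_process M T F L \<and> (AE \<omega> in M. mono_on {0..T} (\<lambda>t. L t \<omega>))"

definition martingale_upto ::
  "'a measure \<Rightarrow> real \<Rightarrow> (real \<Rightarrow> 'a measure) \<Rightarrow> (real \<Rightarrow> 'a \<Rightarrow> real) \<Rightarrow> bool" where
  "martingale_upto M T F X \<longleftrightarrow>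
    adapted_upto T F X \<and>
    (\<forall>t\<in>{0..T}. integrable M (X t)) \<and>
    (\<forall>s t. 0 \<le> s \<and> s \<le> t \<and> t \<le> T \<longrightarrow> (AE \<omega> in M. real_cond_exp M (F s) (X t) \<omega> = X s \<omega>))"

text \<open>
  For a time \<open>\<tau>\<close> with values in \<open>{0..T}\<close>, the conditions of \<^const>\<open>stopping_time\<close> at indices
  outside \<open>{0..T}\<close> hold trivially.
\<close>

definition stopping_time_upto :: "real \<Rightarrow> (real \<Rightarrow> 'a measure) \<Rightarrow> ('a \<Rightarrow> real) \<Rightarrow> bool" where
  "stopping_time_upto T F \<tau> \<longleftrightarrow> stopping_time F \<tau> \<and> (\<forall>\<omega>\<in>space (F T). \<tau> \<omega> \<in> {0..T})"

text \<open>
  On a finite horizon a localizing sequence has to reach \<open>T\<close> almost surely after finitely many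
  steps; convergence to \<open>T\<close> alone would not be enough.
\<close>

definition local_martingale_upto ::
  "'a measure \<Rightarrow> real \<Rightarrow> (real \<Rightarrow> 'a measure) \<Rightarrow> (real \<Rightarrow> 'a \<Rightarrow> real) \<Rightarrow> bool" where
  "local_martingale_upto M T F X \<longleftrightarrow>
    (\<exists>\<tau> :: nat \<Rightarrow> 'a \<Rightarrow> real.
      (\<forall>k. stopping_time_upto T F (\<tau> k)) \<and>
      (AE \<omega> in M. incseq (\<lambda>k. \<tau> k \<omega>)) \<and>
      (AE \<omega> in M. \<exists>k. \<tau> k \<omega> = T) \<and>
      (\<forall>k. martingale_upto M T F (\<lambda>t \<omega>. X (min t (\<tau> k \<omega>)) \<omega>)))"

text \<open>
  The expectation of \<open>Z log Z\<close> is taken in the extended sense, as positive part minus negative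
  part. The latter is finite because \<open>z log z \<ge> - 1 / e\<close>, so the value \<open>\<infinity>\<close> is attained when
  \<open>Z log Z\<close> is not integrable (\<open>KL_divergence\<close> would be \<open>0\<close> there).
  Note \<open>0 * ln 0 = 0\<close>.
\<close>

definition relative_entropy :: "'a measure \<Rightarrow> 'a measure \<Rightarrow> ereal" where
  "relative_entropy Q P =
    (if absolutely_continuous P Q
     then let Z = (\<lambda>\<omega>. enn2real (RN_deriv P Q \<omega>))
          in enn2ereal (\<integral>\<^sup>+ \<omega>. ennreal (Z \<omega> * ln (Z \<omega>)) \<partial>P)
             - enn2ereal (\<integral>\<^sup>+ \<omega>. ennreal (- (Z \<omega> * ln (Z \<omega>))) \<partial>P)
     else \<infinity>)"

definition is_MEMM ::
  "'a measure \<Rightarrow> real \<Rightarrow> (real \<Rightarrow> 'a measure) \<Rightarrow> 'a measure set \<Rightarrow> 'a measure \<Rightarrow> bool" where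
  "is_MEMM P T F C Q \<longleftrightarrow>
    Q \<in> C \<and>
    relative_entropy Q (restr_to_subalg P (F T)) =
      (INF R\<in>C. relative_entropy R (restr_to_subalg P (F T)))"

text \<open>
  The competing measures live on \<open>F T\<close>, whereas \<open>P\<close> may live on a larger sigma-algebra; hence
  the restriction of \<open>P\<close>.
\<close>

definition ac_measures :: "'a measure \<Rightarrow> real \<Rightarrow> (real \<Rightarrow> 'a measure) \<Rightarrow> 'a measure set" where
  "ac_measures P T F =
    {Q. prob_space Q \<and> sets Q = sets (F T) \<and>
        absolutely_continuous (restr_to_subalg P (F T)) Q}"

definition M_a ::
  "'a measure \<Rightarrow> real \<Rightarrow> (real \<Rightarrow> 'a measure) \<Rightarrow> (real \<Rightarrow> 'a \<Rightarrow> real) \<Rightarrow> 'a measure set" where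
  "M_a P T F L = {Q \<in> ac_measures P T F. martingale_upto Q T F L}"

definition M_efl ::
  "'a measure \<Rightarrow> real \<Rightarrow> (real \<Rightarrow> 'a measure) \<Rightarrow> (real \<Rightarrow> 'a \<Rightarrow> real) \<Rightarrow> 'a measure set" where
  "M_efl P T F L =
    {Q \<in> ac_measures P T F.
       absolutely_continuous Q (restr_to_subalg P (F T)) \<and>
       martingale_upto Q T F L \<and>
       relative_entropy Q (restr_to_subalg P (F T)) < \<infinity> \<and>
       levy_process Q T F L}"

definition M_loc_a ::
  "'a measure \<Rightarrow> real \<Rightarrow> (real \<Rightarrow> 'a measure) \<Rightarrow> (real \<Rightarrow> 'a \<Rightarrow> real) \<Rightarrow> 'a measure set" where
  "M_loc_a P T F L = {Q \<in> ac_measures P T F. local_martingale_upto Q T F L}"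

definition M_tilde_a ::
  "'a measure \<Rightarrow> real \<Rightarrow> (real \<Rightarrow> 'a measure) \<Rightarrow> (real \<Rightarrow> 'a \<Rightarrow> real) \<Rightarrow> 'a measure set" where
  "M_tilde_a P T F L =
    {Q \<in> ac_measures P T F. integrable Q (L T) \<and> (\<integral>\<omega>. L T \<omega> \<partial>Q) = 0}"

definition M_tilde_loc0_a ::
  "'a measure \<Rightarrow> real \<Rightarrow> (real \<Rightarrow> 'a measure) \<Rightarrow> (real \<Rightarrow> 'a \<Rightarrow> real) \<Rightarrow> 'a measure set" where
  "M_tilde_loc0_a P T F L =
    {Q \<in> ac_measures P T F.
       integrable Q (L T) \<and>
       (\<exists>\<tau> :: nat \<Rightarrow> 'a \<Rightarrow> real.
         (\<forall>k. stopping_time_upto T F (\<tau> k)) \<and>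
         incseq (\<lambda>k. {\<omega>\<in>space Q. \<tau> k \<omega> = T}) \<and>
         (\<Union>k. {\<omega>\<in>space Q. \<tau> k \<omega> = T}) = space Q \<and>
         (\<forall>k. integrable Q (\<lambda>\<omega>. L (min (\<tau> k \<omega>) T) \<omega>) \<and>
              (\<integral>\<omega>. L (min (\<tau> k \<omega>) T) \<omega> \<partial>Q) = 0))}"

definition M_hat_loc_a ::
  "'a measure \<Rightarrow> real \<Rightarrow> (real \<Rightarrow> 'a measure) \<Rightarrow> (real \<Rightarrow> 'a \<Rightarrow> real) \<Rightarrow> 'a measure set" where
  "M_hat_loc_a P T F L = M_loc_a P T F L \<union> M_tilde_loc0_a P T F L"

end

theory Submission
  imports Defs
begin

text \<open>
  For real \<open>u\<close> with \<open>c = E\<^sub>P exp (u * L\<^sub>T)\<close> finite, the Esscher measure is the measure on \<open>F T\<close> with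
  density \<open>exp (u * L\<^sub>T) / c\<close> with respect to \<open>P\<close>. The theorem holds because \<open>- ln c\<close>, for the \<open>u\<close> that
  minimises \<open>v \<mapsto> E\<^sub>P exp (v * L\<^sub>T)\<close>, is the infimum of the entropy over the largest class, and because
  the Esscher measure for this \<open>u\<close> is the only element of that class whose entropy can be so small.

  The infimum is at most \<open>- ln c\<close>. Since \<open>L\<close> is not monotone, \<open>L\<^sub>T\<close> takes both signs with positive
  probability (lemma \<open>subordinator_of_nonneg\<close>). Hence, for large \<open>n\<close>, the function
  \<open>v \<mapsto> E\<^sub>P [exp (v * L\<^sub>T); \<bar>L\<^sub>T\<bar> \<le> n]\<close> is finite and tends to infinity in both
  directions, and its minimiser \<open>v\<^sub>n\<close> gives a measure with bounded density under which \<open>L\<^sub>T\<close> is centred and whose entropy is minus the logarithm of the minimum. The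
  \<open>v\<^sub>n\<close> stay bounded; \<open>u\<close> is one of their limit points, and the minima have a limit that is at
  least \<open>c\<close> (lemma \<open>truncated_exponential_tilts\<close>).

  Conversely, an entropy of at most \<open>- ln c\<close> determines the measure. Let \<open>\<kappa> = ln c / T\<close>
  and let \<open>Q\<close> with density \<open>Z\<close> be in the largest class. In both
  parts of that class there are stopping times \<open>\<tau>\<^sub>k\<close>, eventually equal to \<open>T\<close>, at which \<open>L\<close> is
  \<open>Q\<close>-centred. With \<open>f\<^sub>k = u * L\<^sub>\<tau>\<^sub>k - \<kappa> * \<tau>\<^sub>k\<close> optional stopping gives \<open>E\<^sub>P exp f\<^sub>k \<le> 1\<close>, so the
  nonnegative function \<open>Z ln Z - Z f\<^sub>k - Z + exp f\<^sub>k\<close> has \<open>P\<close>-integral at most the entropy of \<open>Q\<close>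
  plus \<open>\<kappa> * E\<^sub>Q \<tau>\<^sub>k\<close>. If the entropy is at most \<open>- ln c = - \<kappa> * T\<close>, these integrals vanish in the
  limit, and Fatou's lemma yields \<open>Z = exp (u * L\<^sub>T) / c\<close> where \<open>Z > 0\<close>, hence everywhere
  (lemma \<open>esscher_of_relative_entropy_le\<close>). This identifies the given minimiser in the largest
  class as well as any minimiser in a smaller class that contains it.

  The Esscher measure lies in the smallest classes. Under it \<open>L\<close> is again a Levy process
  (lemma \<open>levy_setting_esscher\<close>). As an element of the largest class it has a centred localizing
  sequence. A stopping time that equals \<open>T\<close> with positive probability cannot hide a missing first
  moment, because after the stopping time the process starts afresh (lemma
  \<open>integrable_of_stopped_martingale\<close>); then Wald's identity \<open>E L\<^sub>\<tau> = E L\<^sub>T / T * E \<tau>\<close> makes \<open>L\<^sub>T\<close>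
  centred, and a centred Levy process is a martingale (lemmas \<open>wald_identity\<close> and
  \<open>martingale_of_mean_zero\<close>).
\<close>

section \<open>Levy processes on a finite horizon\<close>

text \<open>
  Collects the standing data, so that the same facts apply to \<open>P\<close>, to the Esscher measure, to the
  process \<open>- L\<close> and to shorter horizons. The measure may live on a larger sigma-algebra than \<open>F T\<close>.
\<close>
locale levy_setting =
  fixes M :: "'a measure" and T :: real and F :: "real \<Rightarrow> 'a measure" and L :: "real \<Rightarrow> 'a \<Rightarrow> real"
  assumes horizon_pos: "0 < T"
    and filtration_F: "filtration (space M) F"
    and subalgebra_F: "subalgebra M (F T)"
    and levy: "levy_process M T F L"

sublocale levy_setting \<subseteq> prob_space M
  using levy unfolding levy_process_def by blast

sublocale levy_setting \<subseteq> filtration "space M" F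
  by (rule filtration_F)

context levy_setting
begin

lemma subalgebra_le: "s \<le> T \<Longrightarrow> subalgebra M (F s)"
  using subalgebra_F sets_F_mono[of s T] by (auto simp: subalgebra_def space_F)

lemma measurable_from_F: "f \<in> measurable (F s) N \<Longrightarrow> s \<le> T \<Longrightarrow> f \<in> measurable M N"
  using measurable_from_subalg[OF subalgebra_le] .

lemma measurable_F_mono: "f \<in> measurable (F s) N \<Longrightarrow> s \<le> t \<Longrightarrow> f \<in> measurable (F t) N"
  by (rule measurable_from_subalg) (auto simp: subalgebra_def space_F sets_F_mono[THEN subsetD])

lemma cadlag_paths: "\<omega> \<in> space M \<Longrightarrow> cadlag_on T (\<lambda>t. L t \<omega>)"
  using levy unfolding levy_process_def by blast

lemma indep_set_increment:
  "0 \<le> s \<Longrightarrow> s \<le> t \<Longrightarrow> t \<le> T \<Longrightarrow>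
    indep_set (sets (F s)) (sets (vimage_algebra (space M) (\<lambda>\<omega>. L t \<omega> - L s \<omega>) borel))"
  using levy unfolding levy_process_def by blast

lemma L_measurable_F: "0 \<le> s \<Longrightarrow> s \<le> t \<Longrightarrow> t \<le> T \<Longrightarrow> L s \<in> borel_measurable (F t)"
proof (rule measurable_F_mono[of "L s" s])
  have "adapted_upto T F L"
    using levy unfolding levy_process_def by blast
  then show "0 \<le> s \<Longrightarrow> s \<le> t \<Longrightarrow> t \<le> T \<Longrightarrow> L s \<in> borel_measurable (F s)"
    by (simp add: adapted_upto_def)
qed

lemma L_measurable: "0 \<le> s \<Longrightarrow> s \<le> T \<Longrightarrow> L s \<in> borel_measurable M"
  using L_measurable_F[of s s] measurable_from_F by blast

lemma L_0: "\<omega> \<in> space M \<Longrightarrow> L 0 \<omega> = 0"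
  using levy unfolding levy_process_def by blast

lemma distr_increment:
  assumes "0 \<le> s" "s \<le> t" "t \<le> T"
  shows "distr M borel (\<lambda>\<omega>. L t \<omega> - L s \<omega>) = distr M borel (L (t - s))"
proof -
  have "distr M borel (\<lambda>\<omega>. L t \<omega> - L s \<omega>) = distr M borel (\<lambda>\<omega>. L (t - s) \<omega> - L 0 \<omega>)"
    using levy assms unfolding levy_process_def by blast
  also have "\<dots> = distr M borel (L (t - s))"
    by (rule distr_cong) (auto simp: L_0)
  finally show ?thesis .
qed

text \<open>
  The independence hypothesis speaks of sigma-algebras; integrals of products need it for
  functions of the past and of the increment.
\<close>
lemma indep_var_increment:
  fixes G :: "'a \<Rightarrow> 'b :: topological_space" and g :: "real \<Rightarrow> 'b"
  assumes st: "0 \<le> s" "s \<le> t" "t \<le> T"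
    and G: "G \<in> borel_measurable (F s)" and g: "g \<in> borel_measurable borel"
  shows "indep_var borel G borel (\<lambda>\<omega>. g (L t \<omega> - L s \<omega>))"
proof -
  let ?D = "\<lambda>\<omega>. L t \<omega> - L s \<omega>"
  have D[measurable]: "?D \<in> borel_measurable M"
    using st by (intro borel_measurable_diff L_measurable) auto
  have GM: "G \<in> borel_measurable M"
    using measurable_from_F[OF G] st by simp
  have gD: "(\<lambda>\<omega>. g (?D \<omega>)) \<in> borel_measurable M"
    using g by measurable
  have ind: "indep_set (sets (F s)) (sets (vimage_algebra (space M) ?D borel))"
    using st by (rule indep_set_increment)
  have "sigma_sets (space M) {G -` A \<inter> space M |A. A \<in> sets borel} \<subseteq> sets (F s)"
    using measurable_sets[OF G] space_F[of s]
    by (intro sets.sigma_sets_subset[of _ "F s", unfolded space_F]) auto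
  moreover have "sigma_sets (space M) {(\<lambda>\<omega>. g (?D \<omega>)) -` A \<inter> space M |A. A \<in> sets borel}
      \<subseteq> sets (vimage_algebra (space M) ?D borel)"
  proof -
    have "(\<lambda>\<omega>. g (?D \<omega>)) -` A \<inter> space M \<in> sets (vimage_algebra (space M) ?D borel)"
      if "A \<in> sets borel" for A
    proof -
      have "g -` A \<in> sets borel"
        using measurable_sets[OF g that] by simp
      then have "?D -` (g -` A) \<inter> space M \<in> sets (vimage_algebra (space M) ?D borel)"
        by (rule in_vimage_algebra)
      then show ?thesis by (simp add: vimage_def)
    qed
    then show ?thesis
      by (intro sets.sigma_sets_subset[of _ "vimage_algebra (space M) ?D borel", simplified]) auto
  qed
  ultimately have "indep_set (sigma_sets (space M) {G -` A \<inter> space M |A. A \<in> sets borel})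
      (sigma_sets (space M) {(\<lambda>\<omega>. g (?D \<omega>)) -` A \<inter> space M |A. A \<in> sets borel})"
    using ind unfolding indep_sets2_eq by blast
  then show ?thesis
    unfolding indep_var_eq using GM gD by simp
qed

text \<open>
  The form of the Markov property on which everything below rests: a weight from the past factors
  out, and the increment may be replaced by the value of the process after the elapsed time.
\<close>
lemma nn_integral_increment:
  assumes st: "0 \<le> s" "s \<le> t" "t \<le> T"
    and G: "G \<in> borel_measurable (F s)" and g: "g \<in> borel_measurable borel"
  shows "(\<integral>\<^sup>+\<omega>. G \<omega> * g (L t \<omega> - L s \<omega>) \<partial>M) = (\<integral>\<^sup>+\<omega>. G \<omega> \<partial>M) * (\<integral>\<^sup>+\<omega>. g (L (t - s) \<omega>) \<partial>M)"
proof -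
  let ?D = "\<lambda>\<omega>. L t \<omega> - L s \<omega>"
  have D: "?D \<in> borel_measurable M" "L (t - s) \<in> borel_measurable M"
    using st by (auto intro!: borel_measurable_diff L_measurable)
  have "indep_vars (\<lambda>_. borel) (case_bool G (\<lambda>\<omega>. g (?D \<omega>))) UNIV"
    using indep_var_increment[OF assms] unfolding indep_var_def
    by (rule indep_vars_cong[THEN iffD1, rotated -1]) (auto split: bool.split)
  from indep_vars_nn_integral[OF _ this]
  have "(\<integral>\<^sup>+\<omega>. G \<omega> * g (?D \<omega>) \<partial>M) = (\<integral>\<^sup>+\<omega>. G \<omega> \<partial>M) * (\<integral>\<^sup>+\<omega>. g (?D \<omega>) \<partial>M)"
    by (simp add: UNIV_bool mult.commute)
  also have "(\<integral>\<^sup>+\<omega>. g (?D \<omega>) \<partial>M) = (\<integral>\<^sup>+x. g x \<partial>distr M borel ?D)"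
    using D g by (simp add: nn_integral_distr)
  also have "\<dots> = (\<integral>\<^sup>+\<omega>. g (L (t - s) \<omega>) \<partial>M)"
    using D g st by (simp add: distr_increment nn_integral_distr)
  finally show ?thesis .
qed

lemma integral_increment:
  fixes G :: "'a \<Rightarrow> real"
  assumes st: "0 \<le> s" "s \<le> t" "t \<le> T"
    and G: "G \<in> borel_measurable (F s)" "integrable M G"
    and g: "g \<in> borel_measurable borel" "integrable M (\<lambda>\<omega>. g (L (t - s) \<omega>))"
  shows "integrable M (\<lambda>\<omega>. G \<omega> * g (L t \<omega> - L s \<omega>))" (is ?int)
    and "(\<integral>\<omega>. G \<omega> * g (L t \<omega> - L s \<omega>) \<partial>M) = (\<integral>\<omega>. G \<omega> \<partial>M) * (\<integral>\<omega>. g (L (t - s) \<omega>) \<partial>M)" (is ?eq)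
proof -
  let ?D = "\<lambda>\<omega>. L t \<omega> - L s \<omega>"
  have D: "?D \<in> borel_measurable M" "L (t - s) \<in> borel_measurable M"
    using st by (auto intro!: borel_measurable_diff L_measurable)
  have ind: "indep_var borel G borel (\<lambda>\<omega>. g (?D \<omega>))"
    by (rule indep_var_increment) (use st G g in auto)
  have int: "integrable M (\<lambda>\<omega>. g (?D \<omega>))"
  proof -
    have "integrable (distr M borel ?D) g"
      using g D st by (simp add: distr_increment integrable_distr_eq)
    then show ?thesis using D g by (simp add: integrable_distr_eq)
  qed
  show ?int using indep_var_integrable[OF ind G(2) int] .
  have "(\<integral>\<omega>. g (?D \<omega>) \<partial>M) = (\<integral>x. g x \<partial>distr M borel ?D)"
    using D g by (simp add: integral_distr)
  also have "\<dots> = (\<integral>\<omega>. g (L (t - s) \<omega>) \<partial>M)"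
    using D g st by (simp add: distr_increment integral_distr)
  finally show ?eq using indep_var_lebesgue_integral[OF ind G(2) int] by simp
qed

end

text \<open>
  Taking \<open>A\<close> to be the whole space in the product formula gives stationarity, and with stationarity
  the formula becomes independence. A change of measure or a reflection is easier to check in this
  form.
\<close>
lemma levy_processI:
  assumes filt: "filtration (space M) F" and sub: "subalgebra M (F T)" and M: "prob_space M"
    and meas: "\<And>t. 0 \<le> t \<Longrightarrow> t \<le> T \<Longrightarrow> X t \<in> borel_measurable (F t)"
    and cadlag: "\<And>\<omega>. \<omega> \<in> space M \<Longrightarrow> cadlag_on T (\<lambda>t. X t \<omega>)"
    and zero: "\<And>\<omega>. \<omega> \<in> space M \<Longrightarrow> X 0 \<omega> = 0"
    and prod: "\<And>s t A B. 0 \<le> s \<Longrightarrow> s \<le> t \<Longrightarrow> t \<le> T \<Longrightarrow> A \<in> sets (F s) \<Longrightarrow> B \<in> sets borel \<Longrightarrow>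
      measure M (A \<inter> {\<omega>\<in>space M. X t \<omega> - X s \<omega> \<in> B}) =
      measure M A * measure M {\<omega>\<in>space M. X (t - s) \<omega> \<in> B}"
  shows "levy_process M T F X"
proof -
  interpret prob_space M by fact
  interpret filtration "space M" F by fact
  have sub': "subalgebra M (F s)" if "s \<le> T" for s
    using sub sets_F_mono[of s T] that by (auto simp: subalgebra_def space_F)
  have XM: "X t \<in> borel_measurable M" if "0 \<le> t" "t \<le> T" for t
    using measurable_from_subalg[OF sub'] meas that by blast
  have marg: "measure M {\<omega>\<in>space M. X t \<omega> - X s \<omega> \<in> B} = measure M {\<omega>\<in>space M. X (t - s) \<omega> \<in> B}"
    if st: "0 \<le> s" "s \<le> t" "t \<le> T" and B: "B \<in> sets borel" for s t B
  proof -
    have "space M \<in> sets (F s)" using sets.top[of "F s"] by (simp add: space_F)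
    moreover have "space M \<inter> {\<omega>\<in>space M. X t \<omega> - X s \<omega> \<in> B} = {\<omega>\<in>space M. X t \<omega> - X s \<omega> \<in> B}" by auto
    ultimately show ?thesis using prod[OF st, of "space M" B] B by (simp add: prob_space)
  qed
  have d: "distr M borel (\<lambda>\<omega>. X t \<omega> - X s \<omega>) = distr M borel (\<lambda>\<omega>. X (t - s) \<omega> - X 0 \<omega>)"
    if st: "0 \<le> s" "s \<le> t" "t \<le> T" for s t
  proof (rule measure_eqI)
    fix B assume "B \<in> sets (distr M borel (\<lambda>\<omega>. X t \<omega> - X s \<omega>))"
    then have B: "B \<in> sets borel" by simp
    have m: "(\<lambda>\<omega>. X t \<omega> - X s \<omega>) \<in> borel_measurable M" "(\<lambda>\<omega>. X (t - s) \<omega> - X 0 \<omega>) \<in> borel_measurable M"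
      using st XM[of s] XM[of t] XM[of "t - s"] XM[of 0] by auto
    have "(\<lambda>\<omega>. X t \<omega> - X s \<omega>) -` B \<inter> space M = {\<omega>\<in>space M. X t \<omega> - X s \<omega> \<in> B}" by auto
    moreover have "(\<lambda>\<omega>. X (t - s) \<omega> - X 0 \<omega>) -` B \<inter> space M = {\<omega>\<in>space M. X (t - s) \<omega> \<in> B}"
      using zero by auto
    ultimately show "emeasure (distr M borel (\<lambda>\<omega>. X t \<omega> - X s \<omega>)) B =
        emeasure (distr M borel (\<lambda>\<omega>. X (t - s) \<omega> - X 0 \<omega>)) B"
      using m B marg[OF st B] by (simp add: emeasure_distr emeasure_eq_measure)
  qed simp
  have i: "indep_set (sets (F s)) (sets (vimage_algebra (space M) (\<lambda>\<omega>. X t \<omega> - X s \<omega>) borel))"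
    if st: "0 \<le> s" "s \<le> t" "t \<le> T" for s t
  proof (rule indep_setI)
    have m: "(\<lambda>\<omega>. X t \<omega> - X s \<omega>) \<in> borel_measurable M"
      using st XM[of s] XM[of t] by auto
    show "sets (F s) \<subseteq> events" using sub' st by (auto simp: subalgebra_def)
    show "sets (vimage_algebra (space M) (\<lambda>\<omega>. X t \<omega> - X s \<omega>) borel) \<subseteq> events"
      using measurable_sets[OF m] by (auto simp: sets_vimage_algebra2)
    fix a b assume a: "a \<in> sets (F s)"
      and b: "b \<in> sets (vimage_algebra (space M) (\<lambda>\<omega>. X t \<omega> - X s \<omega>) borel)"
    from b obtain B where B: "B \<in> sets borel" "b = {\<omega>\<in>space M. X t \<omega> - X s \<omega> \<in> B}"
      by (auto simp: sets_vimage_algebra2 vimage_def Int_def conj_commute)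
    show "prob (a \<inter> b) = prob a * prob b"
      using prod[OF st a B(1)] marg[OF st B(1)] by (simp add: B(2))
  qed
  show ?thesis
    unfolding levy_process_def adapted_upto_def
    by (intro conjI ballI allI impI M meas cadlag zero d i) auto
qed

lemma (in levy_setting) prob_increment:
  assumes st: "0 \<le> s" "s \<le> t" "t \<le> T" and A: "A \<in> sets (F s)" and B: "B \<in> sets borel"
  shows "prob (A \<inter> {\<omega>\<in>space M. L t \<omega> - L s \<omega> \<in> B}) = prob A * prob {\<omega>\<in>space M. L (t - s) \<omega> \<in> B}"
proof -
  let ?D = "\<lambda>\<omega>. L t \<omega> - L s \<omega>"
  have m: "?D \<in> borel_measurable M" "L (t - s) \<in> borel_measurable M"
    using st by (auto intro!: borel_measurable_diff L_measurable)
  have eq: "{\<omega>\<in>space M. ?D \<omega> \<in> B} = ?D -` B \<inter> space M"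
    "{\<omega>\<in>space M. L (t - s) \<omega> \<in> B} = L (t - s) -` B \<inter> space M" by auto
  have "indep_set (sets (F s)) (sets (vimage_algebra (space M) ?D borel))"
    using st by (rule indep_set_increment)
  from indep_setD[OF this A in_vimage_algebra[OF B]]
  have "prob (A \<inter> {\<omega>\<in>space M. ?D \<omega> \<in> B}) = prob A * prob {\<omega>\<in>space M. ?D \<omega> \<in> B}"
    by (simp only: eq)
  also have "prob {\<omega>\<in>space M. ?D \<omega> \<in> B} = measure (distr M borel ?D) B"
    using m(1) B by (simp only: eq measure_distr)
  also have "\<dots> = prob {\<omega>\<in>space M. L (t - s) \<omega> \<in> B}"
    unfolding distr_increment[OF st] using m(2) B by (simp only: eq measure_distr)
  finally show ?thesis .
qed

lemma (in levy_setting) levy_setting_uminus: "levy_setting M T F (\<lambda>t \<omega>. - L t \<omega>)"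
proof
  show "levy_process M T F (\<lambda>t \<omega>. - L t \<omega>)"
  proof (rule levy_processI)
    fix s t A and B :: "real set"
    assume st: "0 \<le> s" "s \<le> t" "t \<le> T" and A: "A \<in> sets (F s)" and B: "B \<in> sets borel"
    have B': "uminus -` B \<in> sets borel"
      using measurable_sets[OF borel_measurable_uminus[OF measurable_ident] B] by simp
    have "- a + b \<in> B \<longleftrightarrow> a - b \<in> uminus -` B" for a b :: real by simp
    then show "prob (A \<inter> {\<omega> \<in> space M. - L t \<omega> - - L s \<omega> \<in> B}) = prob A * prob {\<omega> \<in> space M. - L (t - s) \<omega> \<in> B}"
      using prob_increment[OF st A B'] by simp
  next
    show "cadlag_on T (\<lambda>t. - L t \<omega>)" if "\<omega> \<in> space M" for \<omega>
      using cadlag_paths[OF that] unfolding cadlag_on_def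
      by (fast intro: continuous_minus tendsto_minus)
  qed (use filtration_F subalgebra_F L_0 L_measurable_F prob_space_axioms in auto)
qed (use horizon_pos filtration_F subalgebra_F in auto)

section \<open>Sampling at the points of a time grid\<close>

text \<open>
  The smallest point of the grid of mesh \<open>T / (n + 1)\<close> that is not before \<open>t\<close>. Rounding up, rather
  than down, turns stopping times into stopping times and matches right-continuity of the paths.
\<close>
definition upper_grid :: "real \<Rightarrow> nat \<Rightarrow> real \<Rightarrow> real" where
  "upper_grid T n t = T / real (Suc n) * of_int \<lceil>real (Suc n) * t / T\<rceil>"

definition grid_points :: "real \<Rightarrow> nat \<Rightarrow> real set" where
  "grid_points T n = (\<lambda>i. T / real (Suc n) * real i) ` {..Suc n}"

lemma finite_grid_points [simp]: "finite (grid_points T n)"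
  by (simp add: grid_points_def)

context
  fixes T :: real assumes T: "0 < T"
begin

lemma upper_grid_ge: "t \<le> upper_grid T n t"
proof -
  have "real (Suc n) * t / T \<le> of_int \<lceil>real (Suc n) * t / T\<rceil>" by (rule le_of_int_ceiling)
  from mult_left_mono[OF this, of "T / real (Suc n)"] show ?thesis
    using T by (simp add: upper_grid_def)
qed

lemma upper_grid_less: "upper_grid T n t < t + T / real (Suc n)"
proof -
  have "of_int \<lceil>real (Suc n) * t / T\<rceil> < real (Suc n) * t / T + 1" by linarith
  from mult_strict_left_mono[OF this, of "T / real (Suc n)"] show ?thesis
    using T by (simp add: upper_grid_def distrib_left del: of_nat_Suc)
qed

lemma upper_grid_mono: "s \<le> t \<Longrightarrow> upper_grid T n s \<le> upper_grid T n t"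
  using T unfolding upper_grid_def
  by (intro mult_left_mono of_int_le_iff[THEN iffD2] ceiling_mono divide_right_mono) auto

lemma upper_grid_self: "upper_grid T n T = T"
  using T by (simp add: upper_grid_def del: of_nat_Suc)

lemma upper_grid_le: "t \<le> T \<Longrightarrow> upper_grid T n t \<le> T"
  using upper_grid_mono[of t T n] by (simp add: upper_grid_self)

lemma upper_grid_tendsto: "(\<lambda>n. upper_grid T n t) \<longlonglongrightarrow> t"
proof (rule tendsto_sandwich[of "\<lambda>_. t" _ _ "\<lambda>n. t + T / real (Suc n)"])
  have "(\<lambda>n. t + T * inverse (real (Suc n))) \<longlonglongrightarrow> t + T * 0"
    by (intro tendsto_intros LIMSEQ_inverse_real_of_nat)
  then show "(\<lambda>n. t + T / real (Suc n)) \<longlonglongrightarrow> t" by (simp add: divide_inverse)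
qed (auto intro!: always_eventually less_imp_le[OF upper_grid_less] upper_grid_ge simp del: of_nat_Suc)

lemma upper_grid_in_grid_points:
  assumes "0 \<le> t" "t \<le> T" shows "upper_grid T n t \<in> grid_points T n"
proof -
  let ?c = "\<lceil>real (Suc n) * t / T\<rceil>"
  have "0 \<le> ?c" using assms T by (simp add: ceiling_le_iff less_ceiling_iff order_less_le_trans[of "-1" 0])
  moreover have "?c \<le> int (Suc n)"
  proof -
    have "real (Suc n) * t / T \<le> real (Suc n)"
      using assms T by (simp add: divide_le_eq mult_left_mono del: of_nat_Suc)
    then show ?thesis by (simp add: ceiling_le_iff del: of_nat_Suc)
  qed
  ultimately obtain k where "?c = int k" "k \<le> Suc n"
    by (metis nonneg_int_cases of_nat_le_iff)
  then show ?thesis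
    unfolding grid_points_def upper_grid_def by (intro image_eqI[of _ _ k]) (simp_all del: of_nat_Suc)
qed

lemma grid_points_bounds: "r \<in> grid_points T n \<Longrightarrow> 0 \<le> r \<and> r \<le> T"
  using T by (auto simp: grid_points_def divide_le_eq mult_left_mono simp del: of_nat_Suc)

text \<open>
  Makes the events of a rounded stopping time expressible by the events of the stopping time itself.
\<close>
lemma upper_grid_le_grid_point_iff:
  assumes "r \<in> grid_points T n" shows "upper_grid T n t \<le> r \<longleftrightarrow> t \<le> r"
proof
  assume "t \<le> r"
  obtain i where r: "r = T / real (Suc n) * real i" using assms by (auto simp: grid_points_def)
  have "upper_grid T n t \<le> upper_grid T n r" by (rule upper_grid_mono) fact
  also have "upper_grid T n r = r" using T by (simp add: upper_grid_def r del: of_nat_Suc)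
  finally show "upper_grid T n t \<le> r" .
qed (use upper_grid_ge[of t n] in linarith)

text \<open>
  Right-continuity gives the claim before \<open>T\<close>; at \<open>T\<close> itself, where only a left limit is
  assumed, the grid point is \<open>T\<close>.
\<close>
lemma cadlag_upper_grid_tendsto:
  assumes f: "cadlag_on T f" and t: "0 \<le> t" "t \<le> T"
  shows "(\<lambda>n. f (upper_grid T n t)) \<longlonglongrightarrow> f t"
proof (cases "t = T")
  case True
  then show ?thesis by (simp add: upper_grid_self)
next
  case False
  then have "(f \<longlongrightarrow> f t) (at_right t)"
    using f t by (simp add: cadlag_on_def continuous_within)
  show ?thesis
  proof (rule LIMSEQ_I)
    fix e :: real assume "0 < e"
    with \<open>(f \<longlongrightarrow> f t) (at_right t)\<close> obtain d where d: "d > 0"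
      "\<And>y. t < y \<Longrightarrow> 0 < dist y t \<Longrightarrow> dist y t < d \<Longrightarrow> dist (f y) (f t) < e"
      unfolding Lim_within by (metis greaterThan_iff)
    from LIMSEQ_D[OF upper_grid_tendsto[of t] d(1)] obtain N where
      N: "\<And>n. n \<ge> N \<Longrightarrow> norm (upper_grid T n t - t) < d" by blast
    show "\<exists>N. \<forall>n\<ge>N. norm (f (upper_grid T n t) - f t) < e"
    proof (intro exI[of _ N] allI impI)
      fix n assume "n \<ge> N"
      from N[OF this] d(2)[of "upper_grid T n t"] upper_grid_ge[of t n] \<open>0 < e\<close>
      show "norm (f (upper_grid T n t) - f t) < e"
        by (cases "upper_grid T n t = t") (auto simp: dist_real_def)
    qed
  qed
qed

end

context levy_setting
begin

lemma L_upper_grid_tendsto: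
  "\<omega> \<in> space M \<Longrightarrow> 0 \<le> t \<Longrightarrow> t \<le> T \<Longrightarrow> (\<lambda>n. L (upper_grid T n t) \<omega>) \<longlonglongrightarrow> L t \<omega>"
  using cadlag_upper_grid_tendsto[OF horizon_pos cadlag_paths] .

text \<open>
  Lets statements about the terminal time \<open>T\<close> be applied to every earlier time.
\<close>
lemma levy_setting_shorter_horizon:
  assumes s: "0 < s" "s \<le> T" shows "levy_setting M s F L"
proof
  have "adapted_upto T F L" "\<forall>\<omega>\<in>space M. cadlag_on T (\<lambda>t. L t \<omega>)"
    using levy unfolding levy_process_def by blast+
  then have "adapted_upto s F L" "\<forall>\<omega>\<in>space M. cadlag_on s (\<lambda>t. L t \<omega>)"
    using s unfolding adapted_upto_def cadlag_on_def by auto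
  moreover have "\<And>u. u \<le> s \<Longrightarrow> u \<le> T" using s by simp
  ultimately show "levy_process M s F L"
    using levy unfolding levy_process_def by blast
qed (use s subalgebra_le filtration_F in auto)

context
  fixes \<tau> :: "'a \<Rightarrow> real"
  assumes stopping: "stopping_time_upto T F \<tau>"
begin

lemma stopping_bounds: "\<omega> \<in> space M \<Longrightarrow> 0 \<le> \<tau> \<omega> \<and> \<tau> \<omega> \<le> T"
  using stopping by (simp add: stopping_time_upto_def space_F)

lemma stopping_le_sets: "{\<omega>\<in>space M. \<tau> \<omega> \<le> t} \<in> sets (F t)"
proof -
  have "Measurable.pred (F t) (\<lambda>\<omega>. \<tau> \<omega> \<le> t)"
    using stopping by (auto simp: stopping_time_upto_def dest: stopping_timeD)
  then show ?thesis by (simp add: pred_def space_F)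
qed

lemma stopping_measurable: "\<tau> \<in> borel_measurable (F T)"
proof (rule borel_measurableI_le)
  fix t
  show "{\<omega> \<in> space (F T). \<tau> \<omega> \<le> t} \<in> sets (F T)"
  proof (cases "t \<le> T")
    case True
    then show ?thesis using stopping_le_sets[of t] sets_F_mono[of t T] by (auto simp: space_F)
  next
    case False
    then have "{\<omega> \<in> space (F T). \<tau> \<omega> \<le> t} = space (F T)"
      using stopping_bounds by (force simp: space_F)
    then show ?thesis by simp
  qed
qed

lemma grid_stopping_sets:
  assumes r: "r \<in> grid_points T n"
  shows "{\<omega>\<in>space M. upper_grid T n (\<tau> \<omega>) = r} \<in> sets (F r)"
proof -
  let ?S = "{q\<in>grid_points T n. q < r}"
  have fin: "finite ?S" by simp
  have "{\<omega>\<in>space M. upper_grid T n (\<tau> \<omega>) = r} =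
      {\<omega>\<in>space M. \<tau> \<omega> \<le> r} - (\<Union>q\<in>?S. {\<omega>\<in>space M. \<tau> \<omega> \<le> q})" (is "?A = ?B")
  proof (intro set_eqI iffI)
    fix \<omega> assume "\<omega> \<in> ?A"
    then show "\<omega> \<in> ?B"
      using upper_grid_le_grid_point_iff[OF horizon_pos, of _ n "\<tau> \<omega>"] r by (force simp: not_le)
  next
    fix \<omega> assume \<omega>: "\<omega> \<in> ?B"
    then have "upper_grid T n (\<tau> \<omega>) \<in> grid_points T n"
      using stopping_bounds by (intro upper_grid_in_grid_points horizon_pos) auto
    moreover have "upper_grid T n (\<tau> \<omega>) \<le> r"
      using \<omega> upper_grid_le_grid_point_iff[OF horizon_pos r] by auto
    moreover have "\<tau> \<omega> \<le> upper_grid T n (\<tau> \<omega>)" by (rule upper_grid_ge[OF horizon_pos])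
    ultimately show "\<omega> \<in> ?A" using \<omega> by force
  qed
  moreover have "{\<omega>\<in>space M. \<tau> \<omega> \<le> q} \<in> sets (F r)" if "q \<le> r" for q
    using stopping_le_sets[of q] sets_F_mono[OF that] by auto
  ultimately show ?thesis by (auto intro!: sets.Diff sets.finite_UN)
qed

lemma grid_stopping_measurable:
  "(\<lambda>\<omega>. upper_grid T n (\<tau> \<omega>)) \<in> measurable (F T) (count_space (grid_points T n))"
proof -
  have "(\<lambda>\<omega>. upper_grid T n (\<tau> \<omega>)) -` {r} \<inter> space (F T) \<in> sets (F T)" if "r \<in> grid_points T n" for r
  proof -
    have "(\<lambda>\<omega>. upper_grid T n (\<tau> \<omega>)) -` {r} \<inter> space (F T) = {\<omega>\<in>space M. upper_grid T n (\<tau> \<omega>) = r}"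
      by (auto simp: space_F)
    then show ?thesis
      using grid_stopping_sets[OF that] sets_F_mono[of r T] grid_points_bounds[OF horizon_pos that] by auto
  qed
  moreover have "(\<lambda>\<omega>. upper_grid T n (\<tau> \<omega>)) \<in> space (F T) \<rightarrow> grid_points T n"
    using stopping_bounds by (auto simp: space_F intro!: upper_grid_in_grid_points horizon_pos)
  ultimately show ?thesis by (simp add: measurable_count_space_eq2)
qed

lemma measurable_at_grid_stopping:
  assumes "\<And>r. r \<in> grid_points T n \<Longrightarrow> H r \<in> measurable (F T) N"
  shows "(\<lambda>\<omega>. H (upper_grid T n (\<tau> \<omega>)) \<omega>) \<in> measurable (F T) N"
  by (rule measurable_compose_countable'[OF assms grid_stopping_measurable])
    (auto intro: countable_finite)

lemma L_grid_stopping_measurable: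
  "(\<lambda>\<omega>. L (upper_grid T n (\<tau> \<omega>)) \<omega>) \<in> borel_measurable (F T)"
  by (rule measurable_at_grid_stopping) (use grid_points_bounds[OF horizon_pos] L_measurable_F in auto)

lemma L_stopping_measurable: "(\<lambda>\<omega>. L (\<tau> \<omega>) \<omega>) \<in> borel_measurable (F T)"
  by (rule borel_measurable_LIMSEQ_real[OF _ L_grid_stopping_measurable])
    (use stopping_bounds in \<open>auto simp: space_F intro!: L_upper_grid_tendsto\<close>)

text \<open>
  The strong Markov property for a stopping time with finitely many values: it follows from
  the Markov property on each event where the rounded stopping time has a given value. Both functions
  may depend on that value, so that terms like \<open>\<kappa> * \<tau>\<close> can be included.
\<close>
lemma nn_integral_increment_after_grid_stopping:
  assumes G: "\<And>r. r \<in> grid_points T n \<Longrightarrow> G r \<in> borel_measurable (F r)"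
    and g: "\<And>r. r \<in> grid_points T n \<Longrightarrow> g r \<in> borel_measurable borel"
  shows "(\<integral>\<^sup>+\<omega>. G (upper_grid T n (\<tau> \<omega>)) \<omega> *
        g (upper_grid T n (\<tau> \<omega>)) (L T \<omega> - L (upper_grid T n (\<tau> \<omega>)) \<omega>) \<partial>M) =
      (\<integral>\<^sup>+\<omega>. G (upper_grid T n (\<tau> \<omega>)) \<omega> *
        (\<integral>\<^sup>+\<omega>'. g (upper_grid T n (\<tau> \<omega>)) (L (T - upper_grid T n (\<tau> \<omega>)) \<omega>') \<partial>M) \<partial>M)"
    (is "(\<integral>\<^sup>+\<omega>. G (?d \<omega>) \<omega> * _ \<omega> \<partial>M) = _")
proof -
  \<comment> \<open>Decomposition according to the value of the rounded stopping time.\<close>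
  have split: "(\<integral>\<^sup>+\<omega>. K (?d \<omega>) \<omega> \<partial>M) =
      (\<Sum>r\<in>grid_points T n. \<integral>\<^sup>+\<omega>. indicator {\<omega>\<in>space M. ?d \<omega> = r} \<omega> * K r \<omega> \<partial>M)"
    if K: "\<And>r. r \<in> grid_points T n \<Longrightarrow> K r \<in> borel_measurable M" for K :: "real \<Rightarrow> 'a \<Rightarrow> ennreal"
  proof -
    have "{\<omega>\<in>space M. ?d \<omega> = r} \<in> sets M" if "r \<in> grid_points T n" for r
      using grid_stopping_sets[OF that] subalgebra_le[of r] grid_points_bounds[OF horizon_pos that]
      by (auto simp: subalgebra_def)
    then have "(\<Sum>r\<in>grid_points T n. \<integral>\<^sup>+\<omega>. indicator {\<omega>\<in>space M. ?d \<omega> = r} \<omega> * K r \<omega> \<partial>M) =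
        (\<integral>\<^sup>+\<omega>. (\<Sum>r\<in>grid_points T n. indicator {\<omega>\<in>space M. ?d \<omega> = r} \<omega> * K r \<omega>) \<partial>M)"
      using K by (intro nn_integral_sum[symmetric]) auto
    also have "\<dots> = (\<integral>\<^sup>+\<omega>. K (?d \<omega>) \<omega> \<partial>M)"
    proof (rule nn_integral_cong)
      fix \<omega> assume \<omega>: "\<omega> \<in> space M"
      then have "?d \<omega> \<in> grid_points T n"
        using stopping_bounds by (intro upper_grid_in_grid_points horizon_pos) auto
      then have "K (?d \<omega>) \<omega> = (\<Sum>r\<in>grid_points T n. if r = ?d \<omega> then K r \<omega> else 0)"
        by (subst sum.delta) auto
      also have "\<dots> = (\<Sum>r\<in>grid_points T n. indicator {\<omega>\<in>space M. ?d \<omega> = r} \<omega> * K r \<omega>)"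
        using \<omega> by (intro sum.cong) auto
      finally show "(\<Sum>r\<in>grid_points T n. indicator {\<omega>\<in>space M. ?d \<omega> = r} \<omega> * K r \<omega>) = K (?d \<omega>) \<omega>" ..
    qed
    finally show ?thesis ..
  qed
  have Gm: "G r \<in> borel_measurable M" if "r \<in> grid_points T n" for r
    using measurable_from_F[OF G[OF that]] grid_points_bounds[OF horizon_pos that] by simp
  have gm: "(\<lambda>\<omega>. g r (L T \<omega> - L r \<omega>)) \<in> borel_measurable M" if "r \<in> grid_points T n" for r
    using grid_points_bounds[OF horizon_pos that] horizon_pos
    by (intro measurable_compose[OF _ g[OF that]] borel_measurable_diff L_measurable) auto
  have "(\<integral>\<^sup>+\<omega>. G (?d \<omega>) \<omega> * g (?d \<omega>) (L T \<omega> - L (?d \<omega>) \<omega>) \<partial>M) =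
      (\<Sum>r\<in>grid_points T n. \<integral>\<^sup>+\<omega>. indicator {\<omega>\<in>space M. ?d \<omega> = r} \<omega> *
        (G r \<omega> * g r (L T \<omega> - L r \<omega>)) \<partial>M)"
    by (rule split) (use Gm gm in auto)
  also have "\<dots> = (\<Sum>r\<in>grid_points T n. \<integral>\<^sup>+\<omega>. indicator {\<omega>\<in>space M. ?d \<omega> = r} \<omega> *
        (G r \<omega> * (\<integral>\<^sup>+\<omega>'. g r (L (T - r) \<omega>') \<partial>M)) \<partial>M)"
  proof (rule sum.cong[OF refl])
    fix r assume r: "r \<in> grid_points T n"
    note b = grid_points_bounds[OF horizon_pos r]
    have m: "(\<lambda>\<omega>. indicator {\<omega>\<in>space M. ?d \<omega> = r} \<omega> * G r \<omega>) \<in> borel_measurable (F r)"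
      using grid_stopping_sets[OF r] G[OF r] by (intro borel_measurable_times_ennreal borel_measurable_indicator)
    have m': "(\<lambda>\<omega>. indicator {\<omega>\<in>space M. ?d \<omega> = r} \<omega> * G r \<omega>) \<in> borel_measurable M"
      using measurable_from_F[OF m] b by simp
    show "(\<integral>\<^sup>+\<omega>. indicator {\<omega>\<in>space M. ?d \<omega> = r} \<omega> * (G r \<omega> * g r (L T \<omega> - L r \<omega>)) \<partial>M) =
      (\<integral>\<^sup>+\<omega>. indicator {\<omega>\<in>space M. ?d \<omega> = r} \<omega> * (G r \<omega> * (\<integral>\<^sup>+\<omega>'. g r (L (T - r) \<omega>') \<partial>M)) \<partial>M)"
      using nn_integral_increment[OF _ _ _ m g[OF r], of T] b m'
      by (simp add: nn_integral_multc mult.assoc[symmetric])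
  qed
  also have "\<dots> = (\<integral>\<^sup>+\<omega>. G (?d \<omega>) \<omega> * (\<integral>\<^sup>+\<omega>'. g (?d \<omega>) (L (T - ?d \<omega>) \<omega>') \<partial>M) \<partial>M)"
    by (rule split[symmetric]) (use Gm in auto)
  finally show ?thesis .
qed

end

end

section \<open>Exponential moments, and integrability from a stopped path\<close>

context levy_setting
begin

lemma exp_moment_add:
  assumes "0 \<le> s" "0 \<le> t" "s + t \<le> T"
  shows "(\<integral>\<^sup>+\<omega>. ennreal (exp (u * L (s + t) \<omega>)) \<partial>M) =
    (\<integral>\<^sup>+\<omega>. ennreal (exp (u * L s \<omega>)) \<partial>M) * (\<integral>\<^sup>+\<omega>. ennreal (exp (u * L t \<omega>)) \<partial>M)"
proof -
  have m: "(\<lambda>\<omega>. ennreal (exp (u * L s \<omega>))) \<in> borel_measurable (F s)"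
    using L_measurable_F[of s s] assms by simp
  have "(\<integral>\<^sup>+\<omega>. ennreal (exp (u * L (s + t) \<omega>)) \<partial>M) =
      (\<integral>\<^sup>+\<omega>. ennreal (exp (u * L s \<omega>)) * ennreal (exp (u * (L (s + t) \<omega> - L s \<omega>))) \<partial>M)"
    by (intro nn_integral_cong) (simp add: ennreal_mult'[symmetric] exp_add[symmetric] algebra_simps)
  also have "\<dots> = (\<integral>\<^sup>+\<omega>. ennreal (exp (u * L s \<omega>)) \<partial>M) * (\<integral>\<^sup>+\<omega>. ennreal (exp (u * L (s + t - s) \<omega>)) \<partial>M)"
    using assms by (intro nn_integral_increment m) auto
  finally show ?thesis by simp
qed

lemma exp_moment_0: "(\<integral>\<^sup>+\<omega>. ennreal (exp (u * L 0 \<omega>)) \<partial>M) = 1"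
proof -
  have "(\<integral>\<^sup>+\<omega>. ennreal (exp (u * L 0 \<omega>)) \<partial>M) = (\<integral>\<^sup>+\<omega>. 1 \<partial>M)"
    by (intro nn_integral_cong) (simp add: L_0)
  then show ?thesis by (simp add: emeasure_space_1)
qed

text \<open>
  The moment is multiplicative in time, so at the grid points it is a power of its value at the
  first one, which is an \<open>(n + 1)\<close>-st root of \<open>c\<close>.
\<close>
lemma exp_moment_grid:
  assumes c: "(\<integral>\<^sup>+\<omega>. ennreal (exp (u * L T \<omega>)) \<partial>M) = ennreal c" "0 < c"
    and r: "r \<in> grid_points T n"
  shows "(\<integral>\<^sup>+\<omega>. ennreal (exp (u * L r \<omega>)) \<partial>M) = ennreal (exp (ln c / T * r))"
proof -
  define \<Phi> where "\<Phi> t = (\<integral>\<^sup>+\<omega>. ennreal (exp (u * L t \<omega>)) \<partial>M)" for t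
  define h where "h = T / real (Suc n)"
  have h: "0 < h" "h * real (Suc n) = T" using horizon_pos by (auto simp: h_def simp del: of_nat_Suc)
  have power: "\<Phi> (h * real i) = \<Phi> h ^ i" if "i \<le> Suc n" for i
    using that
  proof (induction i)
    case 0
    then show ?case by (simp add: \<Phi>_def exp_moment_0)
  next
    case (Suc i)
    have "h * real i + h = h * real (Suc i)" by (simp add: algebra_simps)
    moreover have "h * real (Suc i) \<le> h * real (Suc n)"
      using Suc.prems h by (intro mult_left_mono) auto
    ultimately have "\<Phi> (h * real i + h) = \<Phi> (h * real i) * \<Phi> h"
      unfolding \<Phi>_def using h by (intro exp_moment_add) auto
    with Suc \<open>h * real i + h = _\<close> show ?case by (simp add: mult.commute del: of_nat_Suc)
  qed
  then have eq: "\<Phi> h ^ Suc n = ennreal c" using c h by (metis \<Phi>_def order_refl)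
  then have "\<Phi> h \<noteq> \<top>" by (auto simp: power_eq_top_ennreal)
  then obtain p where p: "\<Phi> h = ennreal p" "0 \<le> p" by (cases "\<Phi> h") auto
  with eq have pc: "p ^ Suc n = c" using c by (simp add: ennreal_power del: power_Suc)
  with c p have "0 < p" by (cases "p = 0") auto
  have lnc: "ln c = real (Suc n) * ln p" using \<open>0 < p\<close> pc by (metis ln_realpow)
  obtain i where i: "i \<le> Suc n" "r = h * real i" using r by (auto simp: grid_points_def h_def)
  have "ln c / (h * N) * (h * real i) = real i * ln p" if "0 < N" "ln c = N * ln p" for N
    using that h(1) by (simp add: field_simps)
  from this[OF _ lnc] have "ln c / T * r = real i * ln p"
    unfolding h(2) i(2) by simp
  then have "exp (ln c / T * r) = p ^ i"
    using \<open>0 < p\<close> by (simp add: exp_of_nat_mult)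
  with power[OF i(1)] show ?thesis
    using p by (simp add: \<Phi>_def i ennreal_power)
qed

lemma grid_points_reflect: "r \<in> grid_points T n \<Longrightarrow> T - r \<in> grid_points T n"
  unfolding grid_points_def
proof (elim imageE, intro image_eqI)
  fix i assume i: "i \<in> {..Suc n}" and "r = T / real (Suc n) * real i"
  then show "T - r = T / real (Suc n) * real (Suc n - i)"
    by (simp add: of_nat_diff right_diff_distrib del: of_nat_Suc)
qed auto

text \<open>
  For rounded stopping times the expectation is exactly \<open>1\<close>, because \<open>exp (u * L\<^sub>t - \<kappa> * t)\<close> with
  \<open>\<kappa> = ln c / T\<close> is a martingale along the grid. Fatou's lemma passes to the limit of finer grids.
\<close>
lemma exp_optional_stopping_le:
  assumes c: "(\<integral>\<^sup>+\<omega>. ennreal (exp (u * L T \<omega>)) \<partial>M) = ennreal c" "0 < c"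
    and \<tau>: "stopping_time_upto T F \<tau>"
  shows "(\<integral>\<^sup>+\<omega>. ennreal (exp (u * L (\<tau> \<omega>) \<omega> - ln c / T * \<tau> \<omega>)) \<partial>M) \<le> 1"
proof -
  define \<kappa> where "\<kappa> = ln c / T"
  have \<kappa>T: "exp (\<kappa> * T) = c" using c horizon_pos by (simp add: \<kappa>_def)
  define d where "d n \<omega> = upper_grid T n (\<tau> \<omega>)" for n \<omega>
  define E where "E t \<omega> = ennreal (exp (u * L t \<omega> - \<kappa> * t))" for t \<omega>
  have grid: "(\<integral>\<^sup>+\<omega>. E (d n \<omega>) \<omega> \<partial>M) = 1" for n
  proof -
    \<comment> \<open>The remaining time \<open>T - r\<close> is again a grid point.\<close>
    have inner: "(\<integral>\<^sup>+\<omega>'. ennreal (exp (u * L (T - r) \<omega>' - \<kappa> * (T - r))) \<partial>M) = 1"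
      if "r \<in> grid_points T n" for r
    proof -
      have "(\<integral>\<^sup>+\<omega>'. ennreal (exp (u * L (T - r) \<omega>' - \<kappa> * (T - r))) \<partial>M) =
          (\<integral>\<^sup>+\<omega>'. ennreal (exp (- \<kappa> * (T - r))) * ennreal (exp (u * L (T - r) \<omega>')) \<partial>M)"
        by (intro nn_integral_cong) (simp add: ennreal_mult'[symmetric] exp_add[symmetric])
      also have "\<dots> = ennreal (exp (- \<kappa> * (T - r))) * ennreal (exp (\<kappa> * (T - r)))"
        using L_measurable[of "T - r"] grid_points_bounds[OF horizon_pos that]
        by (subst nn_integral_cmult) (auto simp: exp_moment_grid[OF c grid_points_reflect[OF that]] \<kappa>_def)
      finally show ?thesis by (simp add: ennreal_mult'[symmetric] exp_add[symmetric])
    qed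
    have dg: "d n \<omega> \<in> grid_points T n" if "\<omega> \<in> space M" for \<omega>
      using stopping_bounds[OF \<tau> that] by (auto simp: d_def intro!: upper_grid_in_grid_points horizon_pos)
    have "(\<integral>\<^sup>+\<omega>. E (d n \<omega>) \<omega> \<partial>M) = (\<integral>\<^sup>+\<omega>. E (d n \<omega>) \<omega> *
        (\<integral>\<^sup>+\<omega>'. ennreal (exp (u * L (T - d n \<omega>) \<omega>' - \<kappa> * (T - d n \<omega>))) \<partial>M) \<partial>M)"
      by (intro nn_integral_cong) (simp add: inner dg)
    also have "\<dots> = (\<integral>\<^sup>+\<omega>. E (d n \<omega>) \<omega> *
        ennreal (exp (u * (L T \<omega> - L (d n \<omega>) \<omega>) - \<kappa> * (T - d n \<omega>))) \<partial>M)"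
      unfolding d_def E_def
    proof (rule nn_integral_increment_after_grid_stopping[OF \<tau>, symmetric])
      fix r assume "r \<in> grid_points T n"
      then show "(\<lambda>\<omega>. ennreal (exp (u * L r \<omega> - \<kappa> * r))) \<in> borel_measurable (F r)"
        using L_measurable_F[of r r] grid_points_bounds[OF horizon_pos] by simp
    qed simp
    also have "\<dots> = (\<integral>\<^sup>+\<omega>. ennreal (exp (- \<kappa> * T)) * ennreal (exp (u * L T \<omega>)) \<partial>M)"
      by (intro nn_integral_cong)
        (simp add: E_def ennreal_mult'[symmetric] exp_add[symmetric] algebra_simps)
    also have "\<dots> = ennreal (exp (- \<kappa> * T)) * ennreal c"
      using L_measurable[of T] horizon_pos by (subst nn_integral_cmult) (auto simp: c)
    also have "\<dots> = 1" using c by (simp add: ennreal_mult'[symmetric] exp_minus \<kappa>T)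
    finally show ?thesis .
  qed
  have "(\<integral>\<^sup>+\<omega>. E (\<tau> \<omega>) \<omega> \<partial>M) = (\<integral>\<^sup>+\<omega>. liminf (\<lambda>n. E (d n \<omega>) \<omega>) \<partial>M)"
  proof (rule nn_integral_cong)
    fix \<omega> assume \<omega>: "\<omega> \<in> space M"
    note b = stopping_bounds[OF \<tau> \<omega>]
    have "(\<lambda>n. E (d n \<omega>) \<omega>) \<longlonglongrightarrow> E (\<tau> \<omega>) \<omega>"
      unfolding E_def d_def
      by (intro tendsto_intros L_upper_grid_tendsto upper_grid_tendsto horizon_pos) (use b \<omega> in auto)
    then show "E (\<tau> \<omega>) \<omega> = liminf (\<lambda>n. E (d n \<omega>) \<omega>)"
      by (intro lim_imp_Liminf[symmetric]) auto
  qed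
  also have "\<dots> \<le> liminf (\<lambda>n. \<integral>\<^sup>+\<omega>. E (d n \<omega>) \<omega> \<partial>M)"
  proof (rule nn_integral_liminf)
    fix n
    have "(\<lambda>\<omega>. E (upper_grid T n (\<tau> \<omega>)) \<omega>) \<in> borel_measurable (F T)"
      unfolding E_def
    proof (rule measurable_at_grid_stopping[OF \<tau>])
      fix r assume "r \<in> grid_points T n"
      then show "(\<lambda>\<omega>. ennreal (exp (u * L r \<omega> - \<kappa> * r))) \<in> borel_measurable (F T)"
        using L_measurable_F[of r T] grid_points_bounds[OF horizon_pos] by simp
    qed
    then show "(\<lambda>\<omega>. E (d n \<omega>) \<omega>) \<in> borel_measurable M"
      unfolding d_def by (rule measurable_from_F) simp
  qed
  finally have "(\<integral>\<^sup>+\<omega>. E (\<tau> \<omega>) \<omega> \<partial>M) \<le> 1" by (simp only: grid) (simp add: Liminf_const)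
  then show ?thesis by (simp only: E_def \<kappa>_def)
qed

text \<open>
  Split \<open>L\<^sub>T\<close> into \<open>L\<^sub>\<tau>\<close> and the increment after \<open>\<tau>\<close>, which vanishes if \<open>\<tau> = T\<close> and otherwise
  is distributed like \<open>L\<close> at the remaining time. Truncation at \<open>R\<close> is subadditive in this sense and
  keeps \<open>S\<close> finite in the application.
\<close>
lemma truncated_moment_le:
  assumes \<tau>: "stopping_time_upto T F \<tau>" and R: "0 \<le> R"
    and S: "\<And>r. 0 \<le> r \<Longrightarrow> r \<le> T \<Longrightarrow> (\<integral>\<^sup>+\<omega>. ennreal (min \<bar>L r \<omega>\<bar> R) \<partial>M) \<le> S"
  shows "(\<integral>\<^sup>+\<omega>. ennreal (min \<bar>L T \<omega>\<bar> R) \<partial>M) \<le>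
    (\<integral>\<^sup>+\<omega>. ennreal \<bar>L (\<tau> \<omega>) \<omega>\<bar> \<partial>M) + S * emeasure M {\<omega>\<in>space M. \<tau> \<omega> < T}"
proof -
  define d where "d n \<omega> = upper_grid T n (\<tau> \<omega>)" for n \<omega>
  define A where "A = {\<omega>\<in>space M. \<tau> \<omega> < T}"
  have \<tau>m[measurable]: "\<tau> \<in> borel_measurable M"
    using measurable_from_F[OF stopping_measurable[OF \<tau>]] by simp
  have A[measurable]: "A \<in> sets M" unfolding A_def by measurable
  have LT[measurable]: "L T \<in> borel_measurable M" using L_measurable[of T] horizon_pos by simp
  have L\<tau>[measurable]: "(\<lambda>\<omega>. L (\<tau> \<omega>) \<omega>) \<in> borel_measurable M"
    using measurable_from_F[OF L_stopping_measurable[OF \<tau>]] by simp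
  have Ld[measurable]: "(\<lambda>\<omega>. L (d n \<omega>) \<omega>) \<in> borel_measurable M" for n
    using measurable_from_F[OF L_grid_stopping_measurable[OF \<tau>, of n]] by (simp add: d_def)
  have grid: "(\<integral>\<^sup>+\<omega>. ennreal (min \<bar>L T \<omega> - L (d n \<omega>) \<omega>\<bar> R) \<partial>M) \<le> S * emeasure M A" for n
  proof -
    have "(\<integral>\<^sup>+\<omega>. ennreal (min \<bar>L T \<omega> - L (d n \<omega>) \<omega>\<bar> R) \<partial>M) =
        (\<integral>\<^sup>+\<omega>. 1 * ennreal (min \<bar>L T \<omega> - L (d n \<omega>) \<omega>\<bar> R) \<partial>M)" by simp
    also have "\<dots> = (\<integral>\<^sup>+\<omega>. 1 * (\<integral>\<^sup>+\<omega>'. ennreal (min \<bar>L (T - d n \<omega>) \<omega>'\<bar> R) \<partial>M) \<partial>M)"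
      unfolding d_def by (rule nn_integral_increment_after_grid_stopping[OF \<tau>]) simp_all
    also have "\<dots> \<le> (\<integral>\<^sup>+\<omega>. S * indicator A \<omega> \<partial>M)"
    proof (rule nn_integral_mono)
      fix \<omega> assume \<omega>: "\<omega> \<in> space M"
      note b = stopping_bounds[OF \<tau> \<omega>]
      show "1 * (\<integral>\<^sup>+\<omega>'. ennreal (min \<bar>L (T - d n \<omega>) \<omega>'\<bar> R) \<partial>M) \<le> S * indicator A \<omega>"
      proof (cases "\<tau> \<omega> < T")
        case True
        then show ?thesis
          using \<omega> b S[of "T - d n \<omega>"] upper_grid_ge[OF horizon_pos, of "\<tau> \<omega>" n] upper_grid_le[OF horizon_pos, of "\<tau> \<omega>" n]
          by (simp add: A_def d_def)
      next
        case False
        with b have "\<tau> \<omega> = T" by simp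
        then have d: "d n \<omega> = T" by (simp add: d_def upper_grid_self[OF horizon_pos])
        have "(\<integral>\<^sup>+\<omega>'. ennreal (min \<bar>L (T - d n \<omega>) \<omega>'\<bar> R) \<partial>M) = (\<integral>\<^sup>+\<omega>'. 0 \<partial>M)"
          using R by (intro nn_integral_cong) (simp add: d L_0)
        then show ?thesis by simp
      qed
    qed
    finally show ?thesis by (simp add: nn_integral_cmult)
  qed
  have "(\<integral>\<^sup>+\<omega>. ennreal (min \<bar>L T \<omega> - L (\<tau> \<omega>) \<omega>\<bar> R) \<partial>M) =
      (\<integral>\<^sup>+\<omega>. liminf (\<lambda>n. ennreal (min \<bar>L T \<omega> - L (d n \<omega>) \<omega>\<bar> R)) \<partial>M)"
  proof (rule nn_integral_cong)
    fix \<omega> assume \<omega>: "\<omega> \<in> space M"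
    note b = stopping_bounds[OF \<tau> \<omega>]
    have "(\<lambda>n. ennreal (min \<bar>L T \<omega> - L (d n \<omega>) \<omega>\<bar> R)) \<longlonglongrightarrow> ennreal (min \<bar>L T \<omega> - L (\<tau> \<omega>) \<omega>\<bar> R)"
      unfolding d_def
      by (intro tendsto_intros L_upper_grid_tendsto) (use b \<omega> in auto)
    then show "ennreal (min \<bar>L T \<omega> - L (\<tau> \<omega>) \<omega>\<bar> R) = liminf (\<lambda>n. ennreal (min \<bar>L T \<omega> - L (d n \<omega>) \<omega>\<bar> R))"
      by (intro lim_imp_Liminf[symmetric]) auto
  qed
  also have "\<dots> \<le> liminf (\<lambda>n. \<integral>\<^sup>+\<omega>. ennreal (min \<bar>L T \<omega> - L (d n \<omega>) \<omega>\<bar> R) \<partial>M)"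
    by (rule nn_integral_liminf) measurable
  also have "\<dots> \<le> S * emeasure M A"
    by (rule order_trans[OF Liminf_le_Limsup Limsup_bounded]) (auto simp: grid)
  finally have after: "(\<integral>\<^sup>+\<omega>. ennreal (min \<bar>L T \<omega> - L (\<tau> \<omega>) \<omega>\<bar> R) \<partial>M) \<le> S * emeasure M A" .
  have "(\<integral>\<^sup>+\<omega>. ennreal (min \<bar>L T \<omega>\<bar> R) \<partial>M) \<le>
      (\<integral>\<^sup>+\<omega>. ennreal \<bar>L (\<tau> \<omega>) \<omega>\<bar> + ennreal (min \<bar>L T \<omega> - L (\<tau> \<omega>) \<omega>\<bar> R) \<partial>M)"
    using R by (intro nn_integral_mono) (simp flip: ennreal_plus)
  also have "\<dots> = (\<integral>\<^sup>+\<omega>. ennreal \<bar>L (\<tau> \<omega>) \<omega>\<bar> \<partial>M) + (\<integral>\<^sup>+\<omega>. ennreal (min \<bar>L T \<omega> - L (\<tau> \<omega>) \<omega>\<bar> R) \<partial>M)"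
    by (rule nn_integral_add) measurable
  finally show ?thesis using after unfolding A_def by (meson add_left_mono order_trans)
qed

lemma stopping_time_upto_min:
  assumes \<tau>: "stopping_time_upto T F \<tau>" and s: "0 \<le> s"
  shows "stopping_time_upto s F (\<lambda>\<omega>. min s (\<tau> \<omega>))"
  unfolding stopping_time_upto_def
proof (intro conjI ballI)
  show "stopping_time F (\<lambda>\<omega>. min s (\<tau> \<omega>))"
    using \<tau> by (intro stopping_time_min stopping_time_const) (simp add: stopping_time_upto_def)
qed (use stopping_bounds[OF \<tau>] s in \<open>auto simp: space_F\<close>)

text \<open>
  Let \<open>S\<close> be the supremum over \<open>s \<le> T\<close> of \<open>E (min \<bar>L\<^sub>s\<bar> R)\<close>. The preceding estimate at every horizon \<open>s\<close>
  gives \<open>S \<le> K + p * S\<close> with \<open>p = P (\<tau> < T) < 1\<close>. Since \<open>S \<le> R\<close> is finite, \<open>S \<le> K / (1 - p)\<close>,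
  a bound that does not depend on \<open>R\<close>.
\<close>
lemma integrable_of_stopped_bounded:
  assumes \<tau>: "stopping_time_upto T F \<tau>" and pos: "0 < emeasure M {\<omega>\<in>space M. \<tau> \<omega> = T}"
    and K: "\<And>s. 0 \<le> s \<Longrightarrow> s \<le> T \<Longrightarrow> (\<integral>\<^sup>+\<omega>. ennreal \<bar>L (min s (\<tau> \<omega>)) \<omega>\<bar> \<partial>M) \<le> ennreal K"
  shows "integrable M (L T)"
proof -
  have LT[measurable]: "L T \<in> borel_measurable M" using L_measurable[of T] horizon_pos by simp
  have \<tau>m[measurable]: "\<tau> \<in> borel_measurable M"
    using measurable_from_F[OF stopping_measurable[OF \<tau>]] by simp
  define p where "p = prob {\<omega>\<in>space M. \<tau> \<omega> < T}"
  have p1: "p < 1"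
  proof -
    have "{\<omega>\<in>space M. \<tau> \<omega> = T} = space M - {\<omega>\<in>space M. \<tau> \<omega> < T}"
      using stopping_bounds[OF \<tau>] by force
    then have "prob {\<omega>\<in>space M. \<tau> \<omega> = T} = 1 - p" by (simp add: p_def prob_compl)
    with pos show ?thesis by (simp add: emeasure_eq_measure)
  qed
  have bound: "(\<integral>\<^sup>+\<omega>. ennreal (min \<bar>L T \<omega>\<bar> (real R)) \<partial>M) \<le> ennreal (max 0 K / (1 - p))" for R :: nat
  proof -
    define m where "m r = (\<integral>\<^sup>+\<omega>. ennreal (min \<bar>L r \<omega>\<bar> (real R)) \<partial>M)" for r
    define S where "S = (SUP r\<in>{0..T}. m r)"
    have mS: "m r \<le> S" if "0 \<le> r" "r \<le> T" for r
      unfolding S_def using that by (intro SUP_upper) auto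
    have "S \<le> ennreal (real R)"
      unfolding S_def
    proof (rule SUP_least)
      fix r
      have "m r \<le> (\<integral>\<^sup>+\<omega>. ennreal (real R) \<partial>M)"
        unfolding m_def by (intro nn_integral_mono ennreal_leI) simp
      then show "m r \<le> ennreal (real R)" by (simp add: emeasure_space_1)
    qed
    then have "S < \<top>" by (rule le_less_trans) simp
    then obtain S' where S': "S = ennreal S'" "0 \<le> S'" by (cases S) auto
    have "m s \<le> ennreal K + S * ennreal p" if s: "0 \<le> s" "s \<le> T" for s
    proof (cases "s = 0")
      case True
      have "m 0 = (\<integral>\<^sup>+\<omega>. 0 \<partial>M)" unfolding m_def by (intro nn_integral_cong) (simp add: L_0)
      then show ?thesis by (simp add: True)
    next
      case False
      with s have "0 < s" by simp
      interpret short: levy_setting M s F L using \<open>0 < s\<close> s by (intro levy_setting_shorter_horizon)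
      have "m s \<le> (\<integral>\<^sup>+\<omega>. ennreal \<bar>L (min s (\<tau> \<omega>)) \<omega>\<bar> \<partial>M) + S * emeasure M {\<omega>\<in>space M. min s (\<tau> \<omega>) < s}"
        unfolding m_def
        by (rule short.truncated_moment_le[OF stopping_time_upto_min[OF \<tau>]])
          (use s mS in \<open>auto simp: m_def\<close>)
      also have "\<dots> \<le> ennreal K + S * ennreal p"
      proof (intro add_mono K s mult_left_mono)
        have "emeasure M {\<omega>\<in>space M. min s (\<tau> \<omega>) < s} \<le> emeasure M {\<omega>\<in>space M. \<tau> \<omega> < T}"
          using s by (intro emeasure_mono) (auto simp: min_less_iff_disj)
        then show "emeasure M {\<omega>\<in>space M. min s (\<tau> \<omega>) < s} \<le> ennreal p"
          by (simp add: p_def emeasure_eq_measure)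
      qed auto
      finally show ?thesis .
    qed
    then have "S \<le> ennreal K + S * ennreal p" unfolding S_def by (intro SUP_least) auto
    also have "\<dots> = ennreal (max 0 K + S' * p)"
      by (simp add: S' p_def ennreal_mult max_def ennreal_neg)
    finally have "ennreal S' \<le> ennreal (max 0 K + S' * p)" unfolding S'(1) .
    then have "S' \<le> max 0 K + S' * p"
      by (subst (asm) ennreal_le_iff) (use S' in \<open>auto simp: p_def\<close>)
    then have "S' * (1 - p) \<le> max 0 K" by (simp add: algebra_simps)
    then have "S' \<le> max 0 K / (1 - p)" using p1 by (simp add: pos_le_divide_eq)
    then show ?thesis using mS[of T] horizon_pos unfolding m_def S'
      by (meson ennreal_leI less_imp_le order_refl order_trans)
  qed
  have "(\<integral>\<^sup>+\<omega>. ennreal \<bar>L T \<omega>\<bar> \<partial>M) = (\<integral>\<^sup>+\<omega>. liminf (\<lambda>R. ennreal (min \<bar>L T \<omega>\<bar> (real R))) \<partial>M)"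
  proof (rule nn_integral_cong)
    fix \<omega>
    have "\<forall>\<^sub>F R in sequentially. \<bar>L T \<omega>\<bar> \<le> real R"
      using filterlim_real_sequentially unfolding filterlim_at_top by blast
    then have "(\<lambda>R. ennreal (min \<bar>L T \<omega>\<bar> (real R))) \<longlonglongrightarrow> ennreal \<bar>L T \<omega>\<bar>"
      by (intro tendsto_eventually) (auto elim!: eventually_mono simp: min_def)
    then show "ennreal \<bar>L T \<omega>\<bar> = liminf (\<lambda>R. ennreal (min \<bar>L T \<omega>\<bar> (real R)))"
      by (intro lim_imp_Liminf[symmetric]) auto
  qed
  also have "\<dots> \<le> liminf (\<lambda>R. \<integral>\<^sup>+\<omega>. ennreal (min \<bar>L T \<omega>\<bar> (real R)) \<partial>M)"
    by (rule nn_integral_liminf) measurable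
  also have "\<dots> \<le> ennreal (max 0 K / (1 - p))"
    by (rule order_trans[OF Liminf_le_Limsup Limsup_bounded]) (auto simp: bound)
  finally show ?thesis
    by (intro integrableI_bounded) (auto simp: top_unique less_top[symmetric])
qed

text \<open>
  The absolute moments of a martingale are bounded by the terminal one.
\<close>
lemma integrable_of_stopped_martingale:
  assumes \<tau>: "stopping_time_upto T F \<tau>" and pos: "0 < emeasure M {\<omega>\<in>space M. \<tau> \<omega> = T}"
    and mart: "martingale_upto M T F (\<lambda>t \<omega>. L (min t (\<tau> \<omega>)) \<omega>)"
  shows "integrable M (L T)"
proof -
  let ?X = "\<lambda>t \<omega>. L (min t (\<tau> \<omega>)) \<omega>"
  have intT: "integrable M (?X T)" using mart horizon_pos by (simp add: martingale_upto_def)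
  have "(\<integral>\<^sup>+\<omega>. ennreal \<bar>?X s \<omega>\<bar> \<partial>M) \<le> (\<integral>\<^sup>+\<omega>. ennreal \<bar>?X T \<omega>\<bar> \<partial>M)" if s: "0 \<le> s" "s \<le> T" for s
  proof -
    interpret fs: finite_measure_subalgebra M "F s"
      by unfold_locales (rule subalgebra_le[OF s(2)])
    have "AE \<omega> in M. real_cond_exp M (F s) (?X T) \<omega> = ?X s \<omega>"
      using mart s horizon_pos unfolding martingale_upto_def by blast
    moreover have "AE \<omega> in M. \<bar>real_cond_exp M (F s) (?X T) \<omega>\<bar> \<le> nn_cond_exp M (F s) (\<lambda>\<omega>. ennreal \<bar>?X T \<omega>\<bar>) \<omega>"
      using intT by (intro fs.real_cond_exp_abs) auto
    ultimately have "(\<integral>\<^sup>+\<omega>. ennreal \<bar>?X s \<omega>\<bar> \<partial>M) \<le> (\<integral>\<^sup>+\<omega>. nn_cond_exp M (F s) (\<lambda>\<omega>. ennreal \<bar>?X T \<omega>\<bar>) \<omega> \<partial>M)"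
      by (intro nn_integral_mono_AE) auto
    also have "\<dots> = (\<integral>\<^sup>+\<omega>. ennreal \<bar>?X T \<omega>\<bar> \<partial>M)"
      using fs.nn_cond_exp_intg[of "\<lambda>_. 1" "\<lambda>\<omega>. ennreal \<bar>?X T \<omega>\<bar>"] intT by simp
    finally show ?thesis .
  qed
  moreover have "(\<integral>\<^sup>+\<omega>. ennreal \<bar>?X T \<omega>\<bar> \<partial>M) = ennreal (\<integral>\<omega>. \<bar>?X T \<omega>\<bar> \<partial>M)"
    using intT by (intro nn_integral_eq_integral) auto
  ultimately show ?thesis
    by (intro integrable_of_stopped_bounded[OF \<tau> pos, of "\<integral>\<omega>. \<bar>?X T \<omega>\<bar> \<partial>M"]) auto
qed

end

section \<open>First moments and the martingale property\<close>

context levy_setting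
begin

text \<open>
  On an event \<open>\<bar>L\<^sub>T - L\<^sub>t\<bar> \<le> K\<close> of positive probability, which is independent of \<open>L\<^sub>t\<close>, the variable \<open>\<bar>L\<^sub>t\<bar>\<close>
  is bounded by \<open>\<bar>L\<^sub>T\<bar> + K\<close>.
\<close>
lemma integrable_earlier:
  assumes int: "integrable M (L T)" and t: "0 \<le> t" "t \<le> T"
  shows "integrable M (L t)"
proof -
  have m[measurable]: "L t \<in> borel_measurable M" "L (T - t) \<in> borel_measurable M" "L T \<in> borel_measurable M"
    using t by (auto intro!: L_measurable)
  obtain K :: nat where K: "emeasure M {\<omega>\<in>space M. \<bar>L (T - t) \<omega>\<bar> \<le> real K} \<noteq> 0"
  proof (rule ccontr)
    assume "\<not> thesis"
    then have "emeasure M {\<omega>\<in>space M. \<bar>L (T - t) \<omega>\<bar> \<le> real K} = 0" for K using that by blast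
    then have "emeasure M (\<Union>K. {\<omega>\<in>space M. \<bar>L (T - t) \<omega>\<bar> \<le> real K}) = 0"
      by (intro emeasure_UN_eq_0) auto
    also have "(\<Union>K. {\<omega>\<in>space M. \<bar>L (T - t) \<omega>\<bar> \<le> real K}) = space M"
      using real_arch_simple by auto
    finally show False by (simp add: emeasure_space_1)
  qed
  let ?g = "\<lambda>x. indicator {x. \<bar>x\<bar> \<le> real K} x :: ennreal"
  have "(\<integral>\<^sup>+\<omega>. ennreal \<bar>L t \<omega>\<bar> \<partial>M) * (\<integral>\<^sup>+\<omega>. ?g (L (T - t) \<omega>) \<partial>M) =
      (\<integral>\<^sup>+\<omega>. ennreal \<bar>L t \<omega>\<bar> * ?g (L T \<omega> - L t \<omega>) \<partial>M)"
    using t L_measurable_F[of t t] by (intro nn_integral_increment[symmetric]) auto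
  also have "\<dots> \<le> (\<integral>\<^sup>+\<omega>. ennreal (\<bar>L T \<omega>\<bar> + real K) \<partial>M)"
    by (intro nn_integral_mono) (auto split: split_indicator simp flip: ennreal_plus intro!: ennreal_leI)
  also have "\<dots> = ennreal (\<integral>\<omega>. \<bar>L T \<omega>\<bar> + real K \<partial>M)"
    using int by (intro nn_integral_eq_integral) auto
  also have "\<dots> < \<top>" by simp
  finally have "(\<integral>\<^sup>+\<omega>. ennreal \<bar>L t \<omega>\<bar> \<partial>M) * (\<integral>\<^sup>+\<omega>. ?g (L (T - t) \<omega>) \<partial>M) < \<top>" .
  moreover have "(\<integral>\<^sup>+\<omega>. ?g (L (T - t) \<omega>) \<partial>M) = emeasure M {\<omega>\<in>space M. \<bar>L (T - t) \<omega>\<bar> \<le> real K}"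
  proof -
    have "(\<integral>\<^sup>+\<omega>. ?g (L (T - t) \<omega>) \<partial>M) = (\<integral>\<^sup>+\<omega>. indicator {\<omega>\<in>space M. \<bar>L (T - t) \<omega>\<bar> \<le> real K} \<omega> \<partial>M)"
      by (rule nn_integral_cong) (auto split: split_indicator)
    also have "\<dots> = emeasure M {\<omega>\<in>space M. \<bar>L (T - t) \<omega>\<bar> \<le> real K}"
      by (rule nn_integral_indicator) measurable
    finally show ?thesis .
  qed
  ultimately have "(\<integral>\<^sup>+\<omega>. ennreal \<bar>L t \<omega>\<bar> \<partial>M) < \<top>"
    using K by (auto simp: ennreal_mult_less_top)
  then show ?thesis by (intro integrableI_bounded) auto
qed

lemma integral_increment_eq:
  assumes int: "integrable M (L (t - s))" and st: "0 \<le> s" "s \<le> t" "t \<le> T"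
  shows "(\<integral>\<omega>. L t \<omega> - L s \<omega> \<partial>M) = (\<integral>\<omega>. L (t - s) \<omega> \<partial>M)"
proof -
  have "(\<integral>\<omega>. 1 * (L t \<omega> - L s \<omega>) \<partial>M) = (\<integral>\<omega>. 1 \<partial>M) * (\<integral>\<omega>. L (t - s) \<omega> \<partial>M)"
    by (rule integral_increment(2)[OF st, where g="\<lambda>x. x"]) (use int in auto)
  then show ?thesis by (simp only: mult_1 lebesgue_integral_const prob_space scaleR_one)
qed

lemma mean_add:
  assumes int: "integrable M (L T)" and st: "0 \<le> s" "0 \<le> t" "s + t \<le> T"
  shows "expectation (L (s + t)) = expectation (L s) + expectation (L t)"
proof -
  have "integrable M (L (s + t))" "integrable M (L s)" "integrable M (L t)"
    using st by (auto intro!: integrable_earlier[OF int])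
  then show ?thesis
    using integral_increment_eq[of "s + t" s] st by simp
qed

lemma mean_grid:
  assumes int: "integrable M (L T)" and r: "r \<in> grid_points T n"
  shows "expectation (L r) = expectation (L T) / T * r"
proof -
  define h where "h = T / real (Suc n)"
  have h: "0 < h" "h * real (Suc n) = T" using horizon_pos by (auto simp: h_def simp del: of_nat_Suc)
  have multiple: "expectation (L (h * real i)) = real i * expectation (L h)" if "i \<le> Suc n" for i
    using that
  proof (induction i)
    case 0
    have "expectation (L 0) = expectation (\<lambda>_. 0)"
      by (rule Bochner_Integration.integral_cong) (auto simp: L_0)
    then show ?case by simp
  next
    case (Suc i)
    have eq: "h * real i + h = h * real (Suc i)" by (simp add: algebra_simps)
    have "h * real (Suc i) \<le> h * real (Suc n)"
      using Suc.prems h by (intro mult_left_mono) auto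
    then have "expectation (L (h * real i + h)) = expectation (L (h * real i)) + expectation (L h)"
      using h eq by (intro mean_add[OF int]) auto
    with Suc eq show ?case by (simp add: algebra_simps)
  qed
  obtain i where i: "i \<le> Suc n" "r = h * real i" using r by (auto simp: grid_points_def h_def)
  have "(N * m) / (h * N) * (h * real i) = real i * m" if "0 < N" for N m
    using that h(1) by (simp add: field_simps)
  from this[of "real (Suc n)" "expectation (L h)"] multiple[of "Suc n"] multiple[OF i(1)]
  show ?thesis by (simp add: h(2) i(2) del: of_nat_Suc)
qed

text \<open>
  With \<open>m = E L\<^sub>T / T\<close> the process \<open>L\<^sub>t - m * t\<close> is a martingale along the grid, and Jensen's inequality
  applies to the convex function \<open>max 0 (\<bar>x\<bar> - R)\<close>. Its subgradient \<open>h\<close> is bounded, so the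
  first-order term has mean zero by independence.
\<close>
lemma convex_moment_le:
  assumes int: "integrable M (L T)" and r: "r \<in> grid_points T n" and R: "0 \<le> R"
    and m: "m = expectation (L T) / T"
  shows "expectation (\<lambda>\<omega>. max 0 (\<bar>L r \<omega> - m * r\<bar> - R)) \<le> expectation (\<lambda>\<omega>. max 0 (\<bar>L T \<omega> - m * T\<bar> - R))"
proof -
  note b = grid_points_bounds[OF horizon_pos r]
  define h where "h x = (if R < x then 1 else if x < - R then -1 else 0 :: real)" for x :: real
  have h[measurable]: "h \<in> borel_measurable borel" unfolding h_def by measurable
  have hb: "\<bar>h x\<bar> \<le> 1" for x by (simp add: h_def)
  have subgradient: "max 0 (\<bar>x\<bar> - R) + h x * (y - x) \<le> max 0 (\<bar>y\<bar> - R)" for x y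
    using R by (auto simp: h_def max_def abs_if)
  have Lr[measurable]: "L r \<in> borel_measurable M" and LT[measurable]: "L T \<in> borel_measurable M"
    using b by (auto intro!: L_measurable)
  have intr: "integrable M (L r)" "integrable M (L (T - r))"
    using b by (auto intro!: integrable_earlier[OF int])
  have hF: "(\<lambda>\<omega>. h (L r \<omega> - m * r)) \<in> borel_measurable (F r)"
  proof -
    have "L r \<in> borel_measurable (F r)" using b by (intro L_measurable_F) auto
    then show ?thesis by measurable
  qed
  have hint: "integrable M (\<lambda>\<omega>. h (L r \<omega> - m * r))"
    by (rule integrable_const_bound[where B=1]) (auto simp: hb)
  note increment = integral_increment[OF _ _ _ hF hint, of T "\<lambda>x. x - m * (T - r)"]
  have mean: "expectation (\<lambda>\<omega>. L (T - r) \<omega> - m * (T - r)) = 0"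
    using intr mean_grid[OF int grid_points_reflect[OF r]] by (simp add: m prob_space)
  have hinc: "integrable M (\<lambda>\<omega>. h (L r \<omega> - m * r) * (L T \<omega> - L r \<omega> - m * (T - r)))"
    using increment(1) b intr by simp
  have hzero: "expectation (\<lambda>\<omega>. h (L r \<omega> - m * r) * (L T \<omega> - L r \<omega> - m * (T - r))) = 0"
    using increment(2) b intr mean by simp
  have max_int: "integrable M (\<lambda>\<omega>. max 0 (\<bar>L r \<omega> - m * r\<bar> - R))" "integrable M (\<lambda>\<omega>. max 0 (\<bar>L T \<omega> - m * T\<bar> - R))"
    using intr int by (auto intro!: integrable_max)
  have "expectation (\<lambda>\<omega>. max 0 (\<bar>L r \<omega> - m * r\<bar> - R)) =
      expectation (\<lambda>\<omega>. max 0 (\<bar>L r \<omega> - m * r\<bar> - R) + h (L r \<omega> - m * r) * (L T \<omega> - L r \<omega> - m * (T - r)))"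
    using max_int(1) hinc hzero by simp
  also have "\<dots> \<le> expectation (\<lambda>\<omega>. max 0 (\<bar>L T \<omega> - m * T\<bar> - R))"
  proof (rule integral_mono)
    fix \<omega>
    show "max 0 (\<bar>L r \<omega> - m * r\<bar> - R) + h (L r \<omega> - m * r) * (L T \<omega> - L r \<omega> - m * (T - r))
      \<le> max 0 (\<bar>L T \<omega> - m * T\<bar> - R)"
      using subgradient[of "L r \<omega> - m * r" "L T \<omega> - m * T"] by (simp add: algebra_simps)
  qed (use max_int hinc in auto)
  finally show ?thesis .
qed

text \<open>
  For rounded stopping times this is immediate, but \<open>L\<close> at the rounded times need not be dominated, so
  the limit cannot be taken directly. Instead the centred increment after the stopping time is clipped
  to \<open>[- R, R]\<close>. Its clipped expectation at grid times is at most
  \<open>\<epsilon> R = E (max 0 (\<bar>L\<^sub>T - m * T\<bar> - R))\<close>, uniformly in the grid, by \<open>convex_moment_le\<close>. Refining the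
  grid first and letting \<open>R\<close> tend to infinity afterwards, both limits are dominated.
\<close>
lemma wald_identity:
  assumes int: "integrable M (L T)" and \<tau>: "stopping_time_upto T F \<tau>"
    and int\<tau>: "integrable M (\<lambda>\<omega>. L (\<tau> \<omega>) \<omega>)"
  shows "expectation (\<lambda>\<omega>. L (\<tau> \<omega>) \<omega>) = expectation (L T) / T * expectation \<tau>"
proof -
  define m where "m = expectation (L T) / T"
  define d where "d n \<omega> = upper_grid T n (\<tau> \<omega>)" for n \<omega>
  define clip where "clip R x = max (- R) (min R x)" for R x :: real
  define \<epsilon> where "\<epsilon> R = expectation (\<lambda>\<omega>. max 0 (\<bar>L T \<omega> - m * T\<bar> - R))" for R
  have clip_meas[measurable]: "clip R \<in> borel_measurable borel" for R unfolding clip_def by measurable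
  have clip_bound: "\<bar>clip R x\<bar> \<le> R" if "0 \<le> R" for R x using that by (auto simp: clip_def)
  have clip_abs: "\<bar>clip R x\<bar> \<le> \<bar>x\<bar>" if "0 \<le> R" for R x using that by (auto simp: clip_def max_def min_def)
  have clip_cont: "continuous_on UNIV (clip R)" for R unfolding clip_def by (intro continuous_intros)
  have LT[measurable]: "L T \<in> borel_measurable M" using L_measurable[of T] horizon_pos by simp
  have \<tau>m[measurable]: "\<tau> \<in> borel_measurable M"
    using measurable_from_F[OF stopping_measurable[OF \<tau>]] by simp
  have L\<tau>[measurable]: "(\<lambda>\<omega>. L (\<tau> \<omega>) \<omega>) \<in> borel_measurable M"
    using measurable_from_F[OF L_stopping_measurable[OF \<tau>]] by simp
  have Ld[measurable]: "(\<lambda>\<omega>. L (d n \<omega>) \<omega>) \<in> borel_measurable M" for n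
    using measurable_from_F[OF L_grid_stopping_measurable[OF \<tau>, of n]] by (simp add: d_def)
  have dm[measurable]: "d n \<in> borel_measurable M" for n
    unfolding d_def upper_grid_def by measurable
  have \<tau>int: "integrable M \<tau>"
    using stopping_bounds[OF \<tau>] horizon_pos by (intro integrable_const_bound[where B=T]) auto

  have grid: "\<bar>expectation (\<lambda>\<omega>. clip R (L r \<omega> - m * r))\<bar> \<le> \<epsilon> R"
    if R: "0 \<le> R" and r: "r \<in> grid_points T n" for R r n
  proof -
    note b = grid_points_bounds[OF horizon_pos r]
    have intr: "integrable M (L r)" using b by (intro integrable_earlier[OF int]) auto
    then have Lr[measurable]: "L r \<in> borel_measurable M" by auto
    have ci: "integrable M (\<lambda>\<omega>. clip R (L r \<omega> - m * r))"
      by (rule integrable_const_bound[where B=R]) (auto simp: clip_bound R)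
    have "expectation (\<lambda>\<omega>. L r \<omega> - m * r) = 0"
      using intr mean_grid[OF int r] by (simp add: m_def prob_space)
    then have "\<bar>expectation (\<lambda>\<omega>. clip R (L r \<omega> - m * r))\<bar> =
        \<bar>expectation (\<lambda>\<omega>. clip R (L r \<omega> - m * r) - (L r \<omega> - m * r))\<bar>"
      using ci intr by simp
    also have "\<dots> \<le> expectation (\<lambda>\<omega>. \<bar>clip R (L r \<omega> - m * r) - (L r \<omega> - m * r)\<bar>)"
      by (rule integral_abs_bound)
    also have "\<dots> = expectation (\<lambda>\<omega>. max 0 (\<bar>L r \<omega> - m * r\<bar> - R))"
      using R by (intro Bochner_Integration.integral_cong) (auto simp: clip_def)
    also have "\<dots> \<le> \<epsilon> R" unfolding \<epsilon>_def by (rule convex_moment_le[OF int r R m_def])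
    finally show ?thesis .
  qed

  have stopped_grid: "\<bar>expectation (\<lambda>\<omega>. clip R (L T \<omega> - L (d n \<omega>) \<omega> - m * (T - d n \<omega>)))\<bar> \<le> \<epsilon> R"
    if R: "0 \<le> R" for R n
  proof -
    let ?Y = "\<lambda>\<omega>. clip R (L T \<omega> - L (d n \<omega>) \<omega> - m * (T - d n \<omega>))"
    have Yint: "integrable M ?Y"
      by (rule integrable_const_bound[where B=R]) (auto simp: clip_bound R)
    have lower: "0 \<le> clip R x + R" for x using clip_bound[OF R, of x] by linarith
    have inner: "(\<integral>\<^sup>+\<omega>'. ennreal (clip R (L (T - r) \<omega>' - m * (T - r)) + R) \<partial>M) =
        ennreal (expectation (\<lambda>\<omega>'. clip R (L (T - r) \<omega>' - m * (T - r))) + R)"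
      if r: "r \<in> grid_points T n" for r
    proof -
      have Lr[measurable]: "L (T - r) \<in> borel_measurable M"
        using grid_points_bounds[OF horizon_pos r] by (intro L_measurable) auto
      have ci: "integrable M (\<lambda>\<omega>. clip R (L (T - r) \<omega> - m * (T - r)))"
        by (rule integrable_const_bound[where B=R]) (auto simp: clip_bound R)
      show ?thesis
        using ci lower by (subst nn_integral_eq_integral) (auto simp: prob_space)
    qed
    have dg: "d n \<omega> \<in> grid_points T n" if "\<omega> \<in> space M" for \<omega>
      using stopping_bounds[OF \<tau> that] by (auto simp: d_def intro!: upper_grid_in_grid_points horizon_pos)
    \<comment> \<open>Adding \<open>R\<close> makes the clipped variable nonnegative.\<close>
    have "ennreal (expectation ?Y + R) = (\<integral>\<^sup>+\<omega>. ennreal (?Y \<omega> + R) \<partial>M)"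
      using Yint lower by (subst nn_integral_eq_integral) (auto simp: prob_space)
    also have "\<dots> = (\<integral>\<^sup>+\<omega>. 1 * ennreal (clip R (L T \<omega> - L (d n \<omega>) \<omega> - m * (T - d n \<omega>)) + R) \<partial>M)"
      by simp
    also have "\<dots> = (\<integral>\<^sup>+\<omega>. 1 * (\<integral>\<^sup>+\<omega>'. ennreal (clip R (L (T - d n \<omega>) \<omega>' - m * (T - d n \<omega>)) + R) \<partial>M) \<partial>M)"
      unfolding d_def by (rule nn_integral_increment_after_grid_stopping[OF \<tau>]) simp_all
    also have "\<dots> = (\<integral>\<^sup>+\<omega>. ennreal (expectation (\<lambda>\<omega>'. clip R (L (T - d n \<omega>) \<omega>' - m * (T - d n \<omega>))) + R) \<partial>M)"
      by (intro nn_integral_cong) (simp add: inner dg)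
    finally have eq: "ennreal (expectation ?Y + R) =
      (\<integral>\<^sup>+\<omega>. ennreal (expectation (\<lambda>\<omega>'. clip R (L (T - d n \<omega>) \<omega>' - m * (T - d n \<omega>))) + R) \<partial>M)" .
    have EY: "0 \<le> expectation ?Y + R"
    proof -
      have "- R \<le> expectation ?Y"
        by (rule integral_ge_const[OF Yint]) (use clip_bound[OF R] in \<open>auto simp: abs_le_iff minus_le_iff\<close>)
      then show ?thesis by simp
    qed
    have "\<epsilon> R \<ge> 0" unfolding \<epsilon>_def by simp
    have g: "expectation (\<lambda>\<omega>'. clip R (L (T - d n \<omega>) \<omega>' - m * (T - d n \<omega>))) + R \<le> \<epsilon> R + R"
      "- \<epsilon> R + R \<le> expectation (\<lambda>\<omega>'. clip R (L (T - d n \<omega>) \<omega>' - m * (T - d n \<omega>))) + R"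
      if "\<omega> \<in> space M" for \<omega>
      using grid[OF R grid_points_reflect[OF dg[OF that]]] by linarith+
    have "ennreal (expectation ?Y + R) \<le> (\<integral>\<^sup>+\<omega>. ennreal (\<epsilon> R + R) \<partial>M)"
      unfolding eq by (intro nn_integral_mono ennreal_leI g)
    then have "expectation ?Y + R \<le> \<epsilon> R + R"
      using \<open>\<epsilon> R \<ge> 0\<close> R by (simp add: emeasure_space_1 ennreal_le_iff del: ennreal_plus)
    moreover have "(\<integral>\<^sup>+\<omega>. ennreal (- \<epsilon> R + R) \<partial>M) \<le> ennreal (expectation ?Y + R)"
      unfolding eq by (intro nn_integral_mono ennreal_leI g)
    then have "- \<epsilon> R + R \<le> expectation ?Y + R"
      using EY by (simp add: emeasure_space_1 ennreal_le_iff del: ennreal_plus)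
    ultimately show ?thesis by linarith
  qed

  have stopped: "\<bar>expectation (\<lambda>\<omega>. clip R (L T \<omega> - L (\<tau> \<omega>) \<omega> - m * (T - \<tau> \<omega>)))\<bar> \<le> \<epsilon> R"
    if R: "0 \<le> R" for R
  proof -
    have "(\<lambda>n. expectation (\<lambda>\<omega>. clip R (L T \<omega> - L (d n \<omega>) \<omega> - m * (T - d n \<omega>)))) \<longlonglongrightarrow>
        expectation (\<lambda>\<omega>. clip R (L T \<omega> - L (\<tau> \<omega>) \<omega> - m * (T - \<tau> \<omega>)))"
    proof (rule integral_dominated_convergence[where w="\<lambda>_. R"])
      show "AE \<omega> in M. (\<lambda>n. clip R (L T \<omega> - L (d n \<omega>) \<omega> - m * (T - d n \<omega>)))
          \<longlonglongrightarrow> clip R (L T \<omega> - L (\<tau> \<omega>) \<omega> - m * (T - \<tau> \<omega>))"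
      proof (rule AE_I2)
        fix \<omega> assume \<omega>: "\<omega> \<in> space M"
        show "(\<lambda>n. clip R (L T \<omega> - L (d n \<omega>) \<omega> - m * (T - d n \<omega>)))
          \<longlonglongrightarrow> clip R (L T \<omega> - L (\<tau> \<omega>) \<omega> - m * (T - \<tau> \<omega>))"
          unfolding d_def
          by (rule continuous_on_tendsto_compose[OF clip_cont],
              intro tendsto_intros L_upper_grid_tendsto upper_grid_tendsto horizon_pos)
            (use \<omega> stopping_bounds[OF \<tau> \<omega>] in auto)
      qed
    qed (auto simp: clip_bound R)
    then have "(\<lambda>n. \<bar>expectation (\<lambda>\<omega>. clip R (L T \<omega> - L (d n \<omega>) \<omega> - m * (T - d n \<omega>)))\<bar>) \<longlonglongrightarrow>
        \<bar>expectation (\<lambda>\<omega>. clip R (L T \<omega> - L (\<tau> \<omega>) \<omega> - m * (T - \<tau> \<omega>)))\<bar>"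
      by (rule tendsto_rabs)
    then show ?thesis by (rule LIMSEQ_le_const2) (use stopped_grid[OF R] in auto)
  qed

  let ?W = "\<lambda>\<omega>. L T \<omega> - L (\<tau> \<omega>) \<omega> - m * (T - \<tau> \<omega>)"
  have Wint: "integrable M ?W" using int int\<tau> \<tau>int by auto
  have "(\<lambda>k. expectation (\<lambda>\<omega>. clip (real k) (?W \<omega>))) \<longlonglongrightarrow> expectation ?W"
  proof (rule integral_dominated_convergence[where w="\<lambda>\<omega>. \<bar>?W \<omega>\<bar>"])
    show "AE \<omega> in M. (\<lambda>k. clip (real k) (?W \<omega>)) \<longlonglongrightarrow> ?W \<omega>"
    proof (rule AE_I2, rule tendsto_eventually)
      fix \<omega>
      have "\<forall>\<^sub>F k in sequentially. \<bar>?W \<omega>\<bar> \<le> real k"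
        using filterlim_real_sequentially unfolding filterlim_at_top by blast
      then show "\<forall>\<^sub>F k in sequentially. clip (real k) (?W \<omega>) = ?W \<omega>"
        by (rule eventually_mono) (auto simp: clip_def)
    qed
  qed (use Wint clip_abs in auto)
  moreover have "(\<lambda>k. expectation (\<lambda>\<omega>. clip (real k) (?W \<omega>))) \<longlonglongrightarrow> 0"
  proof (rule Lim_null_comparison)
    show "\<forall>\<^sub>F k in sequentially. norm (expectation (\<lambda>\<omega>. clip (real k) (?W \<omega>))) \<le> \<epsilon> (real k)"
      using stopped by simp
    have "(\<lambda>k. expectation (\<lambda>\<omega>. max 0 (\<bar>L T \<omega> - m * T\<bar> - real k))) \<longlonglongrightarrow> expectation (\<lambda>_. 0)"
    proof (rule integral_dominated_convergence[where w="\<lambda>\<omega>. \<bar>L T \<omega> - m * T\<bar>"])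
      show "AE \<omega> in M. (\<lambda>k. max 0 (\<bar>L T \<omega> - m * T\<bar> - real k)) \<longlonglongrightarrow> 0"
      proof (rule AE_I2, rule tendsto_eventually)
        fix \<omega>
        have "\<forall>\<^sub>F k in sequentially. \<bar>L T \<omega> - m * T\<bar> \<le> real k"
          using filterlim_real_sequentially unfolding filterlim_at_top by blast
        then show "\<forall>\<^sub>F k in sequentially. max 0 (\<bar>L T \<omega> - m * T\<bar> - real k) = 0"
          by (rule eventually_mono) auto
      qed
    qed (use int in auto)
    then show "(\<lambda>k. \<epsilon> (real k)) \<longlonglongrightarrow> 0" by (simp add: \<epsilon>_def)
  qed
  ultimately have "expectation ?W = 0" using LIMSEQ_unique by blast
  moreover have "expectation ?W = expectation (L T) - expectation (\<lambda>\<omega>. L (\<tau> \<omega>) \<omega>) - m * (T - expectation \<tau>)"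
    using int int\<tau> \<tau>int by (simp add: prob_space)
  ultimately have "expectation (\<lambda>\<omega>. L (\<tau> \<omega>) \<omega>) = expectation (L T) - m * T + m * expectation \<tau>"
    by (simp add: right_diff_distrib)
  moreover have "m * T = expectation (L T)" using horizon_pos by (simp add: m_def)
  ultimately show ?thesis by (simp add: m_def)
qed

text \<open>
  A constant time is a stopping time; Wald's identity extends linearity from the grid points to it.
\<close>
lemma mean_linear:
  assumes int: "integrable M (L T)" and t: "0 \<le> t" "t \<le> T"
  shows "expectation (L t) = expectation (L T) / T * t"
  using wald_identity[OF int, of "\<lambda>_. t"] integrable_earlier[OF int t] t
  by (simp add: stopping_time_upto_def stopping_time_const prob_space)

lemma martingale_of_mean_zero:
  assumes int: "integrable M (L T)" and mean: "expectation (L T) = 0"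
  shows "martingale_upto M T F L"
  unfolding martingale_upto_def
proof (intro conjI ballI allI impI)
  show "adapted_upto T F L"
    unfolding adapted_upto_def using L_measurable_F by auto
  show "integrable M (L t)" if "t \<in> {0..T}" for t
    using that by (auto intro!: integrable_earlier[OF int])
  fix s t assume "0 \<le> s \<and> s \<le> t \<and> t \<le> T"
  then have st: "0 \<le> s" "s \<le> t" "t \<le> T" by auto
  interpret fs: finite_measure_subalgebra M "F s"
    by unfold_locales (use subalgebra_le st in auto)
  have ints: "integrable M (L s)" "integrable M (L t)" "integrable M (L (t - s))"
    using st by (auto intro!: integrable_earlier[OF int])
  show "AE \<omega> in M. real_cond_exp M (F s) (L t) \<omega> = L s \<omega>"
  proof (rule fs.real_cond_exp_charact)
    fix A assume A: "A \<in> sets (F s)"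
    then have AM: "A \<in> events" using fs.subalg by (auto simp: subalgebra_def)
    have "expectation (\<lambda>\<omega>. indicator A \<omega> * (L t \<omega> - L s \<omega>)) = expectation (indicator A) * expectation (L (t - s))"
      using A AM ints by (intro integral_increment(2)[OF st, where g="\<lambda>x. x"]) (auto intro!: integrable_const_bound[where B=1])
    also have "\<dots> = 0" using st mean mean_linear[OF int, of "t - s"] by simp
    finally have z: "expectation (\<lambda>\<omega>. indicator A \<omega> * (L t \<omega> - L s \<omega>)) = 0" .
    have ind: "integrable M (\<lambda>\<omega>. indicator A \<omega> * L t \<omega>)" "integrable M (\<lambda>\<omega>. indicator A \<omega> * L s \<omega>)"
      using integrable_real_mult_indicator[OF AM ints(2)] integrable_real_mult_indicator[OF AM ints(1)]
      by (simp_all only: mult.commute)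
    have "expectation (\<lambda>\<omega>. indicator A \<omega> * L t \<omega>) - expectation (\<lambda>\<omega>. indicator A \<omega> * L s \<omega>) =
        expectation (\<lambda>\<omega>. indicator A \<omega> * (L t \<omega> - L s \<omega>))"
      unfolding right_diff_distrib by (rule Bochner_Integration.integral_diff[OF ind, symmetric])
    then show "set_lebesgue_integral M A (L t) = set_lebesgue_integral M A (L s)"
      unfolding set_lebesgue_integral_def real_scaleR_def using z by linarith
  qed (use ints st L_measurable_F in auto)
qed

end

section \<open>Monotone processes and the Esscher measure\<close>

context levy_setting
begin

text \<open>
  If all of the first \<open>i + 1\<close> increments over steps of length \<open>h\<close> are negative, so is the value at
  \<open>h * (i + 1)\<close>.
\<close>
lemma prob_step_neg_power_le:
  assumes h: "0 < h" "h * real (Suc n) \<le> T" and i: "i \<le> n"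
  shows "prob {\<omega>\<in>space M. L h \<omega> < 0} ^ Suc i \<le> prob {\<omega>\<in>space M. L (h * real (Suc i)) \<omega> < 0}"
  using i
proof (induction i)
  case 0
  then show ?case by simp
next
  case (Suc i)
  define s where "s = h * real (Suc i)"
  have eq: "s + h = h * real (Suc (Suc i))" by (simp add: s_def algebra_simps)
  have "h * real (Suc (Suc i)) \<le> h * real (Suc n)" using Suc.prems h by (intro mult_left_mono) auto
  then have le: "s + h \<le> T" using h eq by linarith
  have s: "0 \<le> s" using h by (simp add: s_def)
  have [measurable]: "L s \<in> borel_measurable M" "L (s + h) \<in> borel_measurable M"
    using s h le by (auto intro!: L_measurable)
  have [measurable]: "L s \<in> borel_measurable (F s)" using s h le by (intro L_measurable_F) auto
  have "{\<omega>\<in>space (F s). L s \<omega> < 0} \<in> sets (F s)" by measurable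
  then have A: "{\<omega>\<in>space M. L s \<omega> < 0} \<in> sets (F s)" by (simp add: space_F)
  have "prob {\<omega>\<in>space M. L h \<omega> < 0} ^ Suc (Suc i) \<le>
      prob {\<omega>\<in>space M. L s \<omega> < 0} * prob {\<omega>\<in>space M. L h \<omega> < 0}"
    using mult_right_mono[OF Suc.IH measure_nonneg] Suc.prems
    by (simp add: s_def mult.commute)
  also have "\<dots> = prob ({\<omega>\<in>space M. L s \<omega> < 0} \<inter> {\<omega>\<in>space M. L (s + h) \<omega> - L s \<omega> \<in> {..<0}})"
    using prob_increment[OF s _ le A, of "{..<0}"] h by simp
  also have "\<dots> \<le> prob {\<omega>\<in>space M. L (s + h) \<omega> < 0}"
    by (rule finite_measure_mono) auto
  finally show ?case unfolding eq .
qed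

text \<open>
  If the increments over a grid step were negative with positive probability, so would be \<open>L\<^sub>T\<close>. Hence
  almost every path increases along all grids, and by right-continuity on \<open>{0..T}\<close>.
\<close>
lemma subordinator_of_nonneg:
  assumes nonneg: "AE \<omega> in M. 0 \<le> L T \<omega>"
  shows "subordinator M T F L"
proof -
  define h where "h n = T / real (Suc n)" for n
  have h: "0 < h n" "h n * real (Suc n) = T" for n using horizon_pos by (auto simp: h_def simp del: of_nat_Suc)
  have LT[measurable]: "L T \<in> borel_measurable M" using L_measurable[of T] horizon_pos by simp
  have hT: "h n * real (Suc i) \<le> T" if "i \<le> n" for i n
  proof -
    have "h n * real (Suc i) \<le> h n * real (Suc n)" using h(1)[of n] that by (intro mult_left_mono) auto
    then show ?thesis by (simp only: h(2))
  qed
  have "prob {\<omega>\<in>space M. L T \<omega> < 0} = 0"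
    using nonneg by (subst prob_eq_0) (auto simp: not_less)
  then have pow: "prob {\<omega>\<in>space M. L (h n) \<omega> < 0} ^ Suc n \<le> 0" for n
    using prob_step_neg_power_le[of "h n" n n] h[of n] by simp
  have step: "prob {\<omega>\<in>space M. L (h n) \<omega> < 0} = 0" for n
  proof (rule ccontr)
    assume "prob {\<omega>\<in>space M. L (h n) \<omega> < 0} \<noteq> 0"
    then have "0 < prob {\<omega>\<in>space M. L (h n) \<omega> < 0}" by (simp add: zero_less_measure_iff)
    from zero_less_power[OF this, of "Suc n"] pow[of n] show False by linarith
  qed
  have "AE \<omega> in M. L (h n * real i) \<omega> \<le> L (h n * real (Suc i)) \<omega>" if i: "i \<le> n" for n i
  proof -
    let ?s = "h n * real i" and ?t = "h n * real (Suc i)"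
    have st: "0 \<le> ?s" "?s \<le> ?t" "?t \<le> T" "?t - ?s = h n" using h[of n] hT[OF i] by (auto simp: algebra_simps)
    have [measurable]: "L ?s \<in> borel_measurable M" "L ?t \<in> borel_measurable M"
      using st by (auto intro!: L_measurable simp del: of_nat_Suc)
    have "space M \<in> sets (F ?s)" using sets.top[of "F ?s"] by (simp add: space_F)
    then have "prob (space M \<inter> {\<omega>\<in>space M. L ?t \<omega> - L ?s \<omega> \<in> {..<0}}) = 0"
      using prob_increment[OF st(1-3), of "space M" "{..<0}", unfolded st(4)] step[of n]
      by (simp del: of_nat_Suc)
    also have "space M \<inter> {\<omega>\<in>space M. L ?t \<omega> - L ?s \<omega> \<in> {..<0}} = {\<omega>\<in>space M. L ?t \<omega> < L ?s \<omega>}" by auto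
    finally have "AE \<omega> in M. \<not> L ?t \<omega> < L ?s \<omega>"
      by (subst (asm) prob_eq_0) (auto simp del: of_nat_Suc)
    then show ?thesis by (simp only: not_less)
  qed
  then have "AE \<omega> in M. \<forall>n i. i \<le> n \<longrightarrow> L (h n * real i) \<omega> \<le> L (h n * real (Suc i)) \<omega>"
    by (simp add: AE_all_countable)
  moreover have "mono_on {0..T} (\<lambda>t. L t \<omega>)"
    if \<omega>: "\<omega> \<in> space M" and steps: "\<And>n i. i \<le> n \<Longrightarrow> L (h n * real i) \<omega> \<le> L (h n * real (Suc i)) \<omega>" for \<omega>
  proof (rule mono_onI)
    fix s t assume st: "s \<in> {0..T}" "t \<in> {0..T}" "s \<le> t"
    have grid_mono: "L (h n * real j) \<omega> \<le> L (h n * real k) \<omega>" if "j \<le> k" "k \<le> Suc n" for n j k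
      using that
    proof (induction k rule: dec_induct)
      case (step k)
      then show ?case using steps[of k n] by (auto intro: order_trans)
    qed simp
    have "L (upper_grid T n s) \<omega> \<le> L (upper_grid T n t) \<omega>" for n
    proof -
      obtain j where j: "j \<le> Suc n" "upper_grid T n s = h n * real j"
        using upper_grid_in_grid_points[OF horizon_pos, of s n] st by (auto simp: grid_points_def h_def)
      obtain k where k: "k \<le> Suc n" "upper_grid T n t = h n * real k"
        using upper_grid_in_grid_points[OF horizon_pos, of t n] st by (auto simp: grid_points_def h_def)
      have "h n * real j \<le> h n * real k"
        using upper_grid_mono[OF horizon_pos st(3), of n] j k by simp
      then have "j \<le> k" using h(1)[of n] by simp
      then show ?thesis using grid_mono[OF _ k(1)] j k by simp
    qed
    then show "L s \<omega> \<le> L t \<omega>"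
      using st by (intro LIMSEQ_le[OF L_upper_grid_tendsto[OF \<omega>] L_upper_grid_tendsto[OF \<omega>]]) auto
  qed
  ultimately have "AE \<omega> in M. mono_on {0..T} (\<lambda>t. L t \<omega>)" by auto
  then show ?thesis using levy by (simp only: subordinator_def simp_thms)
qed

definition esscher :: "real \<Rightarrow> real \<Rightarrow> 'a measure" where
  "esscher u c = density (restr_to_subalg M (F T)) (\<lambda>\<omega>. ennreal (exp (u * L T \<omega>) / c))"

lemma sets_esscher [simp]: "sets (esscher u c) = sets (F T)"
  by (simp add: esscher_def sets_restr_to_subalg[OF subalgebra_F])

lemma space_esscher [simp]: "space (esscher u c) = space M"
  by (simp add: esscher_def space_restr_to_subalg)

text \<open>
  On an event known at time \<open>r\<close> the increment from \<open>r\<close> to \<open>T\<close> integrates out. The factor \<open>c\<close> is kept on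
  the left to avoid division in the extended nonnegative reals.
\<close>
lemma emeasure_esscher:
  assumes c: "0 < c" and r: "0 \<le> r" "r \<le> T" and A: "A \<in> sets (F r)"
  shows "ennreal c * emeasure (esscher u c) A =
    (\<integral>\<^sup>+\<omega>. indicator A \<omega> * ennreal (exp (u * L r \<omega>)) \<partial>M) * (\<integral>\<^sup>+\<omega>. ennreal (exp (u * L (T - r) \<omega>)) \<partial>M)"
proof -
  have AT: "A \<in> sets (F T)" using A sets_F_mono[OF r(2)] by auto
  have LT: "L T \<in> borel_measurable (F T)" using L_measurable_F[of T T] horizon_pos by simp
  have dens: "(\<lambda>\<omega>. ennreal (exp (u * L T \<omega>) / c)) \<in> borel_measurable (restr_to_subalg M (F T))"
    by (rule measurable_in_subalg[OF subalgebra_F]) (use LT in measurable)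
  have "emeasure (esscher u c) A =
      (\<integral>\<^sup>+\<omega>. ennreal (exp (u * L T \<omega>) / c) * indicator A \<omega> \<partial>restr_to_subalg M (F T))"
    unfolding esscher_def
    by (rule emeasure_density[OF dens]) (simp add: AT sets_restr_to_subalg[OF subalgebra_F])
  also have "\<dots> = (\<integral>\<^sup>+\<omega>. ennreal (exp (u * L T \<omega>) / c) * indicator A \<omega> \<partial>M)"
    by (rule nn_integral_subalgebra2[OF subalgebra_F]) (use LT AT in measurable)
  finally have "ennreal c * emeasure (esscher u c) A =
      ennreal c * (\<integral>\<^sup>+\<omega>. ennreal (exp (u * L T \<omega>) / c) * indicator A \<omega> \<partial>M)" by simp
  also have "\<dots> = (\<integral>\<^sup>+\<omega>. ennreal c * (ennreal (exp (u * L T \<omega>) / c) * indicator A \<omega>) \<partial>M)"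
  proof (rule nn_integral_cmult[symmetric], rule measurable_from_F[OF _ order_refl])
    show "(\<lambda>\<omega>. ennreal (exp (u * L T \<omega>) / c) * indicator A \<omega>) \<in> borel_measurable (F T)"
      using LT AT by measurable
  qed
  also have "\<dots> = (\<integral>\<^sup>+\<omega>. (indicator A \<omega> * ennreal (exp (u * L r \<omega>))) * ennreal (exp (u * (L T \<omega> - L r \<omega>))) \<partial>M)"
  proof (rule nn_integral_cong)
    fix \<omega>
    have "exp (u * L T \<omega>) = exp (u * L r \<omega>) * exp (u * (L T \<omega> - L r \<omega>))"
      by (simp add: right_diff_distrib flip: exp_add)
    then have "c * (exp (u * L T \<omega>) / c) = exp (u * L r \<omega>) * exp (u * (L T \<omega> - L r \<omega>))"
      using c by simp
    then have "ennreal c * ennreal (exp (u * L T \<omega>) / c) =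
        ennreal (exp (u * L r \<omega>)) * ennreal (exp (u * (L T \<omega> - L r \<omega>)))"
      using c by (simp only: ennreal_mult'[symmetric] exp_ge_zero less_imp_le)
    then show "ennreal c * (ennreal (exp (u * L T \<omega>) / c) * indicator A \<omega>) =
        indicator A \<omega> * ennreal (exp (u * L r \<omega>)) * ennreal (exp (u * (L T \<omega> - L r \<omega>)))"
      by (auto split: split_indicator)
  qed
  also have "\<dots> = (\<integral>\<^sup>+\<omega>. indicator A \<omega> * ennreal (exp (u * L r \<omega>)) \<partial>M) * (\<integral>\<^sup>+\<omega>. ennreal (exp (u * L (T - r) \<omega>)) \<partial>M)"
  proof (rule nn_integral_increment[OF r order_refl])
    have "L r \<in> borel_measurable (F r)" using r by (intro L_measurable_F) auto
    then show "(\<lambda>\<omega>. indicator A \<omega> * ennreal (exp (u * L r \<omega>))) \<in> borel_measurable (F r)"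
      using A by measurable
  qed simp
  finally show ?thesis .
qed

text \<open>
  The density is a product of factors for the time before \<open>s\<close>, for the increment from \<open>s\<close> to \<open>t\<close>, and for the
  increment from \<open>t\<close> to \<open>T\<close>, and these are independent. Multiplicativity of the exponential moment
  makes the normalising constants agree.
\<close>
lemma levy_setting_esscher:
  assumes c: "(\<integral>\<^sup>+\<omega>. ennreal (exp (u * L T \<omega>)) \<partial>M) = ennreal c" "0 < c"
  shows "levy_setting (esscher u c) T F L"
proof (rule levy_setting.intro)
  have spaceF: "space M \<in> sets (F r)" for r using sets.top[of "F r"] by (simp add: space_F)
  define \<Phi> where "\<Phi> t = (\<integral>\<^sup>+\<omega>. ennreal (exp (u * L t \<omega>)) \<partial>M)" for t
  have add: "\<Phi> (s + t) = \<Phi> s * \<Phi> t" if "0 \<le> s" "0 \<le> t" "s + t \<le> T" for s t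
    unfolding \<Phi>_def by (rule exp_moment_add[OF that])
  have "ennreal c * emeasure (esscher u c) (space M) = ennreal c"
  proof -
    have "(\<integral>\<^sup>+\<omega>. indicator (space M) \<omega> * ennreal (exp (u * L T \<omega>)) \<partial>M) = ennreal c"
      unfolding c(1)[symmetric] by (rule nn_integral_cong) simp
    then show ?thesis
      using emeasure_esscher[OF c(2) _ order_refl spaceF, of u] horizon_pos
      by (simp add: exp_moment_0)
  qed
  then have "emeasure (esscher u c) (space M) = 1"
    using c(2) ennreal_mult_cancel_left[of "ennreal c" _ 1] by simp
  then have prob: "prob_space (esscher u c)" by (intro prob_spaceI) simp
  then interpret Q: prob_space "esscher u c" .
  show "subalgebra (esscher u c) (F T)" by (simp add: subalgebra_def space_F)
  show "filtration (space (esscher u c)) F" using filtration_F by simp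
  show "levy_process (esscher u c) T F L"
  proof (rule levy_processI)
    fix s t A and B :: "real set"
    assume st: "0 \<le> s" "s \<le> t" "t \<le> T" and A: "A \<in> sets (F s)" and B: "B \<in> sets borel"
    let ?E = "{\<omega>\<in>space M. L t \<omega> - L s \<omega> \<in> B}" and ?I = "{\<omega>\<in>space M. L (t - s) \<omega> \<in> B}"
    have mt: "L t \<in> borel_measurable (F t)" "L s \<in> borel_measurable (F t)"
      using st by (auto intro!: L_measurable_F)
    have E: "?E \<in> sets (F t)"
    proof -
      have "?E = (\<lambda>\<omega>. L t \<omega> - L s \<omega>) -` B \<inter> space (F t)" by (auto simp: space_F)
      then show ?thesis using measurable_sets[OF borel_measurable_diff[OF mt] B] by simp
    qed
    have AE: "A \<inter> ?E \<in> sets (F t)" using E A sets_F_mono[OF st(2)] by auto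
    have "L (t - s) \<in> borel_measurable (F (t - s))" using st by (intro L_measurable_F) auto
    then have E0: "?I \<in> sets (F (t - s))"
    proof -
      have "?I = L (t - s) -` B \<inter> space (F (t - s))" by (auto simp: space_F)
      then show ?thesis using measurable_sets[OF \<open>L (t - s) \<in> borel_measurable (F (t - s))\<close> B] by simp
    qed
    define a where "a = (\<integral>\<^sup>+\<omega>. indicator A \<omega> * ennreal (exp (u * L s \<omega>)) \<partial>M)"
    define b where "b = (\<integral>\<^sup>+\<omega>. indicator B (L (t - s) \<omega>) * ennreal (exp (u * L (t - s) \<omega>)) \<partial>M)"
    have QA: "ennreal c * emeasure (esscher u c) A = a * \<Phi> (T - s)"
      unfolding a_def \<Phi>_def by (rule emeasure_esscher[OF c(2)]) (use st A in auto)
    have QE0: "ennreal c * emeasure (esscher u c) ?I = b * \<Phi> (T - (t - s))"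
    proof -
      have "b = (\<integral>\<^sup>+\<omega>. indicator ?I \<omega> * ennreal (exp (u * L (t - s) \<omega>)) \<partial>M)"
        unfolding b_def by (intro nn_integral_cong) (auto split: split_indicator)
      then show ?thesis
        unfolding \<Phi>_def using emeasure_esscher[OF c(2) _ _ E0, of u] st by simp
    qed
    have "(\<integral>\<^sup>+\<omega>. indicator (A \<inter> ?E) \<omega> * ennreal (exp (u * L t \<omega>)) \<partial>M) =
        (\<integral>\<^sup>+\<omega>. (indicator A \<omega> * ennreal (exp (u * L s \<omega>))) *
          (indicator B (L t \<omega> - L s \<omega>) * ennreal (exp (u * (L t \<omega> - L s \<omega>)))) \<partial>M)"
      by (intro nn_integral_cong)
        (auto simp: ennreal_mult'[symmetric] exp_add[symmetric] algebra_simps split: split_indicator)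
    also have "\<dots> = a * b"
      unfolding a_def b_def
    proof (rule nn_integral_increment[OF st])
      have "L s \<in> borel_measurable (F s)" using st by (intro L_measurable_F) auto
      then show "(\<lambda>\<omega>. indicator A \<omega> * ennreal (exp (u * L s \<omega>))) \<in> borel_measurable (F s)"
        using A by measurable
      show "(\<lambda>x. indicator B x * ennreal (exp (u * x))) \<in> borel_measurable borel"
        using B by measurable
    qed
    finally have QAE: "ennreal c * emeasure (esscher u c) (A \<inter> ?E) = a * b * \<Phi> (T - t)"
      unfolding \<Phi>_def using emeasure_esscher[OF c(2) _ _ AE, of u] st by simp
    have "ennreal c = \<Phi> s * \<Phi> (T - s)"
      using add[of s "T - s"] st c(1) by (simp add: \<Phi>_def)
    \<comment> \<open>Both sides are \<open>\<Phi> s * \<Phi> (T - s) * \<Phi> (T - t)\<close>.\<close>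
    then have mult: "ennreal c * \<Phi> (T - t) = \<Phi> (T - s) * \<Phi> (T - (t - s))"
      using add[of s "T - t"] st by (simp add: algebra_simps)
    have "(ennreal c * ennreal c) * emeasure (esscher u c) (A \<inter> ?E) = a * b * (ennreal c * \<Phi> (T - t))"
      using QAE by (simp add: ac_simps)
    also have "\<dots> = (ennreal c * emeasure (esscher u c) A) * (ennreal c * emeasure (esscher u c) ?I)"
      unfolding QA QE0 mult by (simp add: ac_simps)
    also have "\<dots> = (ennreal c * ennreal c) * (emeasure (esscher u c) A * emeasure (esscher u c) ?I)"
      by (simp add: ac_simps)
    finally have "emeasure (esscher u c) (A \<inter> ?E) = emeasure (esscher u c) A * emeasure (esscher u c) ?I"
      using c(2) by (subst (asm) ennreal_mult_cancel_left) (auto simp: ennreal_mult_eq_top_iff)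
    then have "ennreal (Q.prob (A \<inter> ?E)) = ennreal (Q.prob A * Q.prob ?I)"
      by (simp add: Q.emeasure_eq_measure ennreal_mult)
    then show "Q.prob (A \<inter> {\<omega> \<in> space (esscher u c). L t \<omega> - L s \<omega> \<in> B}) =
        Q.prob A * Q.prob {\<omega> \<in> space (esscher u c). L (t - s) \<omega> \<in> B}" by simp
  next
    show "cadlag_on T (\<lambda>t. L t \<omega>)" if "\<omega> \<in> space (esscher u c)" for \<omega>
      using cadlag_paths that by simp
  qed (use prob filtration_F L_0 L_measurable_F in \<open>auto simp: subalgebra_def space_F\<close>)
qed (rule horizon_pos)

end

section \<open>Tilting a truncated random variable, and relative entropy\<close>

context prob_space
begin

context
  fixes Y :: "'a \<Rightarrow> real" and n :: nat
  assumes Y[measurable]: "Y \<in> borel_measurable M"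
begin

abbreviation trunc :: "'a set" where "trunc \<equiv> {\<omega>\<in>space M. \<bar>Y \<omega>\<bar> \<le> real n}"

lemma integrable_trunc_exp: "integrable M (\<lambda>\<omega>. exp (v * Y \<omega>) * indicator trunc \<omega>)"
proof (rule integrable_const_bound[where B="exp (\<bar>v\<bar> * real n)"])
  have "v * Y \<omega> \<le> \<bar>v\<bar> * real n" if "\<bar>Y \<omega>\<bar> \<le> real n" for \<omega>
    using abs_ge_self[of "v * Y \<omega>"] mult_left_mono[OF that, of "\<bar>v\<bar>"] by (simp add: abs_mult)
  then show "AE \<omega> in M. norm (exp (v * Y \<omega>) * indicator trunc \<omega>) \<le> exp (\<bar>v\<bar> * real n)"
    by (intro AE_I2) (auto split: split_indicator)
qed measurable

lemma integrable_trunc_id_exp: "integrable M (\<lambda>\<omega>. Y \<omega> * exp (v * Y \<omega>) * indicator trunc \<omega>)"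
proof (rule Bochner_Integration.integrable_bound)
  show "integrable M (\<lambda>\<omega>. real n * (exp (v * Y \<omega>) * indicator trunc \<omega>))"
    using integrable_trunc_exp by simp
  show "AE \<omega> in M. norm (Y \<omega> * exp (v * Y \<omega>) * indicator trunc \<omega>)
      \<le> norm (real n * (exp (v * Y \<omega>) * indicator trunc \<omega>))"
    by (intro AE_I2) (auto simp: abs_mult split: split_indicator)
qed measurable

lemma trunc_exp_tendsto:
  assumes g: "g \<in> borel_measurable borel" "\<And>x. \<bar>x\<bar> \<le> real n \<Longrightarrow> \<bar>g x\<bar> \<le> C" and v: "w \<longlonglongrightarrow> v"
  shows "(\<lambda>k. expectation (\<lambda>\<omega>. g (Y \<omega>) * exp (w k * Y \<omega>) * indicator trunc \<omega>)) \<longlonglongrightarrow>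
    expectation (\<lambda>\<omega>. g (Y \<omega>) * exp (v * Y \<omega>) * indicator trunc \<omega>)"
proof -
  note g(1)[measurable]
  obtain B where B: "\<And>k. \<bar>w k\<bar> \<le> B"
    using convergent_imp_Bseq[OF convergentI[OF v]] by (auto simp: Bseq_def)
  show ?thesis
  proof (rule integral_dominated_convergence[where w="\<lambda>_. C * exp (B * real n)"])
    show "AE \<omega> in M. (\<lambda>k. g (Y \<omega>) * exp (w k * Y \<omega>) * indicator trunc \<omega>) \<longlonglongrightarrow>
        g (Y \<omega>) * exp (v * Y \<omega>) * indicator trunc \<omega>"
      by (intro AE_I2 tendsto_intros v)
    fix k
    have "w k * Y \<omega> \<le> B * real n" if "\<bar>Y \<omega>\<bar> \<le> real n" for \<omega>
    proof -
      have "w k * Y \<omega> \<le> \<bar>w k\<bar> * \<bar>Y \<omega>\<bar>" by (simp flip: abs_mult)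
      also have "\<dots> \<le> B * real n" using that B[of k] by (intro mult_mono) auto
      finally show ?thesis .
    qed
    moreover have C: "0 \<le> C" using g(2)[of 0] by simp
    ultimately have "\<bar>g (Y \<omega>)\<bar> * exp (w k * Y \<omega>) \<le> C * exp (B * real n)" if "\<bar>Y \<omega>\<bar> \<le> real n" for \<omega>
      using that g(2)[OF that] by (intro mult_mono) simp_all
    then show "AE \<omega> in M. norm (g (Y \<omega>) * exp (w k * Y \<omega>) * indicator trunc \<omega>) \<le> C * exp (B * real n)"
      using C by (intro AE_I2) (simp add: abs_mult split: split_indicator)
  qed auto
qed

text \<open>
  Both bounds keep only the event where \<open>Y\<close> is at least \<open>e\<close>; in the second one the contribution of
  negative \<open>Y\<close> is at least \<open>- n\<close>, because the exponential factor is at most \<open>1\<close> there.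
\<close>
lemma trunc_exp_lower:
  assumes e: "0 < e" and n: "N \<le> n" and v: "0 \<le> v"
  shows "prob {\<omega>\<in>space M. e \<le> Y \<omega> \<and> Y \<omega> \<le> real N} * exp (v * e)
      \<le> expectation (\<lambda>\<omega>. exp (v * Y \<omega>) * indicator trunc \<omega>)"
    and "prob {\<omega>\<in>space M. e \<le> Y \<omega> \<and> Y \<omega> \<le> real N} * (e * exp (v * e)) - real n
      \<le> expectation (\<lambda>\<omega>. Y \<omega> * exp (v * Y \<omega>) * indicator trunc \<omega>)"
proof -
  let ?A = "{\<omega>\<in>space M. e \<le> Y \<omega> \<and> Y \<omega> \<le> real N}"
  have A[measurable]: "?A \<in> events" by measurable
  have sub: "\<bar>Y \<omega>\<bar> \<le> real n" if "\<omega> \<in> ?A" for \<omega> using that e n by auto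
  have intA: "integrable M (\<lambda>\<omega>. a * indicator ?A \<omega>)" for a :: real
    by (intro integrable_mult_right integrable_real_indicator A) (simp add: emeasure_eq_measure)
  have "prob ?A * exp (v * e) = expectation (\<lambda>\<omega>. exp (v * e) * indicator ?A \<omega>)" using A by simp
  also have "\<dots> \<le> expectation (\<lambda>\<omega>. exp (v * Y \<omega>) * indicator trunc \<omega>)"
  proof (rule integral_mono[OF _ integrable_trunc_exp])
    fix \<omega> assume "\<omega> \<in> space M"
    then show "exp (v * e) * indicator ?A \<omega> \<le> exp (v * Y \<omega>) * indicator trunc \<omega>"
      using sub[of \<omega>] v by (auto split: split_indicator intro!: mult_left_mono)
  qed (rule intA)
  finally show "prob ?A * exp (v * e) \<le> expectation (\<lambda>\<omega>. exp (v * Y \<omega>) * indicator trunc \<omega>)" .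
  have int: "integrable M (\<lambda>\<omega>. e * exp (v * e) * indicator ?A \<omega>)"
    by (rule intA)
  have "prob ?A * (e * exp (v * e)) - real n = expectation (\<lambda>\<omega>. e * exp (v * e) * indicator ?A \<omega> - real n)"
    using A int by (simp add: prob_space)
  also have "\<dots> \<le> expectation (\<lambda>\<omega>. Y \<omega> * exp (v * Y \<omega>) * indicator trunc \<omega>)"
  proof (rule integral_mono[OF _ integrable_trunc_id_exp])
    fix \<omega> assume \<omega>: "\<omega> \<in> space M"
    show "e * exp (v * e) * indicator ?A \<omega> - real n \<le> Y \<omega> * exp (v * Y \<omega>) * indicator trunc \<omega>"
    proof (cases "\<omega> \<in> ?A")
      case True
      then have "e * exp (v * e) \<le> Y \<omega> * exp (v * Y \<omega>)"
        using e v by (intro mult_mono) (auto intro!: mult_left_mono)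
      then have "e * exp (v * e) - real n \<le> Y \<omega> * exp (v * Y \<omega>)" by linarith
      then show ?thesis using True sub[OF True] \<omega> by simp
    next
      case False
      have "- real n \<le> Y \<omega> * exp (v * Y \<omega>)" if "\<bar>Y \<omega>\<bar> \<le> real n"
      proof (cases "0 \<le> Y \<omega>")
        case True
        then have "0 \<le> Y \<omega> * exp (v * Y \<omega>)" by simp
        then show ?thesis by linarith
      next
        case False
        then have "exp (v * Y \<omega>) \<le> 1" using v by (simp add: mult_nonneg_nonpos)
        then have "Y \<omega> * 1 \<le> Y \<omega> * exp (v * Y \<omega>)" using False by (intro mult_left_mono_neg) auto
        then show ?thesis using that by linarith
      qed
      then show ?thesis using False \<omega> by (auto split: split_indicator)
    qed
  qed (rule Bochner_Integration.integrable_diff[OF int integrable_const])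
  finally show "prob ?A * (e * exp (v * e)) - real n \<le> expectation (\<lambda>\<omega>. Y \<omega> * exp (v * Y \<omega>) * indicator trunc \<omega>)" .
qed

end

lemma positive_prob_away_from_0:
  assumes Y[measurable]: "Y \<in> borel_measurable M" and pos: "0 < prob {\<omega>\<in>space M. 0 < Y \<omega>}"
  obtains k :: nat where "0 < prob {\<omega>\<in>space M. 1 / real (Suc k) \<le> Y \<omega> \<and> Y \<omega> \<le> real (Suc k)}"
proof (rule ccontr)
  assume "\<not> thesis"
  then have zero: "prob {\<omega>\<in>space M. 1 / real (Suc k) \<le> Y \<omega> \<and> Y \<omega> \<le> real (Suc k)} = 0" for k
    using that measure_nonneg[of M] by (metis order_less_le)
  have "emeasure M (\<Union>k. {\<omega>\<in>space M. 1 / real (Suc k) \<le> Y \<omega> \<and> Y \<omega> \<le> real (Suc k)}) = 0"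
    using zero by (intro emeasure_UN_eq_0) (auto simp: emeasure_eq_measure simp del: of_nat_Suc)
  moreover have "{\<omega>\<in>space M. 0 < Y \<omega>} \<subseteq> (\<Union>k. {\<omega>\<in>space M. 1 / real (Suc k) \<le> Y \<omega> \<and> Y \<omega> \<le> real (Suc k)})"
  proof
    fix \<omega> assume \<omega>: "\<omega> \<in> {\<omega>\<in>space M. 0 < Y \<omega>}"
    obtain k :: nat where k: "max (Y \<omega>) (1 / Y \<omega>) \<le> real k" using real_arch_simple by blast
    then have "Y \<omega> \<le> real (Suc k)" "1 / Y \<omega> \<le> real (Suc k)" by auto
    then have "1 / real (Suc k) \<le> Y \<omega>" using \<omega> by (simp add: field_simps del: of_nat_Suc)
    with \<open>Y \<omega> \<le> real (Suc k)\<close> \<omega>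
    show "\<omega> \<in> (\<Union>k. {\<omega>\<in>space M. 1 / real (Suc k) \<le> Y \<omega> \<and> Y \<omega> \<le> real (Suc k)})" by auto
  qed
  moreover have "(\<Union>k. {\<omega>\<in>space M. 1 / real (Suc k) \<le> Y \<omega> \<and> Y \<omega> \<le> real (Suc k)}) \<in> events"
    by measurable
  ultimately have "emeasure M {\<omega>\<in>space M. 0 < Y \<omega>} = 0"
    using emeasure_mono by (metis (no_types, lifting) le_zero_eq)
  then show False using pos by (simp add: emeasure_eq_measure)
qed

text \<open>
  Let \<open>\<Phi> n v\<close> be the truncated exponential moment and \<open>\<psi> n v\<close> its derivative in \<open>v\<close>. Since \<open>X\<close> takes both
  signs, \<open>\<psi> n\<close> changes sign and has a root \<open>w\<close>, which minimises \<open>\<Phi> n\<close>, so that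
  \<open>\<Phi> n w \<le> \<Phi> n 0 \<le> 1\<close>. This bounds the roots uniformly in \<open>n\<close>. For a limit point \<open>u\<close> of
  the roots, monotonicity in \<open>n\<close> gives \<open>E exp (u * X) \<le> sup \<Phi> n w\<close>.
\<close>
lemma truncated_exponential_tilts:
  assumes X[measurable]: "X \<in> borel_measurable M"
    and pos: "0 < prob {\<omega>\<in>space M. 0 < X \<omega>}" and neg: "0 < prob {\<omega>\<in>space M. X \<omega> < 0}"
  obtains u c where "(\<integral>\<^sup>+\<omega>. ennreal (exp (u * X \<omega>)) \<partial>M) = ennreal c" "0 < c"
    "\<And>c'. c' < c \<Longrightarrow> \<exists>v n. expectation (\<lambda>\<omega>. X \<omega> * exp (v * X \<omega>) * indicator {\<omega>\<in>space M. \<bar>X \<omega>\<bar> \<le> real n} \<omega>) = 0 \<and>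
       c' < expectation (\<lambda>\<omega>. exp (v * X \<omega>) * indicator {\<omega>\<in>space M. \<bar>X \<omega>\<bar> \<le> real n} \<omega>)"
proof -
  define tr where "tr n = {\<omega>\<in>space M. \<bar>X \<omega>\<bar> \<le> real n}" for n
  define \<Phi> where "\<Phi> n v = expectation (\<lambda>\<omega>. exp (v * X \<omega>) * indicator (tr n) \<omega>)" for n v
  define \<psi> where "\<psi> n v = expectation (\<lambda>\<omega>. X \<omega> * exp (v * X \<omega>) * indicator (tr n) \<omega>)" for n v
  have [measurable]: "tr n \<in> events" for n unfolding tr_def by measurable
  have intX: "integrable M (\<lambda>\<omega>. exp (v * X \<omega>) * indicator (tr n) \<omega>)" for n v
    unfolding tr_def by (rule integrable_trunc_exp[OF X])
  have intXX: "integrable M (\<lambda>\<omega>. X \<omega> * exp (v * X \<omega>) * indicator (tr n) \<omega>)" for n v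
    unfolding tr_def by (rule integrable_trunc_id_exp[OF X])
  define X' where "X' \<omega> = - X \<omega>" for \<omega>
  have X'[measurable]: "X' \<in> borel_measurable M" unfolding X'_def by measurable
  have tr': "{\<omega>\<in>space M. \<bar>X' \<omega>\<bar> \<le> real n} = tr n" for n by (simp add: X'_def tr_def)

  obtain k1 where k1: "0 < prob {\<omega>\<in>space M. 1 / real (Suc k1) \<le> X \<omega> \<and> X \<omega> \<le> real (Suc k1)}"
    using positive_prob_away_from_0[OF X pos] .
  have "0 < prob {\<omega>\<in>space M. 0 < X' \<omega>}" using neg by (simp add: X'_def)
  then obtain k2 where k2: "0 < prob {\<omega>\<in>space M. 1 / real (Suc k2) \<le> X' \<omega> \<and> X' \<omega> \<le> real (Suc k2)}"
    using positive_prob_away_from_0[OF X'] by blast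
  define e where "e = min (1 / real (Suc k1)) (1 / real (Suc k2))"
  define N where "N = max (Suc k1) (Suc k2)"
  define p where "p = min (prob {\<omega>\<in>space M. e \<le> X \<omega> \<and> X \<omega> \<le> real N}) (prob {\<omega>\<in>space M. e \<le> X' \<omega> \<and> X' \<omega> \<le> real N})"
  have e: "0 < e" by (simp add: e_def)
  have p: "0 < p"
  proof -
    have eN: "e \<le> 1 / real (Suc k1)" "e \<le> 1 / real (Suc k2)" "real (Suc k1) \<le> real N" "real (Suc k2) \<le> real N"
      by (auto simp: e_def N_def)
    have "prob {\<omega>\<in>space M. 1 / real (Suc k1) \<le> X \<omega> \<and> X \<omega> \<le> real (Suc k1)}
        \<le> prob {\<omega>\<in>space M. e \<le> X \<omega> \<and> X \<omega> \<le> real N}"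
      by (rule finite_measure_mono) (use eN in \<open>auto simp del: of_nat_Suc\<close>)
    moreover have "prob {\<omega>\<in>space M. 1 / real (Suc k2) \<le> X' \<omega> \<and> X' \<omega> \<le> real (Suc k2)}
        \<le> prob {\<omega>\<in>space M. e \<le> X' \<omega> \<and> X' \<omega> \<le> real N}"
      by (rule finite_measure_mono) (use eN in \<open>auto simp del: of_nat_Suc\<close>)
    ultimately show ?thesis using k1 k2 by (simp add: p_def)
  qed

  have p_mult: "0 \<le> a \<Longrightarrow> p * a \<le> prob {\<omega>\<in>space M. e \<le> X \<omega> \<and> X \<omega> \<le> real N} * a"
      "0 \<le> a \<Longrightarrow> p * a \<le> prob {\<omega>\<in>space M. e \<le> X' \<omega> \<and> X' \<omega> \<le> real N} * a" for a
    unfolding p_def by (rule mult_right_mono; simp)+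

  have \<Phi>_pos: "p * exp (v * e) \<le> \<Phi> n v" and \<psi>_pos: "p * (e * exp (v * e)) - real n \<le> \<psi> n v"
    if "N \<le> n" "0 \<le> v" for n v
    using order_trans[OF p_mult(1) trunc_exp_lower(1)[OF X e that]]
      order_trans[OF diff_right_mono[OF p_mult(1)] trunc_exp_lower(2)[OF X e that]] e
    unfolding \<Phi>_def \<psi>_def tr_def[symmetric] by simp_all
  have \<Phi>_neg: "p * exp (- v * e) \<le> \<Phi> n v" and \<psi>_neg: "p * (e * exp (- v * e)) - real n \<le> - \<psi> n v"
    if "N \<le> n" "v \<le> 0" for n v
  proof -
    have "\<Phi> n v = expectation (\<lambda>\<omega>. exp (- v * X' \<omega>) * indicator (tr n) \<omega>)"
      by (simp add: \<Phi>_def X'_def)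
    moreover have "- \<psi> n v = expectation (\<lambda>\<omega>. X' \<omega> * exp (- v * X' \<omega>) * indicator (tr n) \<omega>)"
      by (simp add: \<psi>_def X'_def)
    moreover have "0 \<le> - v" using that by simp
    ultimately show "p * exp (- v * e) \<le> \<Phi> n v" "p * (e * exp (- v * e)) - real n \<le> - \<psi> n v"
      using order_trans[OF p_mult(2) trunc_exp_lower(1)[OF X' e that(1), of "- v"]]
        order_trans[OF diff_right_mono[OF p_mult(2)] trunc_exp_lower(2)[OF X' e that(1), of "- v"]] e
      unfolding tr' by simp_all
  qed

  have \<psi>_cont: "continuous_on UNIV (\<psi> n)" for n
  proof (rule continuous_on_sequentiallyI)
    fix w v assume "w \<longlonglongrightarrow> (v::real)"
    from trunc_exp_tendsto[OF X _ _ this, of "\<lambda>x. x" n "real n"]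
    show "(\<lambda>k. \<psi> n (w k)) \<longlonglongrightarrow> \<psi> n v" by (simp add: \<psi>_def tr_def)
  qed
  have \<Phi>_lim: "(\<lambda>k. \<Phi> n (w k)) \<longlonglongrightarrow> \<Phi> n v" if "w \<longlonglongrightarrow> v" for n w v
    using trunc_exp_tendsto[OF X _ _ that, of "\<lambda>_. 1" n 1] by (simp add: \<Phi>_def tr_def)

  have ex: "\<exists>v. \<psi> n v = 0" if n: "N \<le> n" for n
  proof -
    \<comment> \<open>Chosen such that \<open>p * e * (b * e) = n\<close>, which makes the lower bound for \<open>\<psi> n b\<close> nonnegative.\<close>
    define b where "b = real n / (p * (e * e))"
    have b: "0 \<le> b" using p e by (simp add: b_def)
    have "real n = p * (e * (b * e))" using p e by (simp add: b_def)
    also have "\<dots> \<le> p * (e * exp (b * e))"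
      using p e exp_ge_add_one_self[of "b * e"] by (intro mult_left_mono) linarith+
    finally have large: "real n \<le> p * (e * exp (b * e))" .
    have "\<psi> n (- b) \<le> 0" using \<psi>_neg[OF n, of "- b"] b large by simp
    moreover have "0 \<le> \<psi> n b" using \<psi>_pos[OF n b] large by linarith
    moreover have "- b \<le> b" using b by simp
    ultimately show ?thesis
      using IVT'[of "\<psi> n" "- b" 0 b] continuous_on_subset[OF \<psi>_cont] by blast
  qed
  define w where "w k = (SOME v. \<psi> (k + N) v = 0)" for k
  have \<psi>w: "\<psi> (k + N) (w k) = 0" for k
    unfolding w_def by (rule someI_ex) (rule ex, simp)
  have \<Phi>w: "\<Phi> (k + N) (w k) \<le> 1" for k
  proof -
    have "\<Phi> (k + N) (w k) = expectation (\<lambda>\<omega>. exp (w k * X \<omega>) * indicator (tr (k + N)) \<omega>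
        - w k * (X \<omega> * exp (w k * X \<omega>) * indicator (tr (k + N)) \<omega>))"
      using intX intXX \<psi>w[of k] by (simp add: \<Phi>_def \<psi>_def)
    also have "\<dots> \<le> 1"
    proof (rule integral_le_const)
      \<comment> \<open>The tangent of the convex function \<open>exp\<close> at \<open>y\<close>, evaluated at \<open>0\<close>, lies below \<open>exp 0 = 1\<close>.\<close>
      have "exp y - y * exp y \<le> 1" for y :: real
      proof -
        have "(1 - y) * exp y \<le> exp (- y) * exp y"
          using exp_ge_add_one_self[of "- y"] by (intro mult_right_mono) auto
        then show ?thesis by (simp add: algebra_simps flip: exp_add)
      qed
      from this[of "w k * X _"]
      show "AE \<omega> in M. exp (w k * X \<omega>) * indicator (tr (k + N)) \<omega>
        - w k * (X \<omega> * exp (w k * X \<omega>) * indicator (tr (k + N)) \<omega>) \<le> 1"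
        by (intro AE_I2) (auto simp: mult.assoc split: split_indicator)
    qed (use intX intXX in auto)
    finally show ?thesis .
  qed
  have w_bound: "\<bar>w k\<bar> \<le> 1 / (p * e)" for k
  proof -
    have "p * (\<bar>w k\<bar> * e) \<le> p * exp (\<bar>w k\<bar> * e)"
      using p exp_ge_add_one_self[of "\<bar>w k\<bar> * e"] by (intro mult_left_mono) linarith+
    also have "\<dots> \<le> \<Phi> (k + N) (w k)"
      using \<Phi>_pos[of "k + N" "w k"] \<Phi>_neg[of "k + N" "w k"] by (cases "0 \<le> w k") auto
    also have "\<dots> \<le> 1" by (rule \<Phi>w)
    finally show ?thesis using p e by (simp add: field_simps)
  qed
  then have "bounded (range w)" by (auto simp: bounded_iff)
  then obtain u r where r: "strict_mono r" "(w \<circ> r) \<longlonglongrightarrow> u"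
    using bounded_imp_convergent_subsequence by blast
  have bdd: "bdd_above (range (\<lambda>k. \<Phi> (k + N) (w k)))" using \<Phi>w by (auto simp: bdd_above_def)
  define d where "d = (SUP k. \<Phi> (k + N) (w k))"
  have \<Phi>u: "\<Phi> m u \<le> d" for m
  proof (rule LIMSEQ_le_const2[OF \<Phi>_lim[OF r(2)]], intro exI[of _ m] allI impI)
    fix j assume "m \<le> j"
    also have "j \<le> r j" by (rule seq_suble[OF r(1)])
    finally have "tr m \<subseteq> tr (r j + N)" by (auto simp: tr_def)
    then have "\<Phi> m (w (r j)) \<le> \<Phi> (r j + N) (w (r j))"
      unfolding \<Phi>_def by (intro integral_mono intX mult_left_mono) (auto split: split_indicator)
    also have "\<dots> \<le> d" unfolding d_def by (rule cSUP_upper[OF _ bdd]) simp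
    finally show "\<Phi> m ((w \<circ> r) j) \<le> d" by simp
  qed
  have "(\<integral>\<^sup>+\<omega>. ennreal (exp (u * X \<omega>)) \<partial>M) =
      (\<integral>\<^sup>+\<omega>. liminf (\<lambda>m. ennreal (exp (u * X \<omega>) * indicator (tr m) \<omega>)) \<partial>M)"
  proof (rule nn_integral_cong)
    fix \<omega> assume \<omega>: "\<omega> \<in> space M"
    have "\<forall>\<^sub>F m in sequentially. \<bar>X \<omega>\<bar> \<le> real m"
      using filterlim_real_sequentially unfolding filterlim_at_top by blast
    then have "(\<lambda>m. ennreal (exp (u * X \<omega>) * indicator (tr m) \<omega>)) \<longlonglongrightarrow> ennreal (exp (u * X \<omega>))"
      by (intro tendsto_eventually) (auto elim!: eventually_mono simp: tr_def \<omega>)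
    then show "ennreal (exp (u * X \<omega>)) = liminf (\<lambda>m. ennreal (exp (u * X \<omega>) * indicator (tr m) \<omega>))"
      by (intro lim_imp_Liminf[symmetric]) auto
  qed
  also have "\<dots> \<le> liminf (\<lambda>m. \<integral>\<^sup>+\<omega>. ennreal (exp (u * X \<omega>) * indicator (tr m) \<omega>) \<partial>M)"
    by (rule nn_integral_liminf) measurable
  also have "\<dots> = liminf (\<lambda>m. ennreal (\<Phi> m u))"
    unfolding \<Phi>_def using intX by (subst nn_integral_eq_integral) auto
  also have "\<dots> \<le> ennreal d"
    by (rule order_trans[OF Liminf_le_Limsup Limsup_bounded]) (auto intro!: always_eventually ennreal_leI \<Phi>u)
  finally have le: "(\<integral>\<^sup>+\<omega>. ennreal (exp (u * X \<omega>)) \<partial>M) \<le> ennreal d" .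
  then have "(\<integral>\<^sup>+\<omega>. ennreal (exp (u * X \<omega>)) \<partial>M) < \<top>" by (rule le_less_trans) simp
  then obtain c where c: "(\<integral>\<^sup>+\<omega>. ennreal (exp (u * X \<omega>)) \<partial>M) = ennreal c" "0 \<le> c"
    by (cases "\<integral>\<^sup>+\<omega>. ennreal (exp (u * X \<omega>)) \<partial>M") auto
  have "0 \<le> d"
    unfolding d_def by (rule cSUP_upper2[OF bdd, of 0]) (auto simp: \<Phi>_def)
  with le c have cd: "c \<le> d" by (simp add: ennreal_le_iff)
  have "c \<noteq> 0"
  proof
    assume "c = 0"
    with c(1) have "AE \<omega> in M. ennreal (exp (u * X \<omega>)) = 0"
      using nn_integral_0_iff_AE[of "\<lambda>\<omega>. ennreal (exp (u * X \<omega>))" M] by simp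
    then have "AE \<omega> in M. False" by eventually_elim simp
    then show False by simp
  qed
  with c have c0: "0 < c" by simp
  show thesis
  proof (rule that[OF c(1) c0])
    fix c' assume "c' < c"
    then have "c' < (SUP k. \<Phi> (k + N) (w k))" using cd by (simp add: d_def)
    then obtain k where "c' < \<Phi> (k + N) (w k)"
      using less_cSUP_iff[OF _ bdd] by auto
    with \<psi>w[of k] show "\<exists>v n. expectation (\<lambda>\<omega>. X \<omega> * exp (v * X \<omega>) * indicator {\<omega>\<in>space M. \<bar>X \<omega>\<bar> \<le> real n} \<omega>) = 0 \<and>
       c' < expectation (\<lambda>\<omega>. exp (v * X \<omega>) * indicator {\<omega>\<in>space M. \<bar>X \<omega>\<bar> \<le> real n} \<omega>)"
      unfolding \<psi>_def \<Phi>_def tr_def by blast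
  qed
qed

end

text \<open>
  Integrability of \<open>f ln f\<close> makes both extended integrals in the definition finite.
\<close>
lemma relative_entropy_density:
  assumes N: "sigma_finite_measure N" and f[measurable]: "f \<in> borel_measurable N" and f0: "\<And>x. 0 \<le> f x"
    and int: "integrable N (\<lambda>x. f x * ln (f x))"
  shows "relative_entropy (density N (\<lambda>x. ennreal (f x))) N = ereal (\<integral>x. f x * ln (f x) \<partial>N)"
proof -
  interpret sigma_finite_measure N by fact
  let ?Q = "density N (\<lambda>x. ennreal (f x))"
  define Z where "Z x = enn2real (RN_deriv N ?Q x)" for x
  have "AE x in N. ennreal (f x) = RN_deriv N ?Q x" by (rule RN_deriv_unique) auto
  then have AE: "AE x in N. Z x = f x" by eventually_elim (auto simp: Z_def f0 dest: sym)
  have ac: "absolutely_continuous N ?Q" by (rule absolutely_continuousI_density) simp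
  have 1: "(\<integral>\<^sup>+x. ennreal (Z x * ln (Z x)) \<partial>N) = (\<integral>\<^sup>+x. ennreal (f x * ln (f x)) \<partial>N)"
    by (rule nn_integral_cong_AE) (use AE in eventually_elim, simp)
  have 2: "(\<integral>\<^sup>+x. ennreal (- (Z x * ln (Z x))) \<partial>N) = (\<integral>\<^sup>+x. ennreal (- (f x * ln (f x))) \<partial>N)"
    by (rule nn_integral_cong_AE) (use AE in eventually_elim, simp)
  obtain a where a: "(\<integral>\<^sup>+x. ennreal (f x * ln (f x)) \<partial>N) = ennreal a" "0 \<le> a"
    using int by (cases "\<integral>\<^sup>+x. ennreal (f x * ln (f x)) \<partial>N") (auto simp: real_integrable_def)
  obtain b where b: "(\<integral>\<^sup>+x. ennreal (- (f x * ln (f x))) \<partial>N) = ennreal b" "0 \<le> b"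
    using int by (cases "\<integral>\<^sup>+x. ennreal (- (f x * ln (f x))) \<partial>N") (auto simp: real_integrable_def)
  have "(\<integral>x. f x * ln (f x) \<partial>N) = a - b"
    using int a b by (simp add: real_lebesgue_integral_def)
  moreover have "relative_entropy ?Q N = enn2ereal (ennreal a) - enn2ereal (ennreal b)"
    unfolding relative_entropy_def Let_def using ac 1 2 a b by (simp add: Z_def)
  ultimately show ?thesis using a b by (simp add: enn2ereal_ennreal)
qed

text \<open>
  Because \<open>z ln z \<ge> z - 1 \<ge> - 1\<close>, the subtracted term is at most \<open>1\<close>, so a real upper bound for the
  entropy forces the positive part to be finite.
\<close>
lemma finite_relative_entropyE:
  assumes N: "prob_space N" and Q: "prob_space Q" "sets Q = sets N" "absolutely_continuous N Q"
    and le: "relative_entropy Q N \<le> ereal b"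
  obtains Z where "Z \<in> borel_measurable N" "\<And>x. 0 \<le> Z x" "Q = density N (\<lambda>x. ennreal (Z x))"
    "integrable N (\<lambda>x. Z x * ln (Z x))" "(\<integral>x. Z x * ln (Z x) \<partial>N) \<le> b"
proof -
  interpret N: prob_space N by fact
  interpret Q: prob_space Q by fact
  define Z where "Z x = enn2real (RN_deriv N Q x)" for x
  have Zm[measurable]: "Z \<in> borel_measurable N" unfolding Z_def by measurable
  have Z0: "0 \<le> Z x" for x by (simp add: Z_def)
  have "AE x in N. RN_deriv N Q x \<noteq> \<infinity>"
    by (rule N.RN_deriv_finite[OF _ Q(3,2)]) unfold_locales
  then have "AE x in N. RN_deriv N Q x = ennreal (Z x)"
    by eventually_elim (auto simp: Z_def less_top)
  then have "density N (RN_deriv N Q) = density N (\<lambda>x. ennreal (Z x))"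
    by (intro density_cong) auto
  then have dens: "Q = density N (\<lambda>x. ennreal (Z x))"
    using N.density_RN_deriv[OF Q(3,2)] by simp
  have lower: "- 1 \<le> Z x * ln (Z x)" for x
  proof (cases "Z x = 0")
    case False
    with Z0[of x] have pos: "0 < Z x" by simp
    then have "1 - inverse (Z x) \<le> ln (Z x)"
      using ln_le_minus_one[of "inverse (Z x)"] by (simp add: ln_inverse)
    then have "Z x * (1 - inverse (Z x)) \<le> Z x * ln (Z x)" using pos by (intro mult_left_mono) auto
    then show ?thesis using pos by (simp add: right_diff_distrib)
  qed simp
  have "(\<integral>\<^sup>+x. ennreal (- (Z x * ln (Z x))) \<partial>N) \<le> (\<integral>\<^sup>+x. 1 \<partial>N)"
    using lower by (intro nn_integral_mono) (simp add: minus_le_iff)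
  then have neg: "(\<integral>\<^sup>+x. ennreal (- (Z x * ln (Z x))) \<partial>N) \<le> 1" by (simp add: N.emeasure_space_1)
  then have neg': "(\<integral>\<^sup>+x. ennreal (- (Z x * ln (Z x))) \<partial>N) \<noteq> \<top>" by (auto simp: top_unique)
  then obtain n where n: "(\<integral>\<^sup>+x. ennreal (- (Z x * ln (Z x))) \<partial>N) = ennreal n" "0 \<le> n"
    by (cases "\<integral>\<^sup>+x. ennreal (- (Z x * ln (Z x))) \<partial>N") auto
  have "enn2ereal (\<integral>\<^sup>+x. ennreal (Z x * ln (Z x)) \<partial>N) - enn2ereal (ennreal n) \<le> ereal b"
    using le Q(3) unfolding relative_entropy_def Let_def Z_def[symmetric] n(1) by simp
  then have "(\<integral>\<^sup>+x. ennreal (Z x * ln (Z x)) \<partial>N) \<noteq> \<top>"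
    using n by (auto simp: enn2ereal_ennreal top_ennreal.rep_eq)
  then have int: "integrable N (\<lambda>x. Z x * ln (Z x))"
    using neg' by (simp add: real_integrable_def)
  have "ereal (\<integral>x. Z x * ln (Z x) \<partial>N) = relative_entropy Q N"
    unfolding dens using relative_entropy_density[OF _ Zm Z0 int] by (simp add: N.sigma_finite_measure_axioms)
  with le have "(\<integral>x. Z x * ln (Z x) \<partial>N) \<le> b" by (metis ereal_less_eq(3))
  then show thesis using that[OF Zm Z0 dens int] by blast
qed

section \<open>The entropy minimiser is the Esscher measure\<close>

text \<open>
  What the two parts of the largest class have in common, and all that the rigidity argument uses of
  membership in it.
\<close>
definition centred_localizing_sequence ::
  "'a measure \<Rightarrow> real \<Rightarrow> (real \<Rightarrow> 'a measure) \<Rightarrow> (real \<Rightarrow> 'a \<Rightarrow> real) \<Rightarrow> (nat \<Rightarrow> 'a \<Rightarrow> real) \<Rightarrow> bool" where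
  "centred_localizing_sequence Q T F L \<tau> \<longleftrightarrow>
    (\<forall>k. stopping_time_upto T F (\<tau> k)) \<and>
    (AE \<omega> in Q. \<forall>\<^sub>F k in sequentially. \<tau> k \<omega> = T) \<and>
    (\<forall>k. integrable Q (\<lambda>\<omega>. L (\<tau> k \<omega>) \<omega>) \<and> (\<integral>\<omega>. L (\<tau> k \<omega>) \<omega> \<partial>Q) = 0)"

text \<open>
  The function is the excess of \<open>exp\<close> at \<open>f\<close> over its tangent at \<open>ln x\<close>. By strict
  convexity it vanishes only if \<open>x = exp f\<close>, which is the next lemma.
\<close>
lemma entropy_integrand_nonneg:
  fixes x f :: real assumes "0 \<le> x" shows "0 \<le> x * ln x - x * f - x + exp f"
proof (cases "x = 0")
  case False
  with assms have x: "0 < x" by simp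
  have "ln (exp f / x) \<le> exp f / x - 1" using x by (intro ln_le_minus_one) simp
  then have "x * (f - ln x) \<le> x * (exp f / x - 1)"
    using x by (intro mult_left_mono) (simp_all add: ln_div)
  then show ?thesis using x by (simp add: algebra_simps)
qed simp

lemma entropy_integrand_eq_0D:
  fixes x f :: real assumes x: "0 < x" and eq: "x * ln x - x * f - x + exp f = 0" shows "x = exp f"
proof -
  have "ln (exp f / x) = exp f / x - 1"
  proof -
    have "f - ln x = exp f / x - 1" using x eq by (simp add: field_simps)
    then show ?thesis using x by (simp add: ln_div)
  qed
  then have "exp f / x = 1" using x by (intro ln_eq_minus_one) auto
  then show ?thesis using x by simp
qed

context levy_setting
begin

text \<open>
  Applies Fatou's lemma to \<open>h k = Z ln Z - Z f\<^sub>k - Z + exp f\<^sub>k\<close>, the integrand of the relative entropy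
  of \<open>Q\<close> with respect to the sub-probability density \<open>exp f\<^sub>k\<close>. The entropy bound makes the integrals of
  \<open>h k\<close> tend to zero, while pointwise on \<open>Z > 0\<close> it is eventually the same expression at the
  terminal time.
\<close>
lemma esscher_of_relative_entropy_le:
  assumes c: "(\<integral>\<^sup>+\<omega>. ennreal (exp (u * L T \<omega>)) \<partial>M) = ennreal c" "0 < c"
    and Q: "Q \<in> ac_measures M T F"
    and le: "relative_entropy Q (restr_to_subalg M (F T)) \<le> ereal (- ln c)"
    and loc: "centred_localizing_sequence Q T F L \<tau>"
  shows "Q = esscher u c"
proof -
  define N where "N = restr_to_subalg M (F T)"
  define \<kappa> where "\<kappa> = ln c / T"
  have \<kappa>T: "\<kappa> * T = ln c" using horizon_pos by (simp add: \<kappa>_def)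
  have setsN[measurable_cong]: "sets N = sets (F T)" by (simp add: N_def sets_restr_to_subalg[OF subalgebra_F])
  have spaceN: "space N = space M" by (simp add: N_def space_restr_to_subalg)
  interpret N: prob_space N
    unfolding N_def by (rule prob_space_restr_to_subalg[OF subalgebra_F prob_space_axioms])
  have Q': "prob_space Q" "sets Q = sets N" "absolutely_continuous N Q"
    using Q by (auto simp: ac_measures_def setsN N_def[symmetric])
  interpret Q: prob_space Q by (rule Q'(1))
  have spaceQ: "space Q = space M" using sets_eq_imp_space_eq[OF Q'(2)] spaceN by simp
  have \<tau>: "stopping_time_upto T F (\<tau> k)" for k using loc by (simp add: centred_localizing_sequence_def)
  have ev: "AE \<omega> in Q. \<forall>\<^sub>F k in sequentially. \<tau> k \<omega> = T"
    using loc by (simp add: centred_localizing_sequence_def)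
  have LQ: "integrable Q (\<lambda>\<omega>. L (\<tau> k \<omega>) \<omega>)" "(\<integral>\<omega>. L (\<tau> k \<omega>) \<omega> \<partial>Q) = 0" for k
    using loc by (simp_all add: centred_localizing_sequence_def)
  have toN: "f \<in> borel_measurable (F T) \<Longrightarrow> f \<in> borel_measurable N" for f :: "'a \<Rightarrow> real"
    by (simp add: measurable_cong_sets[OF setsN refl])
  have toQ: "f \<in> borel_measurable (F T) \<Longrightarrow> f \<in> borel_measurable Q" for f :: "'a \<Rightarrow> real"
    by (simp add: measurable_cong_sets[OF Q'(2) refl] toN)

  obtain Z where Zm[measurable]: "Z \<in> borel_measurable N" and Z0: "\<And>x. 0 \<le> Z x"
    and QZ: "Q = density N (\<lambda>x. ennreal (Z x))"
    and Zint: "integrable N (\<lambda>x. Z x * ln (Z x))" and Zle: "(\<integral>x. Z x * ln (Z x) \<partial>N) \<le> - ln c"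
    using finite_relative_entropyE[OF N.prob_space_axioms Q'] le unfolding N_def[symmetric] by blast
  have Z1: "integrable N Z" "(\<integral>x. Z x \<partial>N) = 1"
  proof -
    have "(\<integral>x. 1 \<partial>Q) = (1::real)" "integrable Q (\<lambda>_. 1::real)" by (simp_all add: Q.prob_space)
    moreover have "(\<integral>x. 1 \<partial>Q) = (\<integral>x. Z x * 1 \<partial>N)"
      unfolding QZ by (rule integral_real_density) (use Z0 in auto)
    moreover have "integrable Q (\<lambda>_. 1::real) \<longleftrightarrow> integrable N (\<lambda>x. Z x * 1)"
      unfolding QZ by (rule integrable_real_density) (use Z0 in auto)
    ultimately show "integrable N Z" "(\<integral>x. Z x \<partial>N) = 1" by simp_all
  qed

  define f where "f k \<omega> = u * L (\<tau> k \<omega>) \<omega> - \<kappa> * \<tau> k \<omega>" for k \<omega>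
  define g where "g \<omega> = u * L T \<omega> - \<kappa> * T" for \<omega>
  have fF: "f k \<in> borel_measurable (F T)" for k
    unfolding f_def using L_stopping_measurable[OF \<tau>] stopping_measurable[OF \<tau>] by measurable
  have fN[measurable]: "f k \<in> borel_measurable N" for k by (rule toN[OF fF])
  have gF: "g \<in> borel_measurable (F T)"
    unfolding g_def using L_measurable_F[of T T] horizon_pos by simp
  have gN[measurable]: "g \<in> borel_measurable N" by (rule toN[OF gF])
  have \<tau>Q: "\<tau> k \<in> borel_measurable Q" for k by (rule toQ[OF stopping_measurable[OF \<tau>]])
  have \<tau>int: "integrable Q (\<tau> k)" for k
    using stopping_bounds[OF \<tau>] \<tau>Q horizon_pos
    by (intro Q.integrable_const_bound[where B=T]) (auto simp: spaceQ)
  have fQ: "integrable Q (f k)" "(\<integral>\<omega>. f k \<omega> \<partial>Q) = - \<kappa> * (\<integral>\<omega>. \<tau> k \<omega> \<partial>Q)" for k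
    unfolding f_def using LQ[of k] \<tau>int[of k] by simp_all
  have Zf: "integrable N (\<lambda>x. Z x * f k x)" "(\<integral>x. Z x * f k x \<partial>N) = - \<kappa> * (\<integral>\<omega>. \<tau> k \<omega> \<partial>Q)" for k
  proof -
    show "integrable N (\<lambda>x. Z x * f k x)"
      using fQ(1)[of k] unfolding QZ by (subst (asm) integrable_real_density) (use Z0 in auto)
    have "(\<integral>\<omega>. f k \<omega> \<partial>Q) = (\<integral>x. Z x * f k x \<partial>N)"
      unfolding QZ by (rule integral_real_density) (use Z0 in auto)
    then show "(\<integral>x. Z x * f k x \<partial>N) = - \<kappa> * (\<integral>\<omega>. \<tau> k \<omega> \<partial>Q)" using fQ(2)[of k] by simp
  qed
  have exp_le: "(\<integral>\<^sup>+x. ennreal (exp (f k x)) \<partial>N) \<le> 1" for k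
  proof -
    have "(\<integral>\<^sup>+x. ennreal (exp (f k x)) \<partial>N) = (\<integral>\<^sup>+x. ennreal (exp (f k x)) \<partial>M)"
      unfolding N_def by (rule nn_integral_subalgebra2[OF subalgebra_F]) (use fF[of k] in measurable)
    also have "\<dots> \<le> 1"
      unfolding f_def \<kappa>_def by (rule exp_optional_stopping_le[OF c \<tau>])
    finally show ?thesis .
  qed
  have expf: "integrable N (\<lambda>x. exp (f k x))" "(\<integral>x. exp (f k x) \<partial>N) \<le> 1" for k
  proof -
    have "(\<integral>\<^sup>+x. ennreal (exp (f k x)) \<partial>N) < \<top>" using exp_le[of k] by (rule le_less_trans) simp
    then show int: "integrable N (\<lambda>x. exp (f k x))" by (intro integrableI_nonneg) auto
    show "(\<integral>x. exp (f k x) \<partial>N) \<le> 1"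
      using exp_le[of k] nn_integral_eq_integral[OF int] by simp
  qed

  define h where "h k x = Z x * ln (Z x) - Z x * f k x - Z x + exp (f k x)" for k x
  have h0: "0 \<le> h k x" for k x unfolding h_def by (rule entropy_integrand_nonneg[OF Z0])
  have hm[measurable]: "h k \<in> borel_measurable N" for k unfolding h_def by measurable
  have h_int: "integrable N (h k)" for k
    unfolding h_def using Zint Zf(1)[of k] Z1(1) expf(1)[of k] by simp
  have h_le: "(\<integral>x. h k x \<partial>N) \<le> \<kappa> * ((\<integral>\<omega>. \<tau> k \<omega> \<partial>Q) - T)" for k
  proof -
    have "(\<integral>x. h k x \<partial>N) = (\<integral>x. Z x * ln (Z x) \<partial>N) - (\<integral>x. Z x * f k x \<partial>N) - (\<integral>x. Z x \<partial>N) + (\<integral>x. exp (f k x) \<partial>N)"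
      unfolding h_def using Zint Zf(1)[of k] Z1(1) expf(1)[of k] by simp
    also have "\<dots> \<le> - ln c + \<kappa> * (\<integral>\<omega>. \<tau> k \<omega> \<partial>Q)"
      using Zle Zf(2)[of k] Z1(2) expf(2)[of k] by linarith
    also have "\<dots> = \<kappa> * ((\<integral>\<omega>. \<tau> k \<omega> \<partial>Q) - T)" by (simp add: right_diff_distrib \<kappa>T)
    finally show ?thesis .
  qed
  have "(\<lambda>k. \<integral>\<omega>. \<tau> k \<omega> \<partial>Q) \<longlonglongrightarrow> (\<integral>\<omega>. T \<partial>Q)"
  proof (rule integral_dominated_convergence[where w="\<lambda>_. T"])
    show "AE \<omega> in Q. (\<lambda>k. \<tau> k \<omega>) \<longlonglongrightarrow> T"
      using ev by eventually_elim (rule tendsto_eventually)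
    show "AE \<omega> in Q. norm (\<tau> k \<omega>) \<le> T" for k
      using stopping_bounds[OF \<tau>] by (intro AE_I2) (auto simp: spaceQ)
  qed (use \<tau>Q in auto)
  then have "(\<lambda>k. ennreal (\<kappa> * ((\<integral>\<omega>. \<tau> k \<omega> \<partial>Q) - T))) \<longlonglongrightarrow> ennreal (\<kappa> * (T - T))"
    by (intro tendsto_intros) (simp add: Q.prob_space)
  then have lim0: "liminf (\<lambda>k. ennreal (\<kappa> * ((\<integral>\<omega>. \<tau> k \<omega> \<partial>Q) - T))) = 0"
    by (intro lim_imp_Liminf) auto
  have "(\<integral>\<^sup>+x. liminf (\<lambda>k. ennreal (h k x)) \<partial>N) \<le> liminf (\<lambda>k. \<integral>\<^sup>+x. ennreal (h k x) \<partial>N)"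
    by (rule nn_integral_liminf) measurable
  also have "\<dots> \<le> liminf (\<lambda>k. ennreal (\<kappa> * ((\<integral>\<omega>. \<tau> k \<omega> \<partial>Q) - T)))"
    by (intro Liminf_mono always_eventually allI)
      (use h_le h0 h_int in \<open>auto simp: nn_integral_eq_integral intro!: ennreal_leI\<close>)
  finally have "(\<integral>\<^sup>+x. liminf (\<lambda>k. ennreal (h k x)) \<partial>N) = 0" unfolding lim0 by simp
  then have "AE x in N. liminf (\<lambda>k. ennreal (h k x)) = 0"
    by (subst (asm) nn_integral_0_iff_AE) auto
  moreover have "AE x in N. 0 < ennreal (Z x) \<longrightarrow> (\<forall>\<^sub>F k in sequentially. \<tau> k x = T)"
    using ev unfolding QZ by (subst (asm) AE_density) auto
  ultimately have ZleG: "AE x in N. Z x \<le> exp (g x)"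
  proof eventually_elim
    case (elim x)
    show ?case
    proof (cases "Z x = 0")
      case False
      with Z0[of x] have pos: "0 < Z x" by simp
      define H where "H = Z x * ln (Z x) - Z x * g x - Z x + exp (g x)"
      have "\<forall>\<^sub>F k in sequentially. \<tau> k x = T" using elim pos by simp
      then have "\<forall>\<^sub>F k in sequentially. ennreal (h k x) = ennreal H"
        by (rule eventually_mono) (simp add: h_def f_def g_def H_def)
      then have "(\<lambda>k. ennreal (h k x)) \<longlonglongrightarrow> ennreal H" by (rule tendsto_eventually)
      then have "ennreal H = 0" using elim(1) by (metis lim_imp_Liminf sequentially_bot)
      moreover have "0 \<le> H" unfolding H_def by (rule entropy_integrand_nonneg[OF Z0])
      ultimately have "H = 0" by simp
      then show ?thesis using entropy_integrand_eq_0D[OF pos, of "g x"] by (simp add: H_def)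
    qed simp
  qed
  have expg: "exp (g \<omega>) = exp (u * L T \<omega>) / c" for \<omega>
    using c(2) by (simp add: g_def \<kappa>T exp_diff)
  have "(\<integral>\<^sup>+x. ennreal (exp (g x)) \<partial>N) = (\<integral>\<^sup>+x. ennreal (exp (g x)) \<partial>M)"
    unfolding N_def by (rule nn_integral_subalgebra2[OF subalgebra_F]) (use gF in measurable)
  also have "\<dots> = (\<integral>\<^sup>+x. ennreal (exp (u * L T x)) / ennreal c \<partial>M)"
    using c(2) by (simp add: expg divide_ennreal)
  also have "\<dots> = ennreal c / ennreal c"
    using L_measurable[of T] horizon_pos by (simp add: nn_integral_divide c(1))
  also have "\<dots> = 1" using c(2) by (simp add: divide_ennreal)
  finally have g1: "(\<integral>\<^sup>+x. ennreal (exp (g x)) \<partial>N) = 1" .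
  then have g_int: "integrable N (\<lambda>x. exp (g x))" by (intro integrableI_nonneg) auto
  have g_integral: "(\<integral>x. exp (g x) \<partial>N) = 1"
    using g1 nn_integral_eq_integral[OF g_int] by simp
  \<comment> \<open>The set \<open>Z = 0\<close> is null, because \<open>Z \<le> exp g\<close> and both densities have mass \<open>1\<close>.\<close>
  have "(\<integral>x. exp (g x) - Z x \<partial>N) = 0" using g_int Z1 g_integral by simp
  then have "AE x in N. exp (g x) - Z x = 0"
    using ZleG g_int Z1(1) by (subst (asm) integral_nonneg_eq_0_iff_AE) auto
  then have "AE x in N. ennreal (Z x) = ennreal (exp (u * L T x) / c)"
    by eventually_elim (simp add: expg)
  then show ?thesis
    unfolding QZ esscher_def N_def[symmetric]
    by (rule density_cong[rotated 2]) (use gN in \<open>simp_all add: expg[symmetric]\<close>)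
qed

text \<open>
  A local martingale has \<open>E L\<^sub>\<tau> = 0\<close> along its localizing sequence because it starts at \<open>0\<close>; the other
  part of the class demands this directly. The last conclusion records, for each part, the source of
  integrability of \<open>L\<^sub>T\<close> when \<open>L\<close> is a Levy process under \<open>Q\<close>.
\<close>
lemma M_hat_loc_a_localizing:
  assumes "Q \<in> M_hat_loc_a M T F L"
  obtains \<tau> where "Q \<in> ac_measures M T F" "centred_localizing_sequence Q T F L \<tau>"
    "integrable Q (L T) \<or> (\<forall>k. martingale_upto Q T F (\<lambda>t \<omega>. L (min t (\<tau> k \<omega>)) \<omega>))"
proof -
  have Q: "Q \<in> ac_measures M T F"
    using assms by (auto simp: M_hat_loc_a_def M_loc_a_def M_tilde_loc0_a_def)
  then have "prob_space Q" and sets: "sets Q = sets (F T)" by (auto simp: ac_measures_def)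
  interpret Q: prob_space Q by fact
  have spaceQ: "space Q = space M" using sets_eq_imp_space_eq[OF sets] by (simp add: space_F)
  from assms consider "local_martingale_upto Q T F L" | "Q \<in> M_tilde_loc0_a M T F L"
    by (auto simp: M_hat_loc_a_def M_loc_a_def)
  then show thesis
  proof cases
    case 1
    then obtain \<tau> where \<tau>: "\<And>k. stopping_time_upto T F (\<tau> k)"
      and inc: "AE \<omega> in Q. incseq (\<lambda>k. \<tau> k \<omega>)" and ex: "AE \<omega> in Q. \<exists>k. \<tau> k \<omega> = T"
      and mart: "\<And>k. martingale_upto Q T F (\<lambda>t \<omega>. L (min t (\<tau> k \<omega>)) \<omega>)"
      by (auto simp: local_martingale_upto_def)
    have "AE \<omega> in Q. \<forall>\<^sub>F k in sequentially. \<tau> k \<omega> = T"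
      using inc ex AE_space
    proof eventually_elim
      case (elim \<omega>)
      then obtain k where "\<tau> k \<omega> = T" by blast
      then have "\<tau> j \<omega> = T" if "k \<le> j" for j
        using incseqD[OF elim(1) that] stopping_bounds[OF \<tau>, of \<omega> j] elim(3) by (simp add: spaceQ)
      then show ?case by (auto simp: eventually_sequentially)
    qed
    moreover have "integrable Q (\<lambda>\<omega>. L (\<tau> k \<omega>) \<omega>) \<and> (\<integral>\<omega>. L (\<tau> k \<omega>) \<omega> \<partial>Q) = 0" for k
    proof -
      have sub: "subalgebra Q (F 0)"
        using horizon_pos sets_F_mono[of 0 T] by (auto simp: subalgebra_def sets spaceQ space_F)
      interpret f0: finite_measure_subalgebra Q "F 0" by unfold_locales (rule sub)
      have eqT: "L (min T (\<tau> k \<omega>)) \<omega> = L (\<tau> k \<omega>) \<omega>" if "\<omega> \<in> space Q" for \<omega>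
        using stopping_bounds[OF \<tau>, of \<omega> k] that by (simp add: spaceQ min_absorb2)
      have eq0: "L (min 0 (\<tau> k \<omega>)) \<omega> = 0" if "\<omega> \<in> space Q" for \<omega>
        using stopping_bounds[OF \<tau>, of \<omega> k] that L_0 by (simp add: spaceQ min_def)
      have "integrable Q (\<lambda>\<omega>. L (min T (\<tau> k \<omega>)) \<omega>)"
        using mart[of k] horizon_pos by (simp add: martingale_upto_def)
      moreover from this have "(\<integral>\<omega>. L (min T (\<tau> k \<omega>)) \<omega> \<partial>Q) = 0"
      proof -
        assume int: "integrable Q (\<lambda>\<omega>. L (min T (\<tau> k \<omega>)) \<omega>)"
        have "AE \<omega> in Q. real_cond_exp Q (F 0) (\<lambda>\<omega>. L (min T (\<tau> k \<omega>)) \<omega>) \<omega> = L (min 0 (\<tau> k \<omega>)) \<omega>"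
          using mart[of k] horizon_pos unfolding martingale_upto_def by (meson less_imp_le order_refl)
        then have "AE \<omega> in Q. real_cond_exp Q (F 0) (\<lambda>\<omega>. L (min T (\<tau> k \<omega>)) \<omega>) \<omega> = 0"
          using AE_space by eventually_elim (simp add: eq0)
        then have "(\<integral>\<omega>. real_cond_exp Q (F 0) (\<lambda>\<omega>. L (min T (\<tau> k \<omega>)) \<omega>) \<omega> \<partial>Q) = 0"
          by (rule integral_eq_zero_AE)
        then show ?thesis using f0.real_cond_exp_int(2)[OF int] by simp
      qed
      ultimately show ?thesis
        using eqT by (simp cong: Bochner_Integration.integrable_cong Bochner_Integration.integral_cong)
    qed
    ultimately show thesis
      using that[OF Q] \<tau> mart by (auto simp: centred_localizing_sequence_def)
  next
    case 2
    then obtain \<tau> where int: "integrable Q (L T)" and \<tau>: "\<And>k. stopping_time_upto T F (\<tau> k)"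
      and inc: "incseq (\<lambda>k. {\<omega>\<in>space Q. \<tau> k \<omega> = T})" and un: "(\<Union>k. {\<omega>\<in>space Q. \<tau> k \<omega> = T}) = space Q"
      and mean: "\<And>k. integrable Q (\<lambda>\<omega>. L (min (\<tau> k \<omega>) T) \<omega>) \<and> (\<integral>\<omega>. L (min (\<tau> k \<omega>) T) \<omega> \<partial>Q) = 0"
      by (auto simp: M_tilde_loc0_a_def)
    have "AE \<omega> in Q. \<forall>\<^sub>F k in sequentially. \<tau> k \<omega> = T"
    proof (rule AE_I2)
      fix \<omega> assume \<omega>: "\<omega> \<in> space Q"
      then obtain k where "\<omega> \<in> {\<omega>\<in>space Q. \<tau> k \<omega> = T}" using un by blast
      then have "\<tau> j \<omega> = T" if "k \<le> j" for j using incseqD[OF inc that] by blast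
      then show "\<forall>\<^sub>F k in sequentially. \<tau> k \<omega> = T" by (auto simp: eventually_sequentially)
    qed
    moreover have "integrable Q (\<lambda>\<omega>. L (\<tau> k \<omega>) \<omega>) \<and> (\<integral>\<omega>. L (\<tau> k \<omega>) \<omega> \<partial>Q) = 0" for k
    proof -
      have "L (min (\<tau> k \<omega>) T) \<omega> = L (\<tau> k \<omega>) \<omega>" if "\<omega> \<in> space Q" for \<omega>
        using stopping_bounds[OF \<tau>, of \<omega> k] that by (simp add: spaceQ min_def)
      then show ?thesis
        using mean[of k] by (simp cong: Bochner_Integration.integrable_cong Bochner_Integration.integral_cong)
    qed
    ultimately show thesis
      using that[OF Q] \<tau> int by (auto simp: centred_localizing_sequence_def)
  qed
qed

text \<open>
  Some \<open>\<tau>\<^sub>k\<close> equals \<open>T\<close> with positive probability. This gives integrability in the martingale case, and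
  \<open>E \<tau>\<^sub>k > 0\<close> in Wald's identity \<open>0 = E L\<^sub>T / T * E \<tau>\<^sub>k\<close>.
\<close>
lemma centred_of_localizing:
  assumes loc: "centred_localizing_sequence M T F L \<tau>"
    and int: "integrable M (L T) \<or> (\<forall>k. martingale_upto M T F (\<lambda>t \<omega>. L (min t (\<tau> k \<omega>)) \<omega>))"
  shows "integrable M (L T)" "expectation (L T) = 0"
proof -
  have \<tau>: "stopping_time_upto T F (\<tau> k)" for k using loc by (simp add: centred_localizing_sequence_def)
  have [measurable]: "\<tau> k \<in> borel_measurable M" for k
    using measurable_from_F[OF stopping_measurable[OF \<tau>]] by simp
  obtain k where k: "0 < emeasure M {\<omega>\<in>space M. \<tau> k \<omega> = T}"
  proof (rule ccontr)
    assume "\<not> thesis"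
    then have "emeasure M {\<omega>\<in>space M. \<tau> k \<omega> = T} = 0" for k using that by (metis not_gr_zero)
    then have "AE \<omega> in M. \<tau> k \<omega> \<noteq> T" for k by (intro AE_I[of _ _ "{\<omega>\<in>space M. \<tau> k \<omega> = T}"]) auto
    then have "AE \<omega> in M. \<forall>k. \<tau> k \<omega> \<noteq> T" by (simp add: AE_all_countable)
    moreover have "AE \<omega> in M. \<forall>\<^sub>F k in sequentially. \<tau> k \<omega> = T"
      using loc by (simp add: centred_localizing_sequence_def)
    ultimately have "AE \<omega> in M. False"
      by eventually_elim (auto simp: eventually_sequentially)
    then show False by simp
  qed
  show LT: "integrable M (L T)"
    using int integrable_of_stopped_martingale[OF \<tau> k] by blast
  have L\<tau>: "integrable M (\<lambda>\<omega>. L (\<tau> k \<omega>) \<omega>)" "expectation (\<lambda>\<omega>. L (\<tau> k \<omega>) \<omega>) = 0"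
    using loc by (simp_all add: centred_localizing_sequence_def)
  have \<tau>int: "integrable M (\<tau> k)"
    using stopping_bounds[OF \<tau>] horizon_pos by (intro integrable_const_bound[where B=T]) auto
  have "expectation (\<tau> k) \<noteq> 0"
  proof
    assume "expectation (\<tau> k) = 0"
    then have "AE \<omega> in M. \<tau> k \<omega> = 0"
      using stopping_bounds[OF \<tau>] \<tau>int by (subst (asm) integral_nonneg_eq_0_iff_AE) auto
    then have "AE \<omega> in M. \<not> \<tau> k \<omega> = T" using horizon_pos by auto
    then have "emeasure M {\<omega>\<in>space M. \<tau> k \<omega> = T} = 0"
      by (subst (asm) AE_iff_measurable[OF _ refl]) auto
    with k show False by simp
  qed
  then show "expectation (L T) = 0"
    using wald_identity[OF LT \<tau> L\<tau>(1)] L\<tau>(2) horizon_pos by simp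
qed

end

section \<open>Comparison of the classes\<close>

context levy_setting
begin

lemma M_efl_subset_M_a: "M_efl M T F L \<subseteq> M_a M T F L"
  by (auto simp: M_efl_def M_a_def)

lemma M_a_subset_M_loc_a: "M_a M T F L \<subseteq> M_loc_a M T F L"
proof
  fix Q assume Q: "Q \<in> M_a M T F L"
  then have mart: "martingale_upto Q T F L" by (simp add: M_a_def)
  have "martingale_upto Q T F (\<lambda>t \<omega>. L (min t T) \<omega>)"
    unfolding martingale_upto_def adapted_upto_def
  proof (intro conjI ballI allI impI)
    show "L (min t T) \<in> borel_measurable (F t)" "integrable Q (L (min t T))" if "t \<in> {0..T}" for t
      using mart that by (simp_all add: martingale_upto_def adapted_upto_def min_absorb1)
    fix s t assume st: "0 \<le> s \<and> s \<le> t \<and> t \<le> T"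
    then have "min s T = s" "min t T = t" by auto
    then show "AE \<omega> in Q. real_cond_exp Q (F s) (L (min t T)) \<omega> = L (min s T) \<omega>"
      using mart st unfolding martingale_upto_def by simp
  qed
  moreover have "stopping_time_upto T F (\<lambda>_. T)"
    using horizon_pos by (simp add: stopping_time_upto_def stopping_time_const)
  ultimately have "local_martingale_upto Q T F L"
    unfolding local_martingale_upto_def by (intro exI[of _ "\<lambda>_ _. T"]) (simp add: incseq_def)
  with Q show "Q \<in> M_loc_a M T F L" by (simp add: M_a_def M_loc_a_def)
qed

lemma M_tilde_a_subset_M_hat_loc_a: "M_tilde_a M T F L \<subseteq> M_hat_loc_a M T F L"
proof
  fix Q assume Q: "Q \<in> M_tilde_a M T F L"
  have "stopping_time_upto T F (\<lambda>_. T)"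
    using horizon_pos by (simp add: stopping_time_upto_def stopping_time_const)
  with Q have "Q \<in> M_tilde_loc0_a M T F L"
    unfolding M_tilde_loc0_a_def M_tilde_a_def
    by (auto intro!: exI[of _ "\<lambda>_ _. T"] simp: incseq_def)
  then show "Q \<in> M_hat_loc_a M T F L" by (simp add: M_hat_loc_a_def)
qed

text \<open>
  The density is bounded, and \<open>f ln f = f * (v * L\<^sub>T - ln m)\<close> has integral \<open>- ln m\<close> because \<open>L\<^sub>T\<close> is
  centred under it.
\<close>
lemma truncated_tilt_in_M_tilde_a:
  fixes v :: real and n :: nat
  defines "tr \<equiv> {\<omega>\<in>space M. \<bar>L T \<omega>\<bar> \<le> real n}"
  assumes mean: "expectation (\<lambda>\<omega>. L T \<omega> * exp (v * L T \<omega>) * indicator tr \<omega>) = 0"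
    and mass: "m = expectation (\<lambda>\<omega>. exp (v * L T \<omega>) * indicator tr \<omega>)" "0 < m"
  shows "\<exists>Q\<in>M_tilde_a M T F L. relative_entropy Q (restr_to_subalg M (F T)) = ereal (- ln m)"
proof -
  define N where "N = restr_to_subalg M (F T)"
  have setsN[measurable_cong]: "sets N = sets (F T)" by (simp add: N_def sets_restr_to_subalg[OF subalgebra_F])
  interpret N: prob_space N
    unfolding N_def by (rule prob_space_restr_to_subalg[OF subalgebra_F prob_space_axioms])
  have LF[measurable]: "L T \<in> borel_measurable (F T)" using L_measurable_F[of T T] horizon_pos by simp
  have LM[measurable]: "L T \<in> borel_measurable M" using L_measurable[of T] horizon_pos by simp
  have trF: "tr \<in> sets (F T)"
  proof -
    have "{\<omega>\<in>space (F T). \<bar>L T \<omega>\<bar> \<le> real n} \<in> sets (F T)" by measurable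
    then show ?thesis by (simp add: tr_def space_F)
  qed
  note trF[measurable]
  define f where "f \<omega> = exp (v * L T \<omega>) * indicator tr \<omega> / m" for \<omega>
  have fF[measurable]: "f \<in> borel_measurable (F T)" unfolding f_def by measurable
  have fN[measurable]: "f \<in> borel_measurable N" using fF by (simp add: measurable_cong_sets[OF setsN refl])
  have LN[measurable]: "L T \<in> borel_measurable N" using LF by (simp add: measurable_cong_sets[OF setsN refl])
  have f0: "0 \<le> f \<omega>" for \<omega> using mass(2) by (simp add: f_def)
  have intM: "integrable M (\<lambda>\<omega>. exp (v * L T \<omega>) * indicator tr \<omega>)"
    "integrable M (\<lambda>\<omega>. L T \<omega> * exp (v * L T \<omega>) * indicator tr \<omega>)"
    unfolding tr_def by (rule integrable_trunc_exp[OF LM], rule integrable_trunc_id_exp[OF LM])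
  have toN: "integrable N g" "(\<integral>\<omega>. g \<omega> \<partial>N) = (\<integral>\<omega>. g \<omega> \<partial>M)"
    if "g \<in> borel_measurable (F T)" "integrable M g" for g :: "'a \<Rightarrow> real"
    unfolding N_def by (rule integrable_in_subalg[OF subalgebra_F that])
      (rule integral_subalgebra2[OF subalgebra_F that(1)])
  have intf: "integrable M f" "expectation f = 1"
    unfolding f_def using intM(1) mass by simp_all
  have intLf: "integrable M (\<lambda>\<omega>. f \<omega> * L T \<omega>)" "expectation (\<lambda>\<omega>. f \<omega> * L T \<omega>) = 0"
  proof -
    have eq: "f \<omega> * L T \<omega> = (L T \<omega> * exp (v * L T \<omega>) * indicator tr \<omega>) / m" for \<omega>
      by (simp add: f_def)
    show "integrable M (\<lambda>\<omega>. f \<omega> * L T \<omega>)" "expectation (\<lambda>\<omega>. f \<omega> * L T \<omega>) = 0"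
      unfolding eq using intM(2) mean by simp_all
  qed
  have flnf: "f \<omega> * ln (f \<omega>) = v * (f \<omega> * L T \<omega>) - ln m * f \<omega>" for \<omega>
  proof (cases "\<omega> \<in> tr")
    case True
    then have "ln (f \<omega>) = v * L T \<omega> - ln m" using mass(2) by (simp add: f_def ln_div)
    then show ?thesis by (simp add: right_diff_distrib mult.commute mult.left_commute)
  qed (simp add: f_def)
  have int_flnf: "integrable M (\<lambda>\<omega>. f \<omega> * ln (f \<omega>))" "expectation (\<lambda>\<omega>. f \<omega> * ln (f \<omega>)) = - ln m"
    unfolding flnf using intf intLf by simp_all
  define Q where "Q = density N (\<lambda>\<omega>. ennreal (f \<omega>))"
  have Qprob: "prob_space Q"
  proof (rule prob_spaceI)
    have "emeasure Q (space Q) = (\<integral>\<^sup>+\<omega>. ennreal (f \<omega>) \<partial>N)"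
      by (simp add: Q_def emeasure_density nn_integral_set_ennreal cong: nn_integral_cong)
    also have "\<dots> = ennreal (\<integral>\<omega>. f \<omega> \<partial>N)"
      by (rule nn_integral_eq_integral) (use toN(1)[OF fF intf(1)] f0 in auto)
    finally show "emeasure Q (space Q) = 1" by (simp add: toN(2)[OF fF intf(1)] intf(2))
  qed
  have LfF: "(\<lambda>\<omega>. f \<omega> * L T \<omega>) \<in> borel_measurable (F T)" "(\<lambda>\<omega>. f \<omega> * ln (f \<omega>)) \<in> borel_measurable (F T)"
    by measurable
  have "integrable Q (L T)"
    unfolding Q_def
    by (subst integrable_real_density) (use f0 toN(1)[OF LfF(1) intLf(1)] in auto)
  moreover have "(\<integral>\<omega>. L T \<omega> \<partial>Q) = 0"
    unfolding Q_def
    by (subst integral_real_density) (use f0 toN(2)[OF LfF(1) intLf(1)] intLf(2) in auto)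
  moreover have "Q \<in> ac_measures M T F"
    using Qprob by (auto simp: ac_measures_def Q_def setsN N_def[symmetric] intro!: absolutely_continuousI_density)
  ultimately have "Q \<in> M_tilde_a M T F L" by (simp add: M_tilde_a_def)
  moreover have "relative_entropy Q N = ereal (- ln m)"
    unfolding Q_def
    using relative_entropy_density[OF N.sigma_finite_measure_axioms fN f0 toN(1)[OF LfF(2) int_flnf(1)]]
    by (simp add: toN(2)[OF LfF(2) int_flnf(1)] int_flnf(2))
  ultimately show ?thesis unfolding N_def by blast
qed

lemma restr_absolutely_continuous_esscher:
  assumes "0 < c" shows "absolutely_continuous (esscher u c) (restr_to_subalg M (F T))"
proof -
  have [measurable]: "L T \<in> borel_measurable (F T)" using L_measurable_F[of T T] horizon_pos by simp
  have m: "(\<lambda>\<omega>. ennreal (exp (u * L T \<omega>) / c)) \<in> borel_measurable (restr_to_subalg M (F T))"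
    by (rule measurable_in_subalg[OF subalgebra_F]) measurable
  show ?thesis
    unfolding absolutely_continuous_def esscher_def
  proof
    fix A assume "A \<in> null_sets (density (restr_to_subalg M (F T)) (\<lambda>\<omega>. ennreal (exp (u * L T \<omega>) / c)))"
    then have A: "A \<in> sets (restr_to_subalg M (F T))"
      and "AE \<omega> in restr_to_subalg M (F T). \<omega> \<in> A \<longrightarrow> ennreal (exp (u * L T \<omega>) / c) = 0"
      by (simp_all add: null_sets_density_iff[OF m])
    then have "AE \<omega> in restr_to_subalg M (F T). \<omega> \<notin> A"
      using assms by (auto simp: ennreal_eq_0_iff divide_le_0_iff elim!: eventually_mono)
    with A show "A \<in> null_sets (restr_to_subalg M (F T))" by (simp add: AE_iff_null_sets)
  qed
qed

lemma prob_neg_of_not_subordinator: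
  assumes "\<not> subordinator M T F L" shows "0 < prob {\<omega>\<in>space M. L T \<omega> < 0}"
proof (rule ccontr)
  have [measurable]: "L T \<in> borel_measurable M" using L_measurable[of T] horizon_pos by simp
  assume "\<not> ?thesis"
  then have "prob {\<omega>\<in>space M. L T \<omega> < 0} = 0" by (simp add: zero_less_measure_iff)
  then have "AE \<omega> in M. \<not> L T \<omega> < 0" by (subst (asm) prob_eq_0) auto
  then have "AE \<omega> in M. 0 \<le> L T \<omega>" by (simp add: not_less)
  with assms subordinator_of_nonneg show False by blast
qed

end

theorem corollary4p7:
  fixes P Pstar :: "'a measure"
    and F :: "real \<Rightarrow> 'a measure"
    and L :: "real \<Rightarrow> 'a \<Rightarrow> real"
    and T :: real
  assumes "prob_space P"
    and "T > 0"
    and "filtration (space P) F"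
    and "subalgebra P (F T)"
    and "levy_process P T F L"
    and "\<not> subordinator P T F L"
    and "\<not> subordinator P T F (\<lambda>t \<omega>. - L t \<omega>)"
    and "is_MEMM P T F (M_hat_loc_a P T F L) Pstar"
  shows "\<forall>C \<in> {M_tilde_a P T F L, M_loc_a P T F L, M_a P T F L, M_efl P T F L}.
           is_MEMM P T F C Pstar \<and> (\<forall>Q. is_MEMM P T F C Q \<longrightarrow> Q = Pstar)"
proof -
  interpret levy_setting P T F L by (rule levy_setting.intro) (use assms in simp_all)
  interpret minus: levy_setting P T F "\<lambda>t \<omega>. - L t \<omega>" by (rule levy_setting_uminus)
  define I where "I Q = relative_entropy Q (restr_to_subalg P (F T))" for Q
  let ?hat = "M_hat_loc_a P T F L"

  have "L T \<in> borel_measurable P" using L_measurable[of T] horizon_pos by simp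
  moreover have "0 < prob {\<omega>\<in>space P. 0 < L T \<omega>}"
    using minus.prob_neg_of_not_subordinator[OF assms(7)] by simp
  moreover have "0 < prob {\<omega>\<in>space P. L T \<omega> < 0}"
    by (rule prob_neg_of_not_subordinator[OF assms(6)])
  ultimately obtain u c where c: "(\<integral>\<^sup>+\<omega>. ennreal (exp (u * L T \<omega>)) \<partial>P) = ennreal c" "0 < c"
    and tilts: "\<And>c'. c' < c \<Longrightarrow> \<exists>v n.
      expectation (\<lambda>\<omega>. L T \<omega> * exp (v * L T \<omega>) * indicator {\<omega>\<in>space P. \<bar>L T \<omega>\<bar> \<le> real n} \<omega>) = 0 \<and>
      c' < expectation (\<lambda>\<omega>. exp (v * L T \<omega>) * indicator {\<omega>\<in>space P. \<bar>L T \<omega>\<bar> \<le> real n} \<omega>)"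
    by (rule truncated_exponential_tilts) blast

  \<comment> \<open>The truncated tilts have entropy arbitrarily close to \<open>- ln c\<close> or below it.\<close>
  have inf_le: "(INF Q\<in>?hat. I Q) \<le> ereal (- ln c)"
  proof (rule ccontr)
    assume "\<not> ?thesis"
    then obtain z where z: "ereal (- ln c) < ereal z" "ereal z < (INF Q\<in>?hat. I Q)"
      using ereal_dense2[of "ereal (- ln c)"] by (auto simp: not_le)
    have "exp (- z) < c"
    proof -
      have "exp (- z) < exp (ln c)" using z(1) by (subst exp_less_cancel_iff) simp
      then show ?thesis using c(2) by simp
    qed
    then obtain v n where
      v: "expectation (\<lambda>\<omega>. L T \<omega> * exp (v * L T \<omega>) * indicator {\<omega>\<in>space P. \<bar>L T \<omega>\<bar> \<le> real n} \<omega>) = 0"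
        "exp (- z) < expectation (\<lambda>\<omega>. exp (v * L T \<omega>) * indicator {\<omega>\<in>space P. \<bar>L T \<omega>\<bar> \<le> real n} \<omega>)"
      (is "_ < ?m")
      using tilts by blast
    have m: "0 < ?m" using v(2) by (rule less_trans[rotated]) simp
    then obtain Q where Q: "Q \<in> M_tilde_a P T F L" "I Q = ereal (- ln ?m)"
      using truncated_tilt_in_M_tilde_a[OF v(1) refl m] by (auto simp: I_def)
    have "ln (exp (- z)) < ln ?m" using v(2) by (intro ln_less_cancel_iff[THEN iffD2] m) auto
    then have "- z < ln ?m" by simp
    then have "I Q < ereal z" by (simp add: Q(2))
    moreover have "(INF Q\<in>?hat. I Q) \<le> I Q"
      using Q(1) M_tilde_a_subset_M_hat_loc_a by (intro INF_lower) auto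
    ultimately show False using z(2) by (meson less_le_not_le order_less_trans order_trans)
  qed

  have rigid: "Q = esscher u c" if "Q \<in> ?hat" "I Q \<le> ereal (- ln c)" for Q
  proof -
    obtain \<tau> where "Q \<in> ac_measures P T F" "centred_localizing_sequence Q T F L \<tau>"
      by (rule M_hat_loc_a_localizing[OF \<open>Q \<in> ?hat\<close>]) blast
    then show ?thesis
      using that(2) esscher_of_relative_entropy_le[OF c] unfolding I_def by blast
  qed
  have Pstar: "Pstar \<in> ?hat" "I Pstar = (INF Q\<in>?hat. I Q)"
    using assms(8) by (auto simp: is_MEMM_def I_def)
  then have I_Pstar: "I Pstar \<le> ereal (- ln c)" using inf_le by simp
  have Pstar_eq: "Pstar = esscher u c" by (rule rigid[OF Pstar(1) I_Pstar])

  interpret star: levy_setting Pstar T F L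
    unfolding Pstar_eq by (rule levy_setting_esscher[OF c])
  obtain \<tau> where \<tau>: "Pstar \<in> ac_measures P T F" "centred_localizing_sequence Pstar T F L \<tau>"
    "integrable Pstar (L T) \<or> (\<forall>k. martingale_upto Pstar T F (\<lambda>t \<omega>. L (min t (\<tau> k \<omega>)) \<omega>))"
    by (rule M_hat_loc_a_localizing[OF Pstar(1)])
  note centred = star.centred_of_localizing[OF \<tau>(2,3)]
  have tilde: "Pstar \<in> M_tilde_a P T F L"
    using \<tau>(1) centred by (simp add: M_tilde_a_def)
  have efl: "Pstar \<in> M_efl P T F L"
    unfolding M_efl_def
  proof (intro CollectI conjI)
    show "absolutely_continuous Pstar (restr_to_subalg P (F T))"
      unfolding Pstar_eq by (rule restr_absolutely_continuous_esscher[OF c(2)])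
    show "relative_entropy Pstar (restr_to_subalg P (F T)) < \<infinity>"
      using I_Pstar unfolding I_def by (rule le_less_trans) simp
  qed (use \<tau>(1) star.martingale_of_mean_zero[OF centred] star.levy in simp_all)

  have minimal: "is_MEMM P T F C Pstar \<and> (\<forall>Q. is_MEMM P T F C Q \<longrightarrow> Q = Pstar)"
    if mem: "Pstar \<in> C" and sub: "C \<subseteq> ?hat" for C
  proof -
    have "(INF Q\<in>?hat. I Q) \<le> (INF Q\<in>C. I Q)" using sub by (intro INF_superset_mono) auto
    moreover have "(INF Q\<in>C. I Q) \<le> I Pstar" using mem by (rule INF_lower)
    ultimately have inf: "(INF Q\<in>C. I Q) = I Pstar" using Pstar(2) by simp
    show ?thesis
    proof (intro conjI allI impI)
      show "is_MEMM P T F C Pstar" using mem inf by (simp add: is_MEMM_def I_def)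
      fix Q assume "is_MEMM P T F C Q"
      then have "Q \<in> C" "I Q = I Pstar" using inf by (simp_all add: is_MEMM_def I_def)
      then show "Q = Pstar" using rigid[of Q] sub I_Pstar Pstar_eq by auto
    qed
  qed
  have chain: "M_efl P T F L \<subseteq> M_a P T F L" "M_a P T F L \<subseteq> M_loc_a P T F L" "M_loc_a P T F L \<subseteq> ?hat"
    using M_efl_subset_M_a M_a_subset_M_loc_a by (auto simp: M_hat_loc_a_def)
  show ?thesis
  proof
    fix C assume "C \<in> {M_tilde_a P T F L, M_loc_a P T F L, M_a P T F L, M_efl P T F L}"
    then have "Pstar \<in> C" "C \<subseteq> ?hat"
      using tilde efl chain M_tilde_a_subset_M_hat_loc_a by auto
    then show "is_MEMM P T F C Pstar \<and> (\<forall>Q. is_MEMM P T F C Q \<longrightarrow> Q = Pstar)"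
      by (rule minimal)
  qed
qed

end
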